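(* Let $K$ be a field, $n\ge 1$, $S=K[x_1,\ldots,x_n]$, and let $0\le s\le n$. Let $\alpha: a_1<a_2<\cdots<a_s$ and $\beta: b_1<b_2<\cdots<b_s$ be sequences of integers with $1\le a_1$, $b_s\le n$ and $a_i\le b_i$ for all $1\le i\le s$, and let $I_{\alpha,\beta}=(x_{a_1}x_{a_1+1}\cdots x_{b_1},\ldots,x_{a_s}x_{a_s+1}\cdots x_{b_s})\subset S$ (with $I_{\alpha,\beta}=0$ if $s=0$). If $a_{k+2}=b_k+1$ for all $1\le k\le s-2$, then $$\operatorname{sdepth}(S/I_{\alpha,\beta})=\operatorname{depth}(S/I_{\alpha,\beta})=n-s+\left\lfloor\frac{s}{3}\right\rfloor.$$
   Context: Stanley depth: for a finitely generated $\mathbb Z^n$-graded $S$-module $M$, a Stanley decomposition of $M$ is a direct sum $\mathcal D: M=\bigoplus_{i=1}^r m_iK[Z_i]$ as $\mathbb Z^n$-graded $K$-vector spaces, where each $m_i\in M$ is homogeneous for the $\mathbb Z^n$-grading, $Z_i\subset\{x_1,\ldots,x_n\}$, and $m_iK[Z_i]=\{um_i: u\in K[Z_i]\}$ is a free $K[Z_i]$-submodule of $M$. Set $\operatorname{sdepth}(\mathcal D)=\min_i|Z_i|$ and $\operatorname{sdepth}(M)=\max\{\operatorname{sdepth}(\mathcal D):\mathcal D \text{ a Stanley decomposition of } M\}$. Depth is with respect to the graded maximal ideal $(x_1,\ldots,x_n)$. *)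

theory Defs
  imports "HOL-Algebra.QuotRing" "HOL-Algebra.Module" "HOL-Library.Poly_Mapping"
begin

section \<open>Polynomial rings and quotient modules\<close>

text \<open>Polynomials in variables \<open>x\<^sub>i\<close> indexed by natural numbers: finitely supported maps from
  exponent vectors to coefficients.\<close>

type_synonym 'k mpoly = "(nat \<Rightarrow>\<^sub>0 nat) \<Rightarrow>\<^sub>0 'k"

text \<open>The ring \<open>K[V]\<close> for a set \<open>V\<close> of variable indices, where \<open>K\<close> is the field on the type \<open>'k\<close>.
  All these rings live inside one type, so \<open>K[Z] \<subseteq> K[V]\<close> as carriers whenever \<open>Z \<subseteq> V\<close>.\<close>

definition poly_ring :: "nat set \<Rightarrow> 'k::field mpoly ring" where
  "poly_ring V =
    \<lparr>carrier = {p. \<forall>e \<in> Poly_Mapping.keys p. Poly_Mapping.keys e \<subseteq> V},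
     mult = (*), one = 1, zero = 0, add = (+)\<rparr>"

definition var :: "nat \<Rightarrow> 'k::field mpoly" where
  "var i = Poly_Mapping.single (Poly_Mapping.single i 1) 1"

text \<open>\<open>R/I\<close> as an \<open>R\<close>-module. The multiplicative fields of the record are irrelevant to the module
  structure and are taken from the quotient ring.\<close>

definition quotient_module :: "('a, 'r) ring_scheme \<Rightarrow> 'a set \<Rightarrow> ('a, 'a set) module" where
  "quotient_module R I =
    \<lparr>carrier = carrier (R Quot I), mult = mult (R Quot I), one = one (R Quot I),
     zero = zero (R Quot I), add = add (R Quot I),
     smult = (\<lambda>r X. (I +>\<^bsub>R\<^esub> r) \<otimes>\<^bsub>R Quot I\<^esub> X)\<rparr>"

section \<open>Depth\<close>

text \<open>The submodule \<open>(f\<^sub>0, \<dots>, f\<^sub>r\<^sub>-\<^sub>1) M\<close>.\<close>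

definition list_submodule :: "('a, 'm, 'z) module_scheme \<Rightarrow> 'a list \<Rightarrow> 'm set" where
  "list_submodule M fs =
    {(\<Oplus>\<^bsub>M\<^esub>j\<in>{..<length fs}. (fs ! j) \<odot>\<^bsub>M\<^esub> y j) | y. y \<in> {..<length fs} \<rightarrow> carrier M}"

text \<open>The first condition says that \<open>f\<^sub>i\<close> is a nonzerodivisor on \<open>M / (f\<^sub>0, \<dots>, f\<^sub>i\<^sub>-\<^sub>1) M\<close>.\<close>

definition regular_sequence ::
  "('a, 'r) ring_scheme \<Rightarrow> ('a, 'm, 'z) module_scheme \<Rightarrow> 'a list \<Rightarrow> bool" where
  "regular_sequence R M fs \<longleftrightarrow>
    set fs \<subseteq> carrier R \<and>
    (\<forall>i < length fs. \<forall>x \<in> carrier M.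
       (fs ! i) \<odot>\<^bsub>M\<^esub> x \<in> list_submodule M (take i fs) \<longrightarrow> x \<in> list_submodule M (take i fs)) \<and>
    list_submodule M fs \<noteq> carrier M"

definition depth ::
  "('a, 'r) ring_scheme \<Rightarrow> 'a set \<Rightarrow> ('a, 'm, 'z) module_scheme \<Rightarrow> nat" where
  "depth R J M = Max {length fs | fs. regular_sequence R M fs \<and> set fs \<subseteq> J}"

definition graded_maximal_ideal :: "nat \<Rightarrow> 'k::field mpoly set" where
  "graded_maximal_ideal n = Idl\<^bsub>poly_ring {1..n}\<^esub> (var ` {1..n})"

section \<open>Stanley depth\<close>

text \<open>Elements of \<open>\<int>\<^sup>n\<close> are functions supported in \<open>{1..n}\<close>. A \<open>\<int>\<^sup>n\<close>-grading of \<open>M\<close> is given by its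
  family \<open>G\<close> of homogeneous components.\<close>

definition degrees :: "nat \<Rightarrow> (nat \<Rightarrow> int) set" where
  "degrees n = {g. \<forall>i. i \<notin> {1..n} \<longrightarrow> g i = 0}"

definition homogeneous :: "nat \<Rightarrow> ((nat \<Rightarrow> int) \<Rightarrow> 'm set) \<Rightarrow> 'm \<Rightarrow> bool" where
  "homogeneous n G m \<longleftrightarrow> (\<exists>g \<in> degrees n. m \<in> G g)"

definition stanley_space ::
  "('k::field mpoly, 'm, 'z) module_scheme \<Rightarrow> 'm \<Rightarrow> nat set \<Rightarrow> 'm set" where
  "stanley_space M m Z = {u \<odot>\<^bsub>M\<^esub> m | u. u \<in> carrier (poly_ring Z)}"

text \<open>\<open>m K[Z]\<close> is free over \<open>K[Z]\<close> with basis \<open>m\<close>; in particular \<open>m \<noteq> 0\<close>.\<close>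

definition free_stanley_space ::
  "('k::field mpoly, 'm, 'z) module_scheme \<Rightarrow> 'm \<Rightarrow> nat set \<Rightarrow> bool" where
  "free_stanley_space M m Z \<longleftrightarrow>
    (\<forall>u \<in> carrier (poly_ring Z). u \<odot>\<^bsub>M\<^esub> m = \<zero>\<^bsub>M\<^esub> \<longrightarrow> u = 0)"

definition internal_direct_sum :: "('a, 'm, 'z) module_scheme \<Rightarrow> 'm set list \<Rightarrow> bool" where
  "internal_direct_sum M Ns \<longleftrightarrow>
    (\<forall>N \<in> set Ns. N \<subseteq> carrier M) \<and>
    (\<forall>x \<in> carrier M. \<exists>!y. y \<in> (\<Pi>\<^sub>E i\<in>{..<length Ns}. Ns ! i) \<and>
       x = (\<Oplus>\<^bsub>M\<^esub>i\<in>{..<length Ns}. y i))"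

text \<open>A Stanley decomposition is recorded as the list of pairs \<open>(m\<^sub>i, Z\<^sub>i)\<close>, with variables named by
  their indices. Compatibility of the direct sum with the grading needs no separate clause: each
  \<open>m\<^sub>i\<close> is homogeneous, so each \<open>m\<^sub>i K[Z\<^sub>i]\<close> is a graded subspace.\<close>

definition stanley_decomposition ::
  "nat \<Rightarrow> ('k::field mpoly, 'm, 'z) module_scheme \<Rightarrow> ((nat \<Rightarrow> int) \<Rightarrow> 'm set) \<Rightarrow>
     ('m \<times> nat set) list \<Rightarrow> bool" where
  "stanley_decomposition n M G D \<longleftrightarrow>
    (\<forall>(m, Z) \<in> set D. m \<in> carrier M \<and> homogeneous n G m \<and> Z \<subseteq> {1..n} \<and>
       free_stanley_space M m Z) \<and>
    internal_direct_sum M (map (\<lambda>(m, Z). stanley_space M m Z) D)"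

definition sdepth_decomposition :: "('m \<times> nat set) list \<Rightarrow> nat" where
  "sdepth_decomposition D = Min {card Z | m Z. (m, Z) \<in> set D}"

definition sdepth ::
  "nat \<Rightarrow> ('k::field mpoly, 'm, 'z) module_scheme \<Rightarrow> ((nat \<Rightarrow> int) \<Rightarrow> 'm set) \<Rightarrow> nat" where
  "sdepth n M G = Max {sdepth_decomposition D | D. stanley_decomposition n M G D}"

text \<open>The standard \<open>\<int>\<^sup>n\<close>-grading of \<open>S/I\<close> for a monomial ideal \<open>I\<close>: the component of degree \<open>g\<close> is the
  image of \<open>K x\<^sup>g\<close>, which is zero if \<open>g\<close> has a negative entry.\<close>

definition quotient_grading ::
  "nat \<Rightarrow> 'k::field mpoly set \<Rightarrow> (nat \<Rightarrow> int) \<Rightarrow> 'k mpoly set set" where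
  "quotient_grading n I g =
    {I +>\<^bsub>poly_ring {1..n}\<^esub> p | p. p \<in> carrier (poly_ring {1..n}) \<and>
       (\<forall>e \<in> Poly_Mapping.keys p. \<forall>i. int (Poly_Mapping.lookup e i) = g i)}"

section \<open>The ideals \<open>I\<^sub>\<alpha>\<^sub>,\<^sub>\<beta>\<close>\<close>

definition interval_ideal ::
  "nat \<Rightarrow> nat \<Rightarrow> (nat \<Rightarrow> nat) \<Rightarrow> (nat \<Rightarrow> nat) \<Rightarrow> 'k::field mpoly set" where
  "interval_ideal n s a b =
    Idl\<^bsub>poly_ring {1..n}\<^esub> ((\<lambda>k. \<Prod>i\<in>{a k..b k}. var i) ` {1..s})"

end

theory Submission
  imports Defs
begin

text \<open>The intervals are the edges of a path on \<open>s + 1\<close> blocks of variables, because every interval is the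
  union of two consecutive blocks and the blocks are pairwise disjoint. Let \<open>\<Delta>\<close> be the complex of
  all sets of variables containing no interval, so that \<open>I\<close> is spanned by the monomials whose
  set of variables is not in \<open>\<Delta>\<close>. Both invariants are squeezed between two bounds in terms of \<open>\<Delta>\<close>.

  Upper bounds come from a facet \<open>F\<close>. Its monomial \<open>x\<^sup>F\<close> is annihilated modulo \<open>I\<close> by every variable
  outside \<open>F\<close> and generates a copy of \<open>K[F]\<close>. The Stanley space that meets the degree of \<open>x\<^sup>F\<close> can
  therefore only involve variables of \<open>F\<close> (\<open>stanley_space_in_facet\<close>). A regular sequence longer
  than \<open>card F\<close> would be algebraically dependent on \<open>K[F]\<close>, whereas no nonzero polynomial over \<open>K\<close>
  in the members of a regular sequence annihilates an element of finite order
  (\<open>regular_sequence_independent\<close>, \<open>regular_length_le_facet\<close>).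

  Lower bounds come from splitting \<open>\<Delta>\<close> repeatedly into the link and the deletion of a vertex until
  simplices with at least \<open>d\<close> vertices remain (\<open>decomposable\<close>). For the Stanley depth this partitions
  the monomials outside \<open>I\<close> into cones (\<open>decomposable_cone_partition\<close>). For the depth it filters
  \<open>S/I\<close> by polynomial rings in at least \<open>d\<close> of the variables. The elementary symmetric polynomials
  \<open>e\<^sub>1, \<dots>, e\<^sub>d\<close> are a regular sequence on all of these rings at once
  (\<open>elementary_symmetric_regular\<close>), hence also on \<open>S/I\<close> (\<open>regular_colon\<close>).

  It remains to split the complex of a path. Keeping all of the second block forces one variable
  of each neighbouring block to be dropped and removes three blocks; dropping a variable of the
  second block removes two blocks (\<open>decomposable_path\<close>). At least \<open>n - s + s div 3\<close> variables survive in
  every case, and a facet with exactly that many arises from always taking the first choice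
  (\<open>path_facet\<close>).\<close>

section \<open>Regular sequences modulo an ideal\<close>

text \<open>Rings are subsets of a commutative ring type and ideals are subsets of them, so that every
  quotient \<open>S/N\<close> is handled through the ideal \<open>N\<close> alone.\<close>

locale subring_set =
  fixes S :: "'a::comm_ring_1 set"
  assumes zero_in [simp, intro]: "0 \<in> S"
    and one_in [simp, intro]: "1 \<in> S"
    and add_in [simp, intro]: "x \<in> S \<Longrightarrow> y \<in> S \<Longrightarrow> x + y \<in> S"
    and uminus_in [simp, intro]: "x \<in> S \<Longrightarrow> - x \<in> S"
    and mult_in [simp, intro]: "x \<in> S \<Longrightarrow> y \<in> S \<Longrightarrow> x * y \<in> S"
begin

lemma diff_in [simp, intro]: "x \<in> S \<Longrightarrow> y \<in> S \<Longrightarrow> x - y \<in> S"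
  using add_in[of x "- y"] by simp

lemma sum_in: "(\<And>i. i \<in> A \<Longrightarrow> g i \<in> S) \<Longrightarrow> sum g A \<in> S"
  by (induction A rule: infinite_finite_induct) auto

lemma power_in: "x \<in> S \<Longrightarrow> x ^ k \<in> S"
  by (induction k) auto

definition is_ideal :: "'a set \<Rightarrow> bool" where
  "is_ideal N \<longleftrightarrow> N \<subseteq> S \<and> 0 \<in> N \<and> (\<forall>x\<in>N. \<forall>y\<in>N. x + y \<in> N) \<and> (\<forall>s\<in>S. \<forall>x\<in>N. s * x \<in> N)"

lemma is_idealD:
  assumes "is_ideal N"
  shows "x \<in> N \<Longrightarrow> x \<in> S" "0 \<in> N" "x \<in> N \<Longrightarrow> y \<in> N \<Longrightarrow> x + y \<in> N"
    "s \<in> S \<Longrightarrow> x \<in> N \<Longrightarrow> s * x \<in> N" "x \<in> N \<Longrightarrow> y \<in> N \<Longrightarrow> x - y \<in> N"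
proof -
  show "x - y \<in> N" if "x \<in> N" "y \<in> N"
  proof -
    have "- 1 * y \<in> N" using assms that unfolding is_ideal_def by blast
    then have "x + - 1 * y \<in> N" using assms that unfolding is_ideal_def by blast
    then show ?thesis by simp
  qed
qed (use assms in \<open>auto simp: is_ideal_def\<close>)

lemma ideal_sum:
  "is_ideal N \<Longrightarrow> (\<And>i. i \<in> B \<Longrightarrow> g i \<in> N) \<Longrightarrow> sum g B \<in> N"
  by (induction B rule: infinite_finite_induct) (auto intro: is_idealD)

definition adjoin :: "'a set \<Rightarrow> 'a \<Rightarrow> 'a set" where
  "adjoin N f = {a + f * b | a b. a \<in> N \<and> b \<in> S}"

lemma adjoinI: "a \<in> N \<Longrightarrow> b \<in> S \<Longrightarrow> x = a + f * b \<Longrightarrow> x \<in> adjoin N f"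
  by (auto simp: adjoin_def)

lemma adjoin_ideal [intro]:
  assumes N: "is_ideal N" and f: "f \<in> S"
  shows "is_ideal (adjoin N f)"
proof -
  have "x + y \<in> adjoin N f" if "x \<in> adjoin N f" "y \<in> adjoin N f" for x y
  proof -
    from that obtain a b a' b' where "x = a + f * b" "y = a' + f * b'"
      "a \<in> N" "a' \<in> N" "b \<in> S" "b' \<in> S" by (auto simp: adjoin_def)
    then show ?thesis using is_idealD(3)[OF N]
      by (intro adjoinI[of "a + a'" _ "b + b'"]) (auto simp: algebra_simps)
  qed
  moreover have "s * x \<in> adjoin N f" if "x \<in> adjoin N f" "s \<in> S" for x s
  proof -
    from that obtain a b where "x = a + f * b" "a \<in> N" "b \<in> S" by (auto simp: adjoin_def)
    then show ?thesis using is_idealD(4)[OF N] that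
      by (intro adjoinI[of "s * a" _ "s * b"]) (auto simp: distrib_left mult.left_commute)
  qed
  moreover have "adjoin N f \<subseteq> S" using is_idealD(1)[OF N] f by (auto simp: adjoin_def)
  moreover have "0 \<in> adjoin N f" using is_idealD(2)[OF N] by (intro adjoinI[of 0 _ 0]) auto
  ultimately show ?thesis
    unfolding is_ideal_def by blast
qed

lemma subset_adjoin: "N \<subseteq> adjoin N f"
  by (auto intro: adjoinI[of _ _ 0])

lemma mult_in_adjoin: "is_ideal N \<Longrightarrow> b \<in> S \<Longrightarrow> f * b \<in> adjoin N f"
  by (rule adjoinI[of 0]) (auto simp: is_ideal_def)

lemma adjoin_commute: "adjoin (adjoin N f) g = adjoin (adjoin N g) f"
proof -
  have "adjoin (adjoin N f) g \<subseteq> adjoin (adjoin N g) f" for f g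
  proof
    fix x assume "x \<in> adjoin (adjoin N f) g"
    then obtain a b c where "x = a + f * b + g * c" "a \<in> N" "b \<in> S" "c \<in> S"
      by (auto simp: adjoin_def)
    then show "x \<in> adjoin (adjoin N g) f"
      by (intro adjoinI[of "a + g * c" _ b] adjoinI[of a _ c]) (auto simp: algebra_simps)
  qed
  then show ?thesis by blast
qed

definition nonzerodivisor :: "'a set \<Rightarrow> 'a \<Rightarrow> bool" where
  "nonzerodivisor N f \<longleftrightarrow> (\<forall>x\<in>S. f * x \<in> N \<longrightarrow> x \<in> N)"

fun regular :: "'a set \<Rightarrow> 'a list \<Rightarrow> bool" where
  "regular N [] = True"
| "regular N (f # fs) = (nonzerodivisor N f \<and> regular (adjoin N f) fs)"

lemma regular_append:
  "regular N (fs @ gs) \<longleftrightarrow> regular N fs \<and> regular (fold (\<lambda>f N. adjoin N f) fs N) gs"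
  by (induction fs arbitrary: N) auto

lemma fold_adjoin_ideal:
  "is_ideal N \<Longrightarrow> set fs \<subseteq> S \<Longrightarrow> is_ideal (fold (\<lambda>f N. adjoin N f) fs N)"
  by (induction fs arbitrary: N) auto

lemma subset_fold_adjoin: "N \<subseteq> fold (\<lambda>f N. adjoin N f) fs N"
  by (induction fs arbitrary: N) (simp, metis fold_simps(2) subset_adjoin subset_trans)

lemma fold_adjoin_iff:
  "x \<in> fold (\<lambda>f N. adjoin N f) fs N \<longleftrightarrow>
    (\<exists>a\<in>N. \<exists>g. (\<forall>j<length fs. g j \<in> S) \<and> x = a + (\<Sum>j<length fs. fs ! j * g j))"
proof (induction fs arbitrary: N)
  case (Cons f fs)
  have shift: "(\<Sum>j<length (f # fs). (f # fs) ! j * g j)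
      = f * g 0 + (\<Sum>j<length fs. fs ! j * g (Suc j))" for g
    by (simp add: sum.lessThan_Suc_shift del: sum.lessThan_Suc)
  show ?case
  proof
    assume "x \<in> fold (\<lambda>f N. adjoin N f) (f # fs) N"
    then obtain a b g where ab: "a \<in> N" "b \<in> S" "\<forall>j<length fs. g j \<in> S"
      "x = a + f * b + (\<Sum>j<length fs. fs ! j * g j)"
      using Cons.IH[of "adjoin N f"] by (auto simp: adjoin_def)
    define h where "h j = (case j of 0 \<Rightarrow> b | Suc i \<Rightarrow> g i)" for j
    have "\<forall>j<length (f # fs). h j \<in> S" using ab by (auto simp: h_def split: nat.split)
    moreover have "x = a + (\<Sum>j<length (f # fs). (f # fs) ! j * h j)"
      unfolding shift ab(4) by (simp add: h_def add.assoc)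
    ultimately show "\<exists>a\<in>N. \<exists>g. (\<forall>j<length (f # fs). g j \<in> S) \<and>
        x = a + (\<Sum>j<length (f # fs). (f # fs) ! j * g j)" using ab(1) by blast
  next
    assume "\<exists>a\<in>N. \<exists>g. (\<forall>j<length (f # fs). g j \<in> S) \<and>
        x = a + (\<Sum>j<length (f # fs). (f # fs) ! j * g j)"
    then obtain a g where ag: "a \<in> N" "\<forall>j<length (f # fs). g j \<in> S"
      "x = a + (\<Sum>j<length (f # fs). (f # fs) ! j * g j)" by blast
    have "a + f * g 0 \<in> adjoin N f" using ag by (intro adjoinI[of a _ "g 0"]) auto
    moreover have "x = (a + f * g 0) + (\<Sum>j<length fs. fs ! j * g (Suc j))"
      using ag(3) unfolding shift by (simp add: add.assoc)
    moreover have "\<forall>j<length fs. g (Suc j) \<in> S" using ag(2) by simp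
    ultimately have "\<exists>a\<in>adjoin N f. \<exists>g. (\<forall>j<length fs. g j \<in> S) \<and>
        x = a + (\<Sum>j<length fs. fs ! j * g j)"
      by (intro bexI[of _ "a + f * g 0"] exI[of _ "\<lambda>j. g (Suc j)"] conjI)
    then show "x \<in> fold (\<lambda>f N. adjoin N f) (f # fs) N" using Cons.IH[of "adjoin N f"] by simp
  qed
qed auto

lemma regular_iff_nth:
  "regular N fs \<longleftrightarrow>
    (\<forall>i<length fs. nonzerodivisor (fold (\<lambda>f N. adjoin N f) (take i fs) N) (fs ! i))"
proof (induction fs rule: rev_induct)
  case (snoc f fs)
  then show ?case
    by (auto simp: regular_append less_Suc_eq nth_append)
qed simp

text \<open>In the exact sequence \<open>0 \<rightarrow> S/(N : u) \<rightarrow> S/N \<rightarrow> S/(N + uS) \<rightarrow> 0\<close>, regularity of one common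
  sequence passes from the two outer modules to the middle one. The sequence stays exact after
  dividing by each \<open>f\<close>, which is what makes the induction work.\<close>

lemma regular_colon:
  assumes "is_ideal N" "u \<in> S" "set fs \<subseteq> S"
    and "regular {x \<in> S. u * x \<in> N} fs" and "regular (adjoin N u) fs"
  shows "regular N fs"
  using assms
proof (induction fs arbitrary: N)
  case (Cons f fs)
  note N = is_idealD[OF Cons.prems(1)] and u = Cons.prems(2)
  have f: "f \<in> S" using Cons.prems by simp
  have nzd_u: "z \<in> S \<Longrightarrow> f * z \<in> adjoin N u \<Longrightarrow> z \<in> adjoin N u" for z
    using Cons.prems(5) by (auto simp: nonzerodivisor_def)
  have nzd_colon: "z \<in> S \<Longrightarrow> u * (f * z) \<in> N \<Longrightarrow> u * z \<in> N" for z
    using Cons.prems(4) f by (auto simp: nonzerodivisor_def)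
  have nzd: "x \<in> N" if x: "x \<in> S" "f * x \<in> N" for x
  proof -
    have "f * x \<in> adjoin N u" using x(2) subset_adjoin by blast
    then have "x \<in> adjoin N u" using nzd_u x(1) by simp
    then obtain a b where ab: "x = a + u * b" "a \<in> N" "b \<in> S" by (auto simp: adjoin_def)
    have "f * x - f * a \<in> N" using N(5)[OF x(2) N(4)[OF f ab(2)]] .
    then have "u * (f * b) \<in> N" using ab by (simp add: algebra_simps)
    then show ?thesis using nzd_colon[OF ab(3)] ab N(3) by simp
  qed
  have "{x \<in> S. u * x \<in> adjoin N f} = adjoin {x \<in> S. u * x \<in> N} f"
  proof (intro equalityI subsetI)
    fix z assume "z \<in> {x \<in> S. u * x \<in> adjoin N f}"
    then obtain a b where z: "z \<in> S" and ab: "u * z = a + f * b" "a \<in> N" "b \<in> S"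
      by (auto simp: adjoin_def)
    have "f * b = - a + u * z" using ab by (simp add: algebra_simps)
    moreover have "- a \<in> N" using N(5)[OF N(2) ab(2)] by simp
    ultimately have "f * b \<in> adjoin N u" using z by (intro adjoinI[of "- a" _ z]) auto
    then have "b \<in> adjoin N u" using nzd_u ab(3) by simp
    then obtain c d where cd: "b = c + u * d" "c \<in> N" "d \<in> S" by (auto simp: adjoin_def)
    have "u * (z - f * d) = a + f * c" using ab cd by (simp add: algebra_simps)
    then have "u * (z - f * d) \<in> N" using ab cd N(3) N(4)[OF f] by simp
    then show "z \<in> adjoin {x \<in> S. u * x \<in> N} f"
      using z cd f by (intro adjoinI[of "z - f * d" _ d]) auto
  next
    fix z assume "z \<in> adjoin {x \<in> S. u * x \<in> N} f"
    then obtain a b where "z = a + f * b" "a \<in> S" "u * a \<in> N" "b \<in> S" by (auto simp: adjoin_def)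
    then show "z \<in> {x \<in> S. u * x \<in> adjoin N f}"
      using f u adjoinI[of "u * a" N "u * b" "u * z" f] by (simp add: algebra_simps)
  qed
  then have "regular {x \<in> S. u * x \<in> adjoin N f} fs" using Cons.prems(4) by simp
  moreover have "regular (adjoin (adjoin N f) u) fs"
    using Cons.prems(5) by (simp add: adjoin_commute[of N f u])
  ultimately have "regular (adjoin N f) fs"
    using Cons.IH[OF adjoin_ideal[OF Cons.prems(1) f] u] Cons.prems(3) by simp
  then show ?case using nzd by (simp add: nonzerodivisor_def)
qed auto

lemma regular_carrier: "set fs \<subseteq> S \<Longrightarrow> regular S fs"
proof (induction fs)
  case (Cons f fs)
  have "is_ideal S" by (auto simp: is_ideal_def)
  then have "adjoin S f = S"
    using Cons.prems adjoin_ideal[of S f] subset_adjoin[of S f] by (auto simp: is_ideal_def)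
  then show ?case using Cons by (auto simp: nonzerodivisor_def)
qed auto

section \<open>The adic filtration of a regular sequence\<close>

text \<open>\<open>adic N A k\<close> is the ideal \<open>N + (A)\<^sup>k\<close>, that is, the \<open>k\<close>-th step of the \<open>A\<close>-adic filtration of
  \<open>S/N\<close>.\<close>

inductive adic :: "'a set \<Rightarrow> 'a set \<Rightarrow> nat \<Rightarrow> 'a \<Rightarrow> bool" for N A where
  adic_0: "x \<in> S \<Longrightarrow> adic N A 0 x"
| adic_base: "x \<in> N \<Longrightarrow> adic N A k x"
| adic_step: "f \<in> A \<Longrightarrow> adic N A k x \<Longrightarrow> adic N A (Suc k) (f * x)"
| adic_add: "adic N A k x \<Longrightarrow> adic N A k y \<Longrightarrow> adic N A k (x + y)"

lemma adic_in:
  assumes "adic N A k x" "is_ideal N" "A \<subseteq> S"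
  shows "x \<in> S"
  using assms by induction (auto simp: is_ideal_def)

lemma adic_mult:
  assumes "adic N A k x" "is_ideal N" "s \<in> S"
  shows "adic N A k (s * x)"
  using assms
proof induction
  case (adic_step f k x)
  then have "adic N A (Suc k) (f * (s * x))" by (intro adic.adic_step) auto
  then show ?case by (simp add: mult.left_commute)
next
  case (adic_base x k)
  then show ?case by (auto intro: adic.adic_base is_idealD(4))
qed (auto intro: adic.adic_0 adic.adic_add simp: distrib_left)

lemma adic_diff: "adic N A k x \<Longrightarrow> adic N A k y \<Longrightarrow> is_ideal N \<Longrightarrow> adic N A k (x - y)"
  using adic_add[of N A k x "- 1 * y"] adic_mult[of N A k y "- 1"] by simp

lemma adic_Suc:
  assumes "adic N A (Suc k) x" "is_ideal N" "A \<subseteq> S"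
  shows "adic N A k x"
proof -
  have "adic N A l x \<Longrightarrow> l = Suc k \<Longrightarrow> adic N A k x" for l
  proof (induction arbitrary: k rule: adic.induct)
    case (adic_step f l x)
    then show ?case using assms by (auto intro: adic_mult)
  qed (auto intro: adic.intros)
  then show ?thesis using assms by blast
qed

lemma adic_le:
  assumes "j \<le> k" "adic N A k x" "is_ideal N" "A \<subseteq> S"
  shows "adic N A j x"
  using assms
proof (induction k rule: dec_induct)
  case (step k)
  then show ?case using adic_Suc[of N A k x] by simp
qed

lemma adic_mono: "adic N A k x \<Longrightarrow> N \<subseteq> N' \<Longrightarrow> A \<subseteq> A' \<Longrightarrow> adic N' A' k x"
  by (induction rule: adic.induct) (auto intro: adic.intros)

lemma adic_product:
  assumes "adic N A k x" "adic N A j y" "is_ideal N" "A \<subseteq> S"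
  shows "adic N A (k + j) (x * y)"
  using assms(1)
proof induction
  case (adic_0 x)
  then show ?case using assms adic_mult by auto
next
  case (adic_base x k)
  then have "y * x \<in> N"
    using is_idealD(4)[OF assms(3)] adic_in[OF assms(2,3,4)] by blast
  then show ?case by (auto intro: adic.adic_base simp: mult.commute)
next
  case (adic_step f k x)
  then show ?case by (auto simp: mult.assoc intro: adic.adic_step)
next
  case (adic_add k x x')
  then show ?case by (auto simp: distrib_right intro: adic.adic_add)
qed

lemma adic_empty: "adic N {} (Suc k) x \<Longrightarrow> is_ideal N \<Longrightarrow> x \<in> N"
  by (induction "Suc k" x rule: adic.induct) (auto simp: is_ideal_def)

lemma adic_insertE:
  assumes "adic N (insert f A) (Suc k) x" "is_ideal N" "insert f A \<subseteq> S"
  obtains a b where "x = a + f * b" "adic N A (Suc k) a" "adic N (insert f A) k b"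
proof -
  have "adic N (insert f A) l x \<Longrightarrow> l = Suc k \<Longrightarrow>
      \<exists>a b. x = a + f * b \<and> adic N A (Suc k) a \<and> adic N (insert f A) k b" for l
  proof (induction arbitrary: k rule: adic.induct)
    case (adic_base x l)
    have "0 \<in> N" using assms is_idealD by blast
    then show ?case using adic_base by (intro exI[of _ x] exI[of _ 0]) (auto intro: adic.adic_base)
  next
    case (adic_step g l x)
    have 0: "adic N A m 0" "adic N (insert f A) m 0" for m
      using assms is_idealD by (auto intro: adic.adic_base)
    show ?case
    proof (cases "g = f")
      case True
      then show ?thesis using adic_step 0 by (intro exI[of _ 0] exI[of _ x]) auto
    next
      case False
      then have g: "g \<in> A" "g \<in> S" using adic_step assms by auto
      show ?thesis
      proof (cases k)
        case 0
        have "x \<in> S" using adic_step assms adic_in by blast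
        then have "adic N A (Suc 0) (g * x)" using g by (auto intro: adic.intros)
        then show ?thesis using 0 \<open>adic N (insert f A) _ 0\<close>
          by (intro exI[of _ "g * x"] exI[of _ 0]) auto
      next
        case (Suc k')
        then obtain a b where "x = a + f * b" "adic N A k a" "adic N (insert f A) k' b"
          using adic_step by auto
        moreover have "g * (a + f * b) = g * a + f * (g * b)" by (simp add: algebra_simps)
        ultimately show ?thesis using g Suc by (blast intro: adic.adic_step)
      qed
    qed
  next
    case (adic_add l x y)
    then obtain a b a' b' where "x = a + f * b" "adic N A (Suc k) a" "adic N (insert f A) k b"
      "y = a' + f * b'" "adic N A (Suc k) a'" "adic N (insert f A) k b'" by metis
    then show ?case
      by (intro exI[of _ "a + a'"] exI[of _ "b + b'"])
        (auto simp: algebra_simps intro: adic.adic_add)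
  qed auto
  then show ?thesis using assms(1) that by blast
qed

lemma adic_adjoinE:
  assumes "adic (adjoin N f) A k x" "is_ideal N" "A \<subseteq> S"
  obtains a b where "x = a + f * b" "adic N A k a" "b \<in> S"
proof -
  have "\<exists>a b. x = a + f * b \<and> adic N A k a \<and> b \<in> S"
    using assms(1)
  proof induction
    case (adic_0 x)
    then show ?case by (intro exI[of _ x] exI[of _ 0]) (auto intro: adic.adic_0)
  next
    case (adic_base x k)
    then obtain a b where "x = a + f * b" "a \<in> N" "b \<in> S" by (auto simp: adjoin_def)
    then show ?case by (auto intro: adic.adic_base)
  next
    case (adic_step g k x)
    then obtain a b where "x = a + f * b" "adic N A k a" "b \<in> S" by auto
    moreover have "g \<in> S" using adic_step assms by auto
    moreover have "g * (a + f * b) = g * a + f * (g * b)" by (simp add: algebra_simps)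
    ultimately show ?case using adic_step.hyps by (blast intro: adic.adic_step)
  next
    case (adic_add k x y)
    then obtain a b a' b' where "x = a + f * b" "adic N A k a" "b \<in> S"
      "y = a' + f * b'" "adic N A k a'" "b' \<in> S" by metis
    then show ?case
      by (intro exI[of _ "a + a'"] exI[of _ "b + b'"])
        (auto simp: algebra_simps intro: adic.adic_add)
  qed
  then show ?thesis using that by blast
qed

lemma adic_insert_adjoin:
  assumes "adic N (insert f A) k x" "is_ideal N" "insert f A \<subseteq> S"
  shows "adic (adjoin N f) A k x"
  using assms(1)
proof induction
  case (adic_base x k)
  then show ?case using subset_adjoin by (auto intro: adic.adic_base)
next
  case (adic_step g k x)
  have "x \<in> S" using adic_in[OF adic_step(2)] assms by auto
  then have "f * x \<in> adjoin N f" using assms by (auto intro: mult_in_adjoin)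
  then show ?case using adic_step by (auto intro: adic.adic_step adic.adic_base)
qed (auto intro: adic.intros)

text \<open>The initial form of degree one of \<open>f\<close> is a nonzerodivisor on the graded module associated with the
  \<open>A\<close>-adic filtration of \<open>S/N\<close>.\<close>

definition degree_one_regular :: "'a set \<Rightarrow> 'a set \<Rightarrow> 'a \<Rightarrow> bool" where
  "degree_one_regular N A f \<longleftrightarrow> (\<forall>k. \<forall>h\<in>S. adic N A (Suc k) (f * h) \<longrightarrow> adic N A k h)"

definition regular_on_powers :: "'a set \<Rightarrow> 'a set \<Rightarrow> 'a \<Rightarrow> bool" where
  "regular_on_powers N A g \<longleftrightarrow> (\<forall>k. \<forall>w\<in>S. adic N A k (g * w) \<longrightarrow> adic N A k w)"

lemma degree_one_regular_singleton:
  assumes N: "is_ideal N" and f: "f \<in> S" and nzd: "nonzerodivisor N f"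
  shows "degree_one_regular N {f} f"
  unfolding degree_one_regular_def
proof (intro allI ballI impI)
  fix k h assume h: "h \<in> S" "adic N {f} (Suc k) (f * h)"
  obtain a b where ab: "f * h = a + f * b" "adic N {} (Suc k) a" "adic N {f} k b"
    using h N f by (auto elim: adic_insertE)
  have b: "b \<in> S" using ab N f adic_in by auto
  have "f * (h - b) = a" using ab by (simp add: algebra_simps)
  then have "h - b \<in> N"
    using adic_empty[OF ab(2)] N b h nzd by (auto simp: nonzerodivisor_def)
  then have "adic N {f} k ((h - b) + b)" using ab(3) by (blast intro: adic.adic_add adic.adic_base)
  then show "adic N {f} k h" by simp
qed

text \<open>Modulo \<open>f\<close>, the relation \<open>f h = G + g h'\<close> says that \<open>g h'\<close> lies in a power of \<open>(A)\<close>; since \<open>g\<close> is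
  regular there, so does \<open>h'\<close>, and \<open>g\<close> disappears from the relation.\<close>

lemma degree_one_regular_insert:
  assumes N: "is_ideal N" and S: "insert f (insert g A) \<subseteq> S"
    and f: "degree_one_regular N (insert f A) f"
    and g: "regular_on_powers (adjoin N f) A g"
  shows "degree_one_regular N (insert f (insert g A)) f"
proof -
  let ?F = "insert f (insert g A)" and ?F' = "insert f A"
  have F: "?F = insert g ?F'" by auto
  have M: "is_ideal (adjoin N f)" using N S by auto
  have "adic N ?F k h" if "h \<in> S" "adic N ?F (Suc k) (f * h)" for k h
    using that
  proof (induction k arbitrary: h)
    case 0
    then show ?case by (auto intro: adic.adic_0)
  next
    case (Suc k)
    obtain G h' where G: "f * h = G + g * h'" "adic N ?F' (Suc (Suc k)) G" "adic N ?F (Suc k) h'"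
      using Suc.prems N S unfolding F by (auto elim: adic_insertE)
    have h'S: "h' \<in> S" using G N S adic_in by blast
    have "adic (adjoin N f) A (Suc (Suc k)) (f * h)"
      using Suc.prems N by (intro adic.adic_base mult_in_adjoin) auto
    moreover have "adic (adjoin N f) A (Suc (Suc k)) G"
      using G N S by (auto intro: adic_insert_adjoin)
    ultimately have "adic (adjoin N f) A (Suc (Suc k)) (f * h - G)"
      using M adic_diff by blast
    then have "adic (adjoin N f) A (Suc (Suc k)) h'"
      using g h'S G by (simp add: regular_on_powers_def)
    then obtain e c where e: "h' = e + f * c" "adic N A (Suc (Suc k)) e" "c \<in> S"
      using N S by (auto elim: adic_adjoinE)
    have eS: "e \<in> S" using e N S adic_in by blast
    have e': "adic N ?F' (Suc (Suc k)) e" using e by (auto intro: adic_mono)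
    have "f * (h - g * c) = G + g * e" using G e by (simp add: algebra_simps)
    moreover have "adic N ?F' (Suc (Suc k)) (G + g * e)"
      using G e' N S by (auto intro!: adic.adic_add adic_mult)
    ultimately have "adic N ?F' (Suc k) (h - g * c)"
      using f Suc.prems S e by (auto simp: degree_one_regular_def)
    then have 1: "adic N ?F (Suc k) (h - g * c)" by (auto intro: adic_mono)
    have "adic N ?F (Suc k) e"
      using adic_Suc[OF e'] N S by (auto intro: adic_mono)
    then have "adic N ?F (Suc k) (h' - e)" using G N adic_diff by blast
    then have "adic N ?F k c" using Suc.IH e by simp
    then have "adic N ?F (Suc k) (g * c)" by (auto intro: adic.adic_step)
    then have "adic N ?F (Suc k) ((h - g * c) + g * c)" using 1 by (intro adic.adic_add)
    then show ?case by simp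
  qed
  then show ?thesis by (simp add: degree_one_regular_def)
qed

text \<open>Modulo \<open>f\<close>, the hypothesis gives a representative \<open>e\<close> of \<open>w\<close> of the required order. In the
  remaining relation for \<open>w - e = f z\<close> the factor \<open>f\<close> can be cancelled, and \<open>z\<close> is treated by induction
  on the order.\<close>

lemma regular_on_powers_insert:
  assumes N: "is_ideal N" and S: "insert g (insert f A) \<subseteq> S"
    and f: "degree_one_regular N (insert f A) f"
    and g: "regular_on_powers (adjoin N f) A g"
  shows "regular_on_powers N (insert f A) g"
proof -
  let ?F = "insert f A"
  have "adic N ?F k w" if "w \<in> S" "adic N ?F k (g * w)" for k w
    using that
  proof (induction k arbitrary: w)
    case 0
    then show ?case by (auto intro: adic.adic_0)
  next
    case (Suc k)
    have "adic (adjoin N f) A (Suc k) (g * w)"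
      using Suc.prems N S by (auto intro: adic_insert_adjoin)
    then have "adic (adjoin N f) A (Suc k) w"
      using g Suc.prems by (simp add: regular_on_powers_def)
    then obtain e z where e: "w = e + f * z" "adic N A (Suc k) e" "z \<in> S"
      using N S by (auto elim: adic_adjoinE)
    have e': "adic N ?F (Suc k) e" using e by (auto intro: adic_mono)
    then have "adic N ?F (Suc k) (g * w - g * e)"
      using Suc.prems N S adic_mult[OF e' N, of g] by (auto intro: adic_diff)
    then have "adic N ?F (Suc k) (f * (g * z))" using e by (simp add: algebra_simps)
    then have "adic N ?F k (g * z)" using f e S by (auto simp: degree_one_regular_def)
    then have "adic N ?F k z" using Suc.IH e by blast
    then show ?case using e' unfolding e(1) by (auto intro: adic.adic_add adic.adic_step)
  qed
  then show ?thesis by (simp add: regular_on_powers_def)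
qed

text \<open>Induction on the length of the sequence, simultaneously for regularity modulo powers and for
  regularity of the leading element in degree one. Splitting off the last element reduces the second
  property to the first one modulo \<open>f\<close>, and splitting off the first element \<open>f\<close> reduces the first
  property to the second one. No multi-indices are needed.\<close>

lemma regular_sequence_on_powers:
  assumes "is_ideal N" "set (fs @ [g]) \<subseteq> S" "regular N (fs @ [g])"
  shows "regular_on_powers N (set fs) g"
  using assms
proof (induction "length fs" arbitrary: N fs g rule: less_induct)
  case less
  show ?case
  proof (cases fs)
    case Nil
    have "adic N {} k w" if "w \<in> S" "adic N {} k (g * w)" for k w
      using that less.prems Nil
      by (cases k) (auto simp: nonzerodivisor_def dest: adic_empty intro: adic.intros)
    then show ?thesis using Nil by (simp add: regular_on_powers_def)
  next
    case (Cons f fs')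
    have f: "degree_one_regular N (insert f (set hs)) f"
      if "length hs \<le> length fs'" "regular N (f # hs)" "insert f (set hs) \<subseteq> S" for hs
      using that
    proof (induction hs rule: rev_induct)
      case Nil
      then show ?case using less.prems by (auto intro: degree_one_regular_singleton)
    next
      case (snoc h hs)
      have "regular_on_powers (adjoin N f) (set hs) h"
        using snoc.prems less.prems Cons by (intro less.hyps) auto
      then have "degree_one_regular N (insert f (insert h (set hs))) f"
        using snoc less.prems by (intro degree_one_regular_insert) (auto simp: regular_append)
      then show ?case by (simp add: insert_commute)
    qed
    have "regular_on_powers (adjoin N f) (set fs') g"
      using less.prems Cons by (intro less.hyps) auto
    then show ?thesis
      using less.prems Cons f[of fs']
      by (auto intro!: regular_on_powers_insert simp: regular_append)
  qed
qed

lemma regular_sequence_degree_one: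
  assumes "is_ideal N" "insert f (set fs) \<subseteq> S" "regular N (f # fs)"
  shows "degree_one_regular N (insert f (set fs)) f"
  using assms
proof (induction fs rule: rev_induct)
  case Nil
  then show ?case by (auto intro: degree_one_regular_singleton)
next
  case (snoc h hs)
  have "regular_on_powers (adjoin N f) (set hs) h"
    using snoc.prems by (intro regular_sequence_on_powers) auto
  then have "degree_one_regular N (insert f (insert h (set hs))) f"
    using snoc by (intro degree_one_regular_insert) (auto simp: regular_append)
  then show ?case by (simp add: insert_commute)
qed

definition unit_in :: "'a \<Rightarrow> bool" where
  "unit_in c \<longleftrightarrow> c \<in> S \<and> (\<exists>c'\<in>S. c' * c = 1)"

fun power_product :: "'a list \<Rightarrow> nat list \<Rightarrow> 'a" where
  "power_product (f # fs) (i # \<alpha>) = f ^ i * power_product fs \<alpha>"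
| "power_product _ _ = 1"

lemma power_product_in: "set fs \<subseteq> S \<Longrightarrow> power_product fs \<alpha> \<in> S"
  by (induction fs \<alpha> rule: power_product.induct) (auto simp: power_in)

lemma adic_power_product:
  assumes "is_ideal N" "set fs \<subseteq> A" "A \<subseteq> S" "length \<alpha> = length fs"
  shows "adic N A (sum_list \<alpha>) (power_product fs \<alpha>)"
  using assms(2,4)
proof (induction fs \<alpha> rule: power_product.induct)
  case (1 f fs i \<alpha>)
  have "adic N A i (f ^ i)"
    using 1 assms by (induction i) (auto intro: adic.intros)
  then show ?case using 1 adic_product assms by simp
qed (auto intro: adic.intros)

lemma adic_zero: "is_ideal N \<Longrightarrow> adic N A k 0"
  by (auto intro: adic.adic_base simp: is_ideal_def)

lemma adic_sum:
  "is_ideal N \<Longrightarrow> (\<And>i. i \<in> B \<Longrightarrow> adic N A k (g i)) \<Longrightarrow> adic N A k (sum g B)"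
  by (induction B rule: infinite_finite_induct) (auto intro: adic_zero adic.adic_add)

text \<open>Forms divisible by the leading element \<open>f\<close> reduce to lower degree. Otherwise the form \<open>e\<close> is
  modulo \<open>f\<close> a nonzero form in the remaining elements, so \<open>v = w + f z\<close> with \<open>w\<close> of order \<open>j\<close>, and \<open>z\<close>
  is treated by induction on \<open>j\<close>. In terms of the associated graded module, a nonzero form in the
  members of a regular sequence with unit coefficients is a nonzerodivisor.\<close>

lemma form_mult_adic:
  assumes "is_ideal N" "set fs \<subseteq> S" "regular N fs" "finite A" "A \<noteq> {}"
    and "\<And>\<alpha>. \<alpha> \<in> A \<Longrightarrow> length \<alpha> = length fs \<and> sum_list \<alpha> = k \<and> unit_in (c \<alpha>)"
    and "v \<in> S" "adic N (set fs) (k + j) ((\<Sum>\<alpha>\<in>A. c \<alpha> * power_product fs \<alpha>) * v)"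
  shows "adic N (set fs) j v"
  using assms
proof (induction fs arbitrary: N A c k v j)
  case Nil
  have "A = {[]}" using Nil.prems(5,6) by auto
  then have k: "k = 0" and u: "unit_in (c [])" using Nil.prems(6) by auto
  obtain c' where c': "c' \<in> S" "c' * c [] = 1" using u by (auto simp: unit_in_def)
  have "adic N {} j (c' * (c [] * v))"
    using Nil.prems(1,8) \<open>A = {[]}\<close> k c'(1) adic_mult[of N "{}" j "c [] * v" c'] by simp
  then show ?case using c' by (simp add: mult.assoc[symmetric])
next
  case (Cons f fs)
  let ?F = "set (f # fs)"
  have f: "f \<in> S" and fs: "set fs \<subseteq> S" and N: "is_ideal N" using Cons.prems by auto
  have lead: "adic N ?F i h" if "h \<in> S" "adic N ?F (Suc i) (f * h)" for i h
    using regular_sequence_degree_one[of N f fs] Cons.prems that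
    by (simp add: degree_one_regular_def)
  show ?case using Cons.prems(4-8)
  proof (induction k arbitrary: A c v j rule: less_induct)
    case (less k)
    let ?e = "\<Sum>\<alpha>\<in>A. c \<alpha> * power_product (f # fs) \<alpha>"
    have A: "\<alpha> = hd \<alpha> # tl \<alpha>" "length (tl \<alpha>) = length fs" "hd \<alpha> + sum_list (tl \<alpha>) = k"
      "unit_in (c \<alpha>)" "c \<alpha> \<in> S" if "\<alpha> \<in> A" for \<alpha>
      using less.prems(3)[OF that] by (cases \<alpha>; simp add: unit_in_def)+
    define A0 where "A0 = {\<alpha> \<in> A. hd \<alpha> = 0}"
    have pos: "c \<alpha> * power_product (f # fs) \<alpha>
        = f * (c \<alpha> * power_product (f # fs) ((hd \<alpha> - 1) # tl \<alpha>))" if "\<alpha> \<in> A - A0" for \<alpha>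
    proof -
      have "hd \<alpha> = Suc (hd \<alpha> - 1)" using that by (auto simp: A0_def)
      then have "power_product (f # fs) \<alpha> = f ^ Suc (hd \<alpha> - 1) * power_product fs (tl \<alpha>)"
        using A(1)[of \<alpha>] that by (metis DiffD1 power_product.simps(1))
      then show ?thesis by (simp add: ac_simps)
    qed
    show ?case
    proof (cases "A0 = {}")
      case True
      define dec where "dec \<alpha> = (hd \<alpha> - 1) # tl \<alpha>" for \<alpha> :: "nat list"
      define inc where "inc \<alpha> = Suc (hd \<alpha>) # tl \<alpha>" for \<alpha> :: "nat list"
      have hd: "hd \<alpha> > 0" if "\<alpha> \<in> A" for \<alpha> using that True by (auto simp: A0_def)
      have inc_dec: "inc (dec \<alpha>) = \<alpha>" if "\<alpha> \<in> A" for \<alpha>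
        using A(1)[OF that] hd[OF that] by (simp add: inc_def dec_def)
      obtain \<alpha> where "\<alpha> \<in> A" using less.prems by auto
      then obtain k' where k: "k = Suc k'" using A(3)[of \<alpha>] hd[of \<alpha>] by (cases k) auto
      let ?ed = "\<Sum>\<beta>\<in>dec ` A. c (inc \<beta>) * power_product (f # fs) \<beta>"
      have "inj_on dec A" by (metis inc_dec inj_onI)
      then have "?ed = (\<Sum>\<alpha>\<in>A. c \<alpha> * power_product (f # fs) (dec \<alpha>))"
        by (simp add: sum.reindex inc_dec)
      moreover have "?e = (\<Sum>\<alpha>\<in>A. f * (c \<alpha> * power_product (f # fs) (dec \<alpha>)))"
        using pos True unfolding dec_def by (intro sum.cong) auto
      ultimately have e: "?e = f * ?ed" by (simp add: sum_distrib_left)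
      have "?ed \<in> S" using A(5) inc_dec f fs
        by (intro sum_in mult_in power_product_in) auto
      then have "?ed * v \<in> S" using less.prems(4) by (rule mult_in)
      moreover have "adic N ?F (Suc (k' + j)) (f * (?ed * v))"
        using less.prems(5) unfolding e k by (simp only: mult.assoc add_Suc)
      ultimately have "adic N ?F (k' + j) (?ed * v)" by (rule lead)
      moreover have "length \<beta> = length (f # fs) \<and> sum_list \<beta> = k' \<and> unit_in (c (inc \<beta>))"
        if "\<beta> \<in> dec ` A" for \<beta>
      proof -
        from that obtain \<alpha> where \<alpha>: "\<alpha> \<in> A" "\<beta> = dec \<alpha>" by auto
        then show ?thesis using A(2-4)[OF \<alpha>(1)] hd[OF \<alpha>(1)] inc_dec[OF \<alpha>(1)] k
          by (auto simp: dec_def)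
      qed
      ultimately show ?thesis
        using less.prems k by (intro less.IH[of k' "dec ` A" "\<lambda>\<beta>. c (inc \<beta>)" v j]) auto
    next
      case False
      let ?low = "\<Sum>\<gamma>\<in>tl ` A0. c (0 # \<gamma>) * power_product fs \<gamma>"
      let ?rest = "\<Sum>\<alpha>\<in>A - A0. c \<alpha> * power_product (f # fs) ((hd \<alpha> - 1) # tl \<alpha>)"
      have A0: "0 # tl \<alpha> = \<alpha>" if "\<alpha> \<in> A0" for \<alpha>
        using that A(1)[of \<alpha>] by (auto simp: A0_def)
      have sub: "A0 \<subseteq> A" by (auto simp: A0_def)
      have "inj_on tl A0" by (metis A0 inj_onI)
      then have "?low = (\<Sum>\<alpha>\<in>A0. c \<alpha> * power_product fs (tl \<alpha>))"
        by (simp add: sum.reindex A0)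
      also have "\<dots> = (\<Sum>\<alpha>\<in>A0. c \<alpha> * power_product (f # fs) \<alpha>)"
      proof (rule sum.cong[OF refl])
        fix \<alpha> assume "\<alpha> \<in> A0"
        then have "power_product (f # fs) \<alpha> = power_product (f # fs) (0 # tl \<alpha>)"
          by (simp only: A0)
        then show "c \<alpha> * power_product fs (tl \<alpha>) = c \<alpha> * power_product (f # fs) \<alpha>" by simp
      qed
      finally have e0: "?low = (\<Sum>\<alpha>\<in>A0. c \<alpha> * power_product (f # fs) \<alpha>)" .
      have "?e = (\<Sum>\<alpha>\<in>A - A0. c \<alpha> * power_product (f # fs) \<alpha>)
          + (\<Sum>\<alpha>\<in>A0. c \<alpha> * power_product (f # fs) \<alpha>)"
        by (rule sum.subset_diff[OF sub less.prems(1)])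
      moreover have "(\<Sum>\<alpha>\<in>A - A0. c \<alpha> * power_product (f # fs) \<alpha>) = f * ?rest"
        using pos by (simp add: sum_distrib_left)
      ultimately have e: "?e = ?low + f * ?rest" by (simp only: e0 add.commute)
      have e1: "?rest \<in> S"
        using A(5) f fs by (intro sum_in mult_in power_product_in) auto
      have ek: "adic N ?F k ?e"
      proof (intro adic_sum adic_mult N)
        show "adic N ?F k (power_product (f # fs) \<alpha>)" if "\<alpha> \<in> A" for \<alpha>
          using adic_power_product[of N "f # fs" ?F \<alpha>] N f fs less.prems(3)[OF that] by auto
      qed (use A(5) in auto)
      have eS: "?e \<in> S" using A(5) f fs by (intro sum_in mult_in power_product_in) auto
      show ?thesis using less.prems(4,5)
      proof (induction j arbitrary: v)
        case 0
        then show ?case by (auto intro: adic.adic_0)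
      next
        case (Suc j)
        have M: "is_ideal (adjoin N f)" using N f by auto
        have "adic (adjoin N f) (set fs) (k + Suc j) (?e * v)"
          using Suc.prems N f fs by (intro adic_insert_adjoin) auto
        moreover have "adic (adjoin N f) (set fs) (k + Suc j) (f * (?rest * v))"
          using e1 Suc.prems N by (intro adic.adic_base mult_in_adjoin) auto
        ultimately have "adic (adjoin N f) (set fs) (k + Suc j) (?e * v - f * (?rest * v))"
          using M adic_diff by blast
        moreover have "?e * v - f * (?rest * v) = ?low * v" unfolding e by (simp add: algebra_simps)
        ultimately have "adic (adjoin N f) (set fs) (k + Suc j) (?low * v)" by simp
        moreover have "length \<gamma> = length fs \<and> sum_list \<gamma> = k \<and> unit_in (c (0 # \<gamma>))"
          if "\<gamma> \<in> tl ` A0" for \<gamma>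
        proof -
          from that obtain \<alpha> where "\<alpha> \<in> A0" "\<gamma> = tl \<alpha>" by auto
          moreover have "\<alpha> \<in> A" "hd \<alpha> = 0" using \<open>\<alpha> \<in> A0\<close> by (auto simp: A0_def)
          ultimately show ?thesis using A(2-4)[of \<alpha>] A0[of \<alpha>] by simp
        qed
        moreover have "finite (tl ` A0)" "tl ` A0 \<noteq> {}"
          using False less.prems(1) sub by (auto intro: finite_subset)
        ultimately have "adic (adjoin N f) (set fs) (Suc j) v"
          using Cons.IH[of "adjoin N f" "tl ` A0" k "\<lambda>\<gamma>. c (0 # \<gamma>)" v "Suc j"]
            M fs Cons.prems(3) Suc.prems(1) by auto
        then obtain w z where wz: "v = w + f * z" "adic N (set fs) (Suc j) w" "z \<in> S"
          using N f fs by (auto elim: adic_adjoinE)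
        have w: "adic N ?F (Suc j) w" using wz by (auto intro: adic_mono)
        have "adic N ?F (k + Suc j) (?e * w)"
          using adic_product[OF ek w] N f fs by auto
        then have "adic N ?F (k + Suc j) (?e * v - ?e * w)"
          using Suc.prems N by (intro adic_diff) auto
        moreover have "?e * v - ?e * w = f * (?e * z)" unfolding wz(1) by (simp add: algebra_simps)
        ultimately have "adic N ?F (Suc (k + j)) (f * (?e * z))" by simp
        then have "adic N ?F (k + j) (?e * z)" by (rule lead[OF mult_in[OF eS wz(3)]])
        then have "adic N ?F j z" using Suc.IH wz by blast
        then have "adic N ?F (Suc j) (f * z)" by (auto intro: adic.adic_step)
        then show ?case using w unfolding wz(1) by (auto intro: adic.adic_add)
      qed
    qed
  qed
qed

text \<open>Comparison of lowest forms: if \<open>v\<close> has order at least \<open>j\<close>, then the terms of degree exceeding the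
  lowest degree \<open>k\<close> contribute only to order \<open>k + j + 1\<close>. The lowest form thus multiplies \<open>v\<close> into that
  order, and \<open>v\<close> has order at least \<open>j + 1\<close>. Hence a nonzero polynomial whose coefficients
  are zero or units can only annihilate elements of infinite order.\<close>

lemma regular_sequence_independent:
  assumes "is_ideal N" "set fs \<subseteq> S" "regular N fs" "finite A" "\<beta> \<in> A" "c \<beta> \<noteq> 0"
    and A: "\<And>\<alpha>. \<alpha> \<in> A \<Longrightarrow> length \<alpha> = length fs \<and> (c \<alpha> = 0 \<or> unit_in (c \<alpha>))"
    and "v \<in> S" "(\<Sum>\<alpha>\<in>A. c \<alpha> * power_product fs \<alpha>) * v \<in> N"
  shows "adic N (set fs) j v"
proof (induction j)
  case 0
  then show ?case using assms by (auto intro: adic.adic_0)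
next
  case (Suc j)
  define B where "B = {\<alpha> \<in> A. c \<alpha> \<noteq> 0}"
  define k where "k = Min (sum_list ` B)"
  define C where "C = {\<alpha> \<in> B. sum_list \<alpha> = k}"
  have B: "finite B" "B \<noteq> {}" using assms by (auto simp: B_def)
  then have "k \<in> sum_list ` B" unfolding k_def by (intro Min_in) auto
  then have C: "C \<noteq> {}" by (auto simp: C_def)
  have sum_ge: "k \<le> sum_list \<alpha>" if "\<alpha> \<in> B" for \<alpha>
    using that B unfolding k_def by auto
  let ?t = "\<lambda>\<alpha>. c \<alpha> * power_product fs \<alpha>"
  have "sum ?t A = sum ?t B" unfolding B_def using assms(4) by (intro sum.mono_neutral_right) auto
  also have "\<dots> = sum ?t (B - C) + sum ?t C"
    using B by (intro sum.subset_diff) (auto simp: C_def)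
  finally have split: "sum ?t A = sum ?t (B - C) + sum ?t C" .
  have "adic N (set fs) (Suc k) (sum ?t (B - C))"
  proof (intro adic_sum adic_mult assms(1))
    fix \<alpha> assume \<alpha>: "\<alpha> \<in> B - C"
    then have "Suc k \<le> sum_list \<alpha>" using sum_ge[of \<alpha>] by (auto simp: C_def)
    moreover have "adic N (set fs) (sum_list \<alpha>) (power_product fs \<alpha>)"
      using \<alpha> A assms by (intro adic_power_product) (auto simp: B_def)
    ultimately show "adic N (set fs) (Suc k) (power_product fs \<alpha>)"
      by (rule adic_le[OF _ _ assms(1,2)])
    show "c \<alpha> \<in> S" using \<alpha> A[of \<alpha>] by (auto simp: B_def unit_in_def)
  qed
  then have "adic N (set fs) (Suc k + j) (sum ?t (B - C) * v)"
    by (rule adic_product[OF _ Suc assms(1,2)])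
  then have "adic N (set fs) (Suc k + j) (sum ?t A * v - sum ?t (B - C) * v)"
    using assms by (intro adic_diff) (auto intro: adic.adic_base)
  then have "adic N (set fs) (k + Suc j) (sum ?t C * v)"
    unfolding split by (simp add: algebra_simps)
  then show ?case
    using assms B C A by (intro form_mult_adic[of N fs C k c v "Suc j"]) (auto simp: B_def C_def)
qed

end

section \<open>Face ideals\<close>

definition polys :: "nat set \<Rightarrow> 'k::field mpoly set" where
  "polys V = carrier (poly_ring V)"

abbreviation vars :: "(nat \<Rightarrow>\<^sub>0 nat) \<Rightarrow> nat set" where
  "vars e \<equiv> Poly_Mapping.keys e"

abbreviation monomial :: "(nat \<Rightarrow>\<^sub>0 nat) \<Rightarrow> 'k::field mpoly" where
  "monomial e \<equiv> Poly_Mapping.single e 1"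

lemma in_polys_iff: "p \<in> polys V \<longleftrightarrow> (\<forall>e\<in>Poly_Mapping.keys p. vars e \<subseteq> V)"
  by (simp add: polys_def poly_ring_def)

lemma vars_add: "vars (e + e') = vars e \<union> vars e'"
  by (auto simp: in_keys_iff lookup_add)

lemma vars_diff: "vars (e - e') \<subseteq> vars e"
  by (auto simp: in_keys_iff lookup_minus)

lemma keys_multE:
  assumes "e \<in> Poly_Mapping.keys (p * q :: 'k::field mpoly)"
  obtains a b where "e = a + b" "a \<in> Poly_Mapping.keys p" "b \<in> Poly_Mapping.keys q"
  using keys_mult[of p q] assms by blast

lemma keys_addE:
  assumes "e \<in> Poly_Mapping.keys (p + q :: 'k::field mpoly)"
  obtains "e \<in> Poly_Mapping.keys p" | "e \<in> Poly_Mapping.keys q"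
  using keys_add[of p q] assms by blast

interpretation polys: subring_set "polys V :: 'k::field mpoly set" for V
proof
  fix p q :: "'k mpoly" assume pq: "p \<in> polys V" "q \<in> polys V"
  show "p + q \<in> polys V" using pq by (auto simp: in_polys_iff elim!: keys_addE)
  show "p * q \<in> polys V" using pq
    by (auto simp: in_polys_iff vars_add elim!: keys_multE) blast+
qed (auto simp: in_polys_iff)

lemma single_in_polys: "vars e \<subseteq> V \<Longrightarrow> Poly_Mapping.single e c \<in> polys V"
  by (auto simp: in_polys_iff)

lemma lookup_single_mult:
  fixes p :: "'k::field mpoly"
  shows "Poly_Mapping.lookup (Poly_Mapping.single m c * p) (m + e) = c * Poly_Mapping.lookup p e"
  by (simp add: lookup_mult lookup_single when_mult)

lemma keys_monomial_mult:
  fixes p :: "'k::field mpoly"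
  shows "Poly_Mapping.keys (monomial m * p) = (+) m ` Poly_Mapping.keys p"
proof
  show "Poly_Mapping.keys (monomial m * p) \<subseteq> (+) m ` Poly_Mapping.keys p"
    by (auto elim!: keys_multE)
  show "(+) m ` Poly_Mapping.keys p \<subseteq> Poly_Mapping.keys (monomial m * p)"
    by (auto simp: in_keys_iff lookup_single_mult)
qed

lemma poly_mapping_expansion:
  "p = (\<Sum>e\<in>Poly_Mapping.keys p. Poly_Mapping.single e (Poly_Mapping.lookup p e))"
proof (rule poly_mapping_eqI)
  fix k
  have "(\<Sum>e\<in>Poly_Mapping.keys p. Poly_Mapping.lookup (Poly_Mapping.single e (Poly_Mapping.lookup p e)) k)
      = (\<Sum>e\<in>Poly_Mapping.keys p. if e = k then Poly_Mapping.lookup p k else 0)"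
    by (intro sum.cong) (auto simp: lookup_single)
  also have "\<dots> = Poly_Mapping.lookup p k" by (simp add: in_keys_iff)
  finally show "Poly_Mapping.lookup p k = Poly_Mapping.lookup
      (\<Sum>e\<in>Poly_Mapping.keys p. Poly_Mapping.single e (Poly_Mapping.lookup p e)) k"
    by (simp add: lookup_sum)
qed

text \<open>Homogeneous components and the components of a polynomial in the Stanley spaces of a
  decomposition are obtained by restricting it to a set of exponents.\<close>

definition restrict_poly :: "((nat \<Rightarrow>\<^sub>0 nat) \<Rightarrow> bool) \<Rightarrow> 'k::field mpoly \<Rightarrow> 'k mpoly" where
  "restrict_poly P p = Abs_poly_mapping (\<lambda>e. if P e then Poly_Mapping.lookup p e else 0)"

lemma lookup_restrict_poly:
  "Poly_Mapping.lookup (restrict_poly P p) e = (if P e then Poly_Mapping.lookup p e else 0)"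
proof -
  have "finite {e. (if P e then Poly_Mapping.lookup p e else 0) \<noteq> 0}"
    by (rule finite_subset[OF _ finite_keys[of p]]) (auto simp: in_keys_iff)
  then show ?thesis by (simp add: restrict_poly_def)
qed

lemma keys_restrict_poly:
  "Poly_Mapping.keys (restrict_poly P p) = {e \<in> Poly_Mapping.keys p. P e}"
  by (auto simp: in_keys_iff lookup_restrict_poly split: if_splits)

lemma restrict_poly_add: "restrict_poly P (p + q) = restrict_poly P p + restrict_poly P q"
  by (rule poly_mapping_eqI) (simp add: lookup_restrict_poly lookup_add)

lemma restrict_poly_split: "p = restrict_poly P p + restrict_poly (\<lambda>e. \<not> P e) p"
  by (rule poly_mapping_eqI) (simp add: lookup_restrict_poly lookup_add)

lemma restrict_poly_id: "(\<And>e. e \<in> Poly_Mapping.keys p \<Longrightarrow> P e) \<Longrightarrow> restrict_poly P p = p"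
  by (rule poly_mapping_eqI) (auto simp: lookup_restrict_poly in_keys_iff)

lemma restrict_poly_0: "(\<And>e. e \<in> Poly_Mapping.keys p \<Longrightarrow> \<not> P e) \<Longrightarrow> restrict_poly P p = 0"
  by (rule poly_mapping_eqI) (auto simp: lookup_restrict_poly in_keys_iff)

lemma restrict_poly_in: "p \<in> polys V \<Longrightarrow> restrict_poly P p \<in> polys V"
  by (auto simp: in_polys_iff keys_restrict_poly)

definition face_ideal :: "nat set \<Rightarrow> nat set set \<Rightarrow> 'k::field mpoly set" where
  "face_ideal V \<Delta> = {p \<in> polys V. \<forall>e\<in>Poly_Mapping.keys p. vars e \<notin> \<Delta>}"

definition down_closed :: "'a set set \<Rightarrow> bool" where
  "down_closed \<Delta> \<longleftrightarrow> (\<forall>G\<in>\<Delta>. \<forall>H\<subseteq>G. H \<in> \<Delta>)"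

definition link :: "'a \<Rightarrow> 'a set set \<Rightarrow> 'a set set" where
  "link v \<Delta> = {G. insert v G \<in> \<Delta>}"

definition deletion :: "'a \<Rightarrow> 'a set set \<Rightarrow> 'a set set" where
  "deletion v \<Delta> = {G \<in> \<Delta>. v \<notin> G}"

lemma down_closed_link: "down_closed \<Delta> \<Longrightarrow> down_closed (link v \<Delta>)"
  unfolding down_closed_def link_def by (metis insert_mono mem_Collect_eq)

lemma down_closed_deletion: "down_closed \<Delta> \<Longrightarrow> down_closed (deletion v \<Delta>)"
  unfolding down_closed_def deletion_def by blast

lemma face_ideal_ideal:
  assumes "down_closed \<Delta>"
  shows "polys.is_ideal V (face_ideal V \<Delta> :: 'k::field mpoly set)"
proof -
  have "s * p \<in> face_ideal V \<Delta>" if "s \<in> polys V" "p \<in> face_ideal V \<Delta>" for s p :: "'k mpoly"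
  proof -
    have "vars e \<notin> \<Delta>" if "e \<in> Poly_Mapping.keys (s * p)" for e
      using that
    proof (rule keys_multE)
      fix a b assume "e = a + b" "b \<in> Poly_Mapping.keys p"
      then show ?thesis using \<open>p \<in> face_ideal V \<Delta>\<close> assms
        unfolding face_ideal_def down_closed_def by (auto simp: vars_add)
    qed
    then show ?thesis using that by (auto simp: face_ideal_def)
  qed
  then show ?thesis
    by (auto simp: polys.is_ideal_def face_ideal_def elim!: keys_addE)
qed

definition indicator_exp :: "nat set \<Rightarrow> nat \<Rightarrow>\<^sub>0 nat" where
  "indicator_exp G = (\<Sum>i\<in>G. Poly_Mapping.single i 1)"

lemma lookup_indicator_exp:
  "finite G \<Longrightarrow> Poly_Mapping.lookup (indicator_exp G) i = (if i \<in> G then 1 else 0)"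
  by (simp add: indicator_exp_def lookup_sum lookup_single when_def)

lemma vars_indicator_exp: "finite G \<Longrightarrow> vars (indicator_exp G) = G"
  by (auto simp: in_keys_iff lookup_indicator_exp split: if_splits)

lemma var_in_polys: "v \<in> V \<Longrightarrow> var v \<in> polys V"
  by (auto simp: var_def intro: single_in_polys)

lemma lookup_var_0: "Poly_Mapping.lookup (var v :: 'k::field mpoly) 0 = 0"
proof -
  have "Poly_Mapping.single v 1 \<noteq> (0 :: nat \<Rightarrow>\<^sub>0 nat)"
    by (metis lookup_single_eq lookup_zero zero_neq_one)
  then show ?thesis by (simp add: var_def lookup_single)
qed

lemma colon_face_ideal:
  assumes "v \<in> V"
  shows "{p \<in> polys V. var v * p \<in> face_ideal V \<Delta>} = (face_ideal V (link v \<Delta>) :: 'k::field mpoly set)"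
proof -
  have "var v * p \<in> polys V" if "p \<in> polys V" for p :: "'k mpoly"
    using that assms by (auto intro: var_in_polys)
  then show ?thesis
    by (auto simp: face_ideal_def link_def var_def keys_monomial_mult vars_add)
qed

lemma monomial_dvd:
  fixes p :: "'k::field mpoly"
  assumes "\<And>e. e \<in> Poly_Mapping.keys p \<Longrightarrow> \<exists>h. e = m + h \<and> vars h \<subseteq> Z"
  obtains q where "q \<in> polys Z" "p = monomial m * q"
proof -
  let ?q = "\<Sum>e\<in>Poly_Mapping.keys p. Poly_Mapping.single (e - m) (Poly_Mapping.lookup p e)"
  have e: "m + (e - m) = e" "vars (e - m) \<subseteq> Z" if "e \<in> Poly_Mapping.keys p" for e
    using assms[OF that] by auto
  have "monomial m * ?q = (\<Sum>e\<in>Poly_Mapping.keys p. Poly_Mapping.single e (Poly_Mapping.lookup p e))"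
    unfolding sum_distrib_left by (intro sum.cong refl) (simp add: mult_single e)
  then have "p = monomial m * ?q" by (simp only: poly_mapping_expansion[symmetric])
  moreover have "?q \<in> polys Z" using e(2) by (intro polys.sum_in single_in_polys)
  ultimately show ?thesis using that by blast
qed

lemma exponent_split:
  assumes "v \<in> vars e"
  shows "e = Poly_Mapping.single v 1 + (e - Poly_Mapping.single v 1)"
proof (rule poly_mapping_eqI)
  fix i
  have "Poly_Mapping.lookup e v \<noteq> 0" using assms by (simp add: in_keys_iff)
  then show "Poly_Mapping.lookup e i
      = Poly_Mapping.lookup (Poly_Mapping.single v 1 + (e - Poly_Mapping.single v 1)) i"
    by (auto simp: lookup_add lookup_minus lookup_single when_def)
qed

lemma var_dvd:
  fixes p :: "'k::field mpoly"
  assumes "p \<in> polys V" and "\<And>e. e \<in> Poly_Mapping.keys p \<Longrightarrow> v \<in> vars e"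
  obtains q where "q \<in> polys V" "p = var v * q"
proof (rule monomial_dvd)
  fix e assume e: "e \<in> Poly_Mapping.keys p"
  have "vars (e - Poly_Mapping.single v 1) \<subseteq> V"
    using vars_diff e assms(1) unfolding in_polys_iff by blast
  then show "\<exists>h. e = Poly_Mapping.single v 1 + h \<and> vars h \<subseteq> V"
    using exponent_split[OF assms(2)[OF e]] by blast
qed (use that in \<open>simp add: var_def\<close>)

lemma adjoin_face_ideal:
  assumes v: "v \<in> V"
  shows "polys.adjoin V (face_ideal V \<Delta>) (var v) = (face_ideal V (deletion v \<Delta>) :: 'k::field mpoly set)"
proof (intro equalityI subsetI)
  fix p :: "'k mpoly" assume "p \<in> polys.adjoin V (face_ideal V \<Delta>) (var v)"
  then obtain a b where ab: "p = a + var v * b" "a \<in> face_ideal V \<Delta>" "b \<in> polys V"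
    by (auto simp: polys.adjoin_def)
  have "vars e \<notin> deletion v \<Delta>" if "e \<in> Poly_Mapping.keys p" for e
  proof -
    have "e \<in> Poly_Mapping.keys a \<or> e \<in> Poly_Mapping.keys (var v * b)"
      using that ab(1) keys_addE by blast
    then show ?thesis using ab(2)
      by (auto simp: face_ideal_def deletion_def var_def keys_monomial_mult vars_add)
  qed
  moreover have "p \<in> polys V" using ab v by (auto simp: face_ideal_def intro!: var_in_polys)
  ultimately show "p \<in> face_ideal V (deletion v \<Delta>)" by (auto simp: face_ideal_def)
next
  fix p :: "'k mpoly" assume p: "p \<in> face_ideal V (deletion v \<Delta>)"
  let ?P = "\<lambda>e. v \<notin> vars e"
  have pV: "p \<in> polys V" using p by (simp add: face_ideal_def)
  obtain q where q: "q \<in> polys V" "restrict_poly (\<lambda>e. \<not> ?P e) p = var v * q"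
    by (rule var_dvd[of "restrict_poly (\<lambda>e. \<not> ?P e) p" V v])
      (use pV in \<open>auto simp: restrict_poly_in keys_restrict_poly\<close>)
  have "restrict_poly ?P p \<in> face_ideal V \<Delta>"
    using p by (auto simp: face_ideal_def keys_restrict_poly deletion_def restrict_poly_in)
  moreover have "p = restrict_poly ?P p + var v * q"
    unfolding q(2)[symmetric] by (rule restrict_poly_split)
  ultimately show "p \<in> polys.adjoin V (face_ideal V \<Delta>) (var v)"
    using polys.adjoinI q(1) by blast
qed

section \<open>Decomposable complexes\<close>

text \<open>A variant of vertex decomposability along which the lower bound \<open>d\<close> for both depth and Stanley
  depth is inherited from the simplices at the end. The complex without any face is allowed because
  it arises as the link of a non-face.\<close>

inductive decomposable :: "nat set \<Rightarrow> nat \<Rightarrow> nat set set \<Rightarrow> bool" for V d where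
  decomposable_void: "decomposable V d {}"
| decomposable_simplex: "F \<subseteq> V \<Longrightarrow> d \<le> card F \<Longrightarrow> decomposable V d (Pow F)"
| decomposable_split: "v \<in> V \<Longrightarrow> decomposable V d (link v \<Delta>) \<Longrightarrow> decomposable V d (deletion v \<Delta>)
    \<Longrightarrow> decomposable V d \<Delta>"

section \<open>Lower bound for the depth\<close>

definition weight :: "nat set \<Rightarrow> (nat \<Rightarrow>\<^sub>0 nat) \<Rightarrow> nat" where
  "weight V e = (\<Sum>i\<in>V. Poly_Mapping.lookup e i)"

lemma weight_add: "weight V (a + b) = weight V a + weight V b"
  by (simp add: weight_def lookup_add sum.distrib)

lemma weight_pos:
  assumes "finite V" "vars e \<subseteq> V" "e \<noteq> 0"
  shows "0 < weight V e"
proof -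
  from assms(3) obtain i where "i \<in> vars e" by (metis keys_eq_empty ex_in_conv)
  then have "i \<in> V" "0 < Poly_Mapping.lookup e i" using assms(2) by (auto simp: in_keys_iff)
  then show ?thesis unfolding weight_def using assms(1) by (intro sum_pos2) auto
qed

definition homogeneous_poly :: "nat set \<Rightarrow> 'k::field mpoly \<Rightarrow> nat \<Rightarrow> bool" where
  "homogeneous_poly V f d \<longleftrightarrow> (\<forall>e\<in>Poly_Mapping.keys f. weight V e = d)"

definition homogeneous_ideal :: "nat set \<Rightarrow> 'k::field mpoly set \<Rightarrow> bool" where
  "homogeneous_ideal V N \<longleftrightarrow> (\<forall>p\<in>N. \<forall>k. restrict_poly (\<lambda>e. weight V e = k) p \<in> N)"

definition order_ge :: "nat set \<Rightarrow> nat \<Rightarrow> 'k::field mpoly \<Rightarrow> bool" where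
  "order_ge V j p \<longleftrightarrow> (\<forall>e\<in>Poly_Mapping.keys p. j \<le> weight V e)"

lemma order_ge_mult: "order_ge V j p \<Longrightarrow> order_ge V k q \<Longrightarrow> order_ge V (j + k) (p * q)"
  by (auto simp: order_ge_def weight_add add_mono elim!: keys_multE)

lemma order_ge_1:
  assumes "finite V" "p \<in> polys V" "Poly_Mapping.lookup p 0 = 0"
  shows "order_ge V 1 p"
  using assms weight_pos unfolding order_ge_def in_polys_iff
  by (metis One_nat_def Suc_leI in_keys_iff)

text \<open>Below degree \<open>j\<close>, the homogeneous components of \<open>p\<close> are those of an element of \<open>N\<close> and hence lie in
  \<open>N\<close>; for large \<open>j\<close> these are all components of \<open>p\<close>. In other words, a homogeneous ideal is closed in
  the topology given by the powers of the graded maximal ideal.\<close>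

lemma homogeneous_ideal_closed:
  assumes "polys.is_ideal V N" "homogeneous_ideal V N"
    and approx: "\<And>j. \<exists>a\<in>N. order_ge V j (p - a)"
  shows "p \<in> N"
proof -
  define j where "j = Suc (Max (insert 0 (weight V ` Poly_Mapping.keys p)))"
  have bound: "weight V e < j" if "e \<in> Poly_Mapping.keys p" for e
    using that unfolding j_def by (auto simp: less_Suc_eq_le)
  obtain a where a: "a \<in> N" "order_ge V j (p - a)" using approx by blast
  let ?c = "\<lambda>k. restrict_poly (\<lambda>e. weight V e = k)"
  have "?c k p \<in> N" if "k < j" for k
  proof -
    have "Poly_Mapping.lookup (p - a) e = 0" if "weight V e = k" for e
      using a(2) that \<open>k < j\<close> by (metis in_keys_iff not_le order_ge_def)
    then have "?c k p = ?c k a"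
      by (intro poly_mapping_eqI) (auto simp: lookup_restrict_poly lookup_minus)
    then show ?thesis using a assms(2) by (simp add: homogeneous_ideal_def)
  qed
  then have "(\<Sum>k<j. ?c k p) \<in> N"
    using assms(1) by (intro polys.ideal_sum) auto
  moreover have "p = (\<Sum>k<j. ?c k p)"
    by (rule poly_mapping_eqI) (use bound in \<open>auto simp: lookup_sum lookup_restrict_poly in_keys_iff\<close>)
  ultimately show ?thesis by simp
qed

lemma homogeneous_face_ideal: "homogeneous_ideal V (face_ideal V \<Delta>)"
  by (auto simp: homogeneous_ideal_def face_ideal_def keys_restrict_poly restrict_poly_in)

lemma homogeneous_adjoin:
  fixes f :: "'k::field mpoly"
  assumes N: "homogeneous_ideal V N" and f: "homogeneous_poly V f d"
  shows "homogeneous_ideal V (polys.adjoin V N f)"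
  unfolding homogeneous_ideal_def
proof (intro ballI allI)
  fix p k assume "p \<in> polys.adjoin V N f"
  then obtain a b where ab: "p = a + f * b" "a \<in> N" "b \<in> polys V" by (auto simp: polys.adjoin_def)
  let ?c = "\<lambda>k. restrict_poly (\<lambda>e. weight V e = k)"
  let ?P = "\<lambda>e. d + weight V e = k"
  have w: "weight V e = d + weight V e'" if "e = c + e'" "c \<in> Poly_Mapping.keys f" for e e' c
    using that f by (simp add: weight_add homogeneous_poly_def)
  have "f * b = f * restrict_poly ?P b + f * restrict_poly (\<lambda>e. \<not> ?P e) b"
    using restrict_poly_split[of b ?P] by (metis distrib_left)
  moreover have "?c k (f * restrict_poly ?P b) = f * restrict_poly ?P b"
    by (rule restrict_poly_id) (auto simp: keys_restrict_poly w elim!: keys_multE)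
  moreover have "?c k (f * restrict_poly (\<lambda>e. \<not> ?P e) b) = 0"
    by (rule restrict_poly_0) (auto simp: keys_restrict_poly w elim!: keys_multE)
  ultimately have "?c k p = ?c k a + f * restrict_poly ?P b"
    by (simp add: ab restrict_poly_add)
  then show "?c k p \<in> polys.adjoin V N f"
    using N ab by (intro polys.adjoinI) (auto simp: homogeneous_ideal_def restrict_poly_in)
qed

text \<open>If \<open>g x \<in> N\<close>, then \<open>x = a + f y\<close> with \<open>a \<in> N\<close> and again \<open>g y \<in> N\<close>; iterating this approximates
  \<open>x\<close> by elements of \<open>N\<close> to arbitrary order, so that \<open>x \<in> N\<close>. Without the grading, regular sequences
  cannot be permuted in general.\<close>

lemma regular_swap:
  fixes f g :: "'k::field mpoly"
  assumes V: "finite V" and N: "polys.is_ideal V N" "homogeneous_ideal V N"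
    and fg: "f \<in> polys V" "g \<in> polys V" and f0: "Poly_Mapping.lookup f 0 = 0"
    and reg: "polys.regular V N [f, g]"
  shows "polys.regular V N [g, f]"
proof -
  note I = polys.is_idealD[OF N(1)]
  have f: "x \<in> N" if "x \<in> polys V" "f * x \<in> N" for x
    using reg that by (simp add: polys.nonzerodivisor_def)
  have g: "x \<in> polys.adjoin V N f" if "x \<in> polys V" "g * x \<in> polys.adjoin V N f" for x
    using reg that by (simp add: polys.nonzerodivisor_def)
  have approx: "\<exists>a\<in>N. order_ge V j (x - a)" if "x \<in> polys V" "g * x \<in> N" for x j
    using that
  proof (induction j arbitrary: x)
    case 0
    then show ?case using I(2) by (auto simp: order_ge_def)
  next
    case (Suc j)
    have "g * x \<in> polys.adjoin V N f" using Suc.prems(2) polys.subset_adjoin by blast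
    then have "x \<in> polys.adjoin V N f" using g Suc.prems(1) by blast
    then obtain a y where ay: "x = a + f * y" "a \<in> N" "y \<in> polys V"
      by (auto simp: polys.adjoin_def)
    have "g * x - g * a \<in> N" using I(5)[OF Suc.prems(2) I(4)[OF fg(2) ay(2)]] .
    then have "f * (g * y) \<in> N" unfolding ay(1) by (simp add: algebra_simps)
    then have "g * y \<in> N" using f ay fg by blast
    then obtain b where b: "b \<in> N" "order_ge V j (y - b)" using Suc.IH ay by blast
    have "order_ge V (1 + j) (f * (y - b))"
      using order_ge_mult[OF order_ge_1[OF V fg(1) f0] b(2)] .
    then have "order_ge V (Suc j) (x - (a + f * b))" unfolding ay(1) by (simp add: algebra_simps)
    moreover have "a + f * b \<in> N" using I(3)[OF ay(2) I(4)[OF fg(1) b(1)]] .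
    ultimately show ?case by blast
  qed
  have "x \<in> N" if "x \<in> polys V" "g * x \<in> N" for x
    using homogeneous_ideal_closed[OF N] approx that by blast
  then have 1: "polys.nonzerodivisor V N g" by (auto simp: polys.nonzerodivisor_def)
  have "x \<in> polys.adjoin V N g" if x: "x \<in> polys V" "f * x \<in> polys.adjoin V N g" for x
  proof -
    obtain a y where ay: "f * x = a + g * y" "a \<in> N" "y \<in> polys V"
      using x by (auto simp: polys.adjoin_def)
    have "- a \<in> N" using I(5)[OF I(2) ay(2)] by simp
    moreover have "g * y = - a + f * x" using ay by (simp add: algebra_simps)
    ultimately have "g * y \<in> polys.adjoin V N f" using x by (auto intro: polys.adjoinI)
    then have "y \<in> polys.adjoin V N f" using g ay by blast
    then obtain b z where bz: "y = b + f * z" "b \<in> N" "z \<in> polys V"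
      by (auto simp: polys.adjoin_def)
    have "f * (x - g * z) = a + g * b" using ay bz by (simp add: algebra_simps)
    then have "f * (x - g * z) \<in> N" using I(3)[OF ay(2) I(4)[OF fg(2) bz(2)]] by simp
    moreover have "x - g * z \<in> polys V" using x fg bz by blast
    ultimately have "x - g * z \<in> N" using f by blast
    then show ?thesis using bz by (intro polys.adjoinI[of "x - g * z" _ z]) auto
  qed
  then show ?thesis using 1 by (simp add: polys.nonzerodivisor_def)
qed

lemma regular_move_to_end:
  fixes f :: "'k::field mpoly"
  assumes "finite V" "f \<in> polys V" "Poly_Mapping.lookup f 0 = 0"
    and "polys.is_ideal V N" "homogeneous_ideal V N"
    and "\<And>g. g \<in> set gs \<Longrightarrow> g \<in> polys V \<and> (\<exists>d. homogeneous_poly V g d)"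
    and "polys.regular V N (f # gs)"
  shows "polys.regular V N (gs @ [f])"
  using assms
proof (induction gs arbitrary: N)
  case (Cons g gs)
  have g: "g \<in> polys V" and "\<exists>d. homogeneous_poly V g d" using Cons.prems(6) by auto
  then have hom: "homogeneous_ideal V (polys.adjoin V N g)"
    using homogeneous_adjoin Cons.prems(5) by blast
  have "polys.regular V N [g, f]"
    using regular_swap[OF Cons.prems(1,4,5,2) g Cons.prems(3)] Cons.prems(7) by simp
  moreover have "polys.regular V (polys.adjoin V (polys.adjoin V N g) f) gs"
    using Cons.prems(7) polys.adjoin_commute[of V N f g] by simp
  ultimately have "polys.regular V (polys.adjoin V N g) (f # gs)"
    and "polys.nonzerodivisor V N g" by simp_all
  moreover have "polys.regular V (polys.adjoin V N g) (gs @ [f])"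
    using Cons.IH[OF Cons.prems(1-3) polys.adjoin_ideal[OF Cons.prems(4) g] hom Cons.prems(6)]
      calculation(1) by simp
  ultimately show ?case by simp
qed auto

definition elementary_symmetric :: "nat set \<Rightarrow> nat \<Rightarrow> 'k::field mpoly" where
  "elementary_symmetric V k = (\<Sum>G | G \<subseteq> V \<and> card G = k. monomial (indicator_exp G))"

lemma keys_elementary_symmetric:
  assumes "finite V" "e \<in> Poly_Mapping.keys (elementary_symmetric V k :: 'k::field mpoly)"
  obtains G where "G \<subseteq> V" "card G = k" "e = indicator_exp G"
proof -
  have "Poly_Mapping.keys (elementary_symmetric V k :: 'k mpoly)
      \<subseteq> (\<Union>G\<in>{G. G \<subseteq> V \<and> card G = k}. Poly_Mapping.keys (monomial (indicator_exp G) :: 'k mpoly))"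
    unfolding elementary_symmetric_def by (rule keys_sum)
  then have "\<exists>G\<in>{G. G \<subseteq> V \<and> card G = k}. e \<in> Poly_Mapping.keys (monomial (indicator_exp G) :: 'k mpoly)"
    using assms(2) by blast
  then show ?thesis using that by auto
qed

lemma weight_indicator_exp: "finite V \<Longrightarrow> G \<subseteq> V \<Longrightarrow> weight V (indicator_exp G) = card G"
  by (simp add: weight_def lookup_indicator_exp finite_subset sum.If_cases Int_absorb1)

lemma elementary_symmetric_in: "finite V \<Longrightarrow> elementary_symmetric V k \<in> polys V"
  unfolding elementary_symmetric_def
  by (intro polys.sum_in single_in_polys) (auto simp: vars_indicator_exp finite_subset)

lemma elementary_symmetric_homogeneous:
  "finite V \<Longrightarrow> homogeneous_poly V (elementary_symmetric V k) k"
  unfolding homogeneous_poly_def using keys_elementary_symmetric weight_indicator_exp by metis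

lemma monomial_indicator_insert:
  assumes "finite G" "v \<notin> G"
  shows "monomial (indicator_exp (insert v G)) = (var v * monomial (indicator_exp G) :: 'k::field mpoly)"
  using assms by (simp add: indicator_exp_def var_def mult_single)

text \<open>One sequence has to serve all simplices of a decomposition, whichever variables survive. If some
  \<open>x\<^sub>v\<close> with \<open>v \<in> F\<close> can be spared, the sequence is regular after setting \<open>x\<^sub>v\<close> to zero, and \<open>x\<^sub>v\<close> can
  be moved from its beginning to its end. If \<open>card F = d\<close>, the last polynomial becomes the product of
  the surviving variables, each of which is regular modulo the preceding polynomials by the
  same argument.\<close>

lemma elementary_symmetric_regular:
  assumes V: "finite V" and "F \<subseteq> V" and "d \<le> card F"
  shows "polys.regular V (face_ideal V (Pow F) :: 'k::field mpoly set)
    (map (elementary_symmetric V) [1..<Suc d])"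
  using assms(2,3)
proof (induction "card F" arbitrary: F d)
  case 0
  then show ?case by simp
next
  case (Suc m)
  let ?N = "face_ideal V (Pow F) :: 'k mpoly set"
  let ?es = "\<lambda>d. map (elementary_symmetric V) [1..<Suc d] :: 'k mpoly list"
  have N: "polys.is_ideal V ?N" by (rule face_ideal_ideal) (auto simp: down_closed_def)
  have F: "finite F" using Suc.prems V finite_subset by blast
  have move: "polys.regular V ?N (?es c @ [var v])" if v: "v \<in> F" and c: "c \<le> m" for v c
  proof -
    have "deletion v (Pow F) = Pow (F - {v})" by (auto simp: deletion_def)
    then have "polys.adjoin V ?N (var v) = face_ideal V (Pow (F - {v}))"
      using adjoin_face_ideal[of v V "Pow F"] v Suc.prems by auto
    moreover have "polys.regular V (face_ideal V (Pow (F - {v})) :: 'k mpoly set) (?es c)"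
      using Suc.hyps(2) Suc.prems v c F by (intro Suc.hyps(1)) auto
    moreover have "polys.nonzerodivisor V ?N (var v)"
    proof -
      have "link v (Pow F) = Pow F" using v by (auto simp: link_def)
      then show ?thesis
        using colon_face_ideal[of v V "Pow F"] v Suc.prems
        unfolding polys.nonzerodivisor_def by auto
    qed
    ultimately have "polys.regular V ?N (var v # ?es c)" by simp
    moreover note lookup_var_0[of v]
    ultimately show ?thesis
      using v Suc.prems N elementary_symmetric_in[OF V] elementary_symmetric_homogeneous[OF V]
      by (intro regular_move_to_end[OF V] homogeneous_face_ideal)
        (auto simp del: upt_Suc intro: var_in_polys)
  qed
  show ?case
  proof (cases "d \<le> m")
    case True
    obtain v where "v \<in> F" using Suc.hyps(2) by fastforce
    then show ?thesis using move[OF _ True] by (simp add: polys.regular_append)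
  next
    case False
    then have d: "d = Suc m" "card F = d" using Suc by auto
    let ?M = "fold (\<lambda>f N. polys.adjoin V N f) (?es m) ?N"
    have M: "polys.is_ideal V ?M" "?N \<subseteq> ?M"
      using N elementary_symmetric_in[OF V]
      by (intro polys.fold_adjoin_ideal polys.subset_fold_adjoin; auto simp del: upt_Suc)+
    have var: "x \<in> ?M" if "v \<in> F" "x \<in> polys V" "var v * x \<in> ?M" for v x
      using move[of v m] that by (auto simp: polys.regular_append polys.nonzerodivisor_def)
    have prod: "x \<in> ?M" if "G \<subseteq> F" "x \<in> polys V" "monomial (indicator_exp G) * x \<in> ?M" for G x
    proof -
      have "finite G" using that F finite_subset by blast
      then show ?thesis using that
      proof (induction G arbitrary: x rule: finite_induct)
        case empty
        then show ?case by (simp add: indicator_exp_def)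
      next
        case (insert v G)
        have v: "v \<in> F" "v \<in> V" using insert.prems(1) Suc.prems(1) by auto
        have "monomial (indicator_exp G) * (var v * x) \<in> ?M"
          using insert.prems(3) unfolding monomial_indicator_insert[OF insert.hyps(1,2)]
          by (simp only: mult.assoc mult.left_commute)
        moreover have "var v * x \<in> polys V"
          by (rule polys.mult_in[OF var_in_polys[OF v(2)] insert.prems(2)])
        ultimately have "var v * x \<in> ?M" using insert.IH insert.prems(1) by blast
        then show ?case using var v insert.prems(2) by blast
      qed
    qed
    have "elementary_symmetric V d - monomial (indicator_exp F) \<in> ?N"
    proof -
      have "elementary_symmetric V d - monomial (indicator_exp F)
          = (\<Sum>G\<in>{G. G \<subseteq> V \<and> card G = d} - {F}. monomial (indicator_exp G) :: 'k mpoly)"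
        unfolding elementary_symmetric_def using d Suc.prems V
        by (subst sum.remove[of _ F]) auto
      also have "\<dots> \<in> ?N"
      proof (rule polys.ideal_sum[OF N])
        fix G assume G: "G \<in> {G. G \<subseteq> V \<and> card G = d} - {F}"
        then have "finite G" using V finite_subset by blast
        have "G \<noteq> F" "card G = card F" using G d by auto
        then have "\<not> G \<subseteq> F" using card_subset_eq[OF F] by blast
        then show "(monomial (indicator_exp G) :: 'k mpoly) \<in> ?N"
          using G single_in_polys[of "indicator_exp G" V]
          by (simp add: face_ideal_def vars_indicator_exp \<open>finite G\<close>)
      qed
      finally show ?thesis .
    qed
    then have diff: "elementary_symmetric V d - monomial (indicator_exp F) \<in> ?M" using M by blast
    have "x \<in> ?M" if x: "x \<in> polys V" "elementary_symmetric V d * x \<in> ?M" for x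
    proof -
      have "elementary_symmetric V d * x
          - x * (elementary_symmetric V d - monomial (indicator_exp F)) \<in> ?M"
        using polys.is_idealD(4,5)[OF M(1)] diff x by blast
      then have "monomial (indicator_exp F) * x \<in> ?M" by (simp add: algebra_simps)
      then show ?thesis using prod x by blast
    qed
    moreover obtain v where "v \<in> F" using Suc.hyps(2) by fastforce
    ultimately show ?thesis
      using move[of v m] d by (simp add: polys.regular_append polys.nonzerodivisor_def)
  qed
qed

lemma decomposable_regular:
  assumes V: "finite V" and "decomposable V d \<Delta>" and "down_closed \<Delta>"
  shows "polys.regular V (face_ideal V \<Delta> :: 'k::field mpoly set)
    (map (elementary_symmetric V) [1..<Suc d])"
  using assms(2,3)
proof induction
  case decomposable_void
  have "face_ideal V {} = (polys V :: 'k mpoly set)" by (auto simp: face_ideal_def)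
  then show ?case
    using elementary_symmetric_in[OF V] by (auto simp del: upt_Suc intro!: polys.regular_carrier)
next
  case (decomposable_simplex F)
  then show ?case using V by (intro elementary_symmetric_regular)
next
  case (decomposable_split v \<Delta>)
  then have v: "v \<in> V" and \<Delta>: "down_closed \<Delta>" by simp_all
  show ?case
  proof (rule polys.regular_colon[OF face_ideal_ideal[OF \<Delta>] var_in_polys[OF v]])
    show "set (map (elementary_symmetric V) [1..<Suc d]) \<subseteq> (polys V :: 'k mpoly set)"
      using elementary_symmetric_in[OF V] by auto
  qed (unfold colon_face_ideal[OF v] adjoin_face_ideal[OF v],
      use decomposable_split.IH \<Delta> in \<open>simp_all only: down_closed_link down_closed_deletion\<close>)
qed

section \<open>Upper bound for the depth\<close>

lemma linear_relation:
  fixes M :: "'a \<Rightarrow> 'b \<Rightarrow> 'k::field"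
  assumes "finite E" "finite A" "card E < card A"
  obtains c where "\<exists>\<alpha>\<in>A. c \<alpha> \<noteq> 0" "\<And>e. e \<in> E \<Longrightarrow> (\<Sum>\<alpha>\<in>A. c \<alpha> * M \<alpha> e) = 0"
proof -
  have "\<exists>c. (\<exists>\<alpha>\<in>A. c \<alpha> \<noteq> 0) \<and> (\<forall>e\<in>E. (\<Sum>\<alpha>\<in>A. c \<alpha> * M \<alpha> e) = 0)"
    using assms
  proof (induction E arbitrary: A M rule: finite_induct)
    case empty
    then have "A \<noteq> {}" by auto
    then show ?case by (intro exI[of _ "\<lambda>_. 1"]) auto
  next
    case (insert e E)
    show ?case
    proof (cases "\<exists>\<alpha>\<in>A. M \<alpha> e \<noteq> 0")
      case False
      have "card E < card A" using insert by simp
      then show ?thesis using insert.IH[of A M] insert.prems False by auto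
    next
      case True
      then obtain \<alpha>0 where \<alpha>0: "\<alpha>0 \<in> A" "M \<alpha>0 e \<noteq> 0" by auto
      \<comment> \<open>one step of Gaussian elimination with pivot \<open>M \<alpha>\<^sub>0 e\<close>\<close>
      define q where "q \<alpha> = M \<alpha> e / M \<alpha>0 e" for \<alpha>
      have "card E < card (A - {\<alpha>0})" using insert \<alpha>0 by simp
      then obtain c where c: "\<exists>\<alpha>\<in>A - {\<alpha>0}. c \<alpha> \<noteq> 0"
        "\<forall>x\<in>E. (\<Sum>\<alpha>\<in>A - {\<alpha>0}. c \<alpha> * (M \<alpha> x - q \<alpha> * M \<alpha>0 x)) = 0"
        using insert.IH[of "A - {\<alpha>0}" "\<lambda>\<alpha> x. M \<alpha> x - q \<alpha> * M \<alpha>0 x"] insert.prems by auto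
      define c' where "c' = c(\<alpha>0 := - (\<Sum>\<alpha>\<in>A - {\<alpha>0}. c \<alpha> * q \<alpha>))"
      have sum: "(\<Sum>\<alpha>\<in>A. c' \<alpha> * M \<alpha> x) = (\<Sum>\<alpha>\<in>A - {\<alpha>0}. c \<alpha> * (M \<alpha> x - q \<alpha> * M \<alpha>0 x))" for x
      proof -
        have "(\<Sum>\<alpha>\<in>A. c' \<alpha> * M \<alpha> x) = c' \<alpha>0 * M \<alpha>0 x + (\<Sum>\<alpha>\<in>A - {\<alpha>0}. c' \<alpha> * M \<alpha> x)"
          using insert.prems \<alpha>0 by (simp add: sum.remove)
        also have "(\<Sum>\<alpha>\<in>A - {\<alpha>0}. c' \<alpha> * M \<alpha> x) = (\<Sum>\<alpha>\<in>A - {\<alpha>0}. c \<alpha> * M \<alpha> x)"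
          by (intro sum.cong) (auto simp: c'_def)
        finally show ?thesis
          by (simp add: c'_def sum_distrib_right sum_subtractf right_diff_distrib mult.assoc)
      qed
      have "(\<Sum>\<alpha>\<in>A. c' \<alpha> * M \<alpha> e) = 0" unfolding sum using \<alpha>0 by (simp add: q_def)
      moreover have "(\<Sum>\<alpha>\<in>A. c' \<alpha> * M \<alpha> x) = 0" if "x \<in> E" for x unfolding sum using c that by blast
      moreover have "\<exists>\<alpha>\<in>A. c' \<alpha> \<noteq> 0" using c(1) by (auto simp: c'_def)
      ultimately show ?thesis by blast
    qed
  qed
  then show ?thesis using that by blast
qed

definition degrees_le :: "nat \<Rightarrow> 'k::field mpoly \<Rightarrow> bool" where
  "degrees_le B p \<longleftrightarrow> (\<forall>e\<in>Poly_Mapping.keys p. \<forall>i. Poly_Mapping.lookup e i \<le> B)"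

lemma degrees_le_mult: "degrees_le a p \<Longrightarrow> degrees_le b q \<Longrightarrow> degrees_le (a + b) (p * q)"
  by (auto simp: degrees_le_def lookup_add add_mono elim!: keys_multE)

lemma degrees_le_power: "degrees_le a p \<Longrightarrow> degrees_le (k * a) (p ^ k)"
proof (induction k)
  case (Suc k)
  then show ?case using degrees_le_mult by auto
qed (simp add: degrees_le_def)

lemma degrees_le_power_product:
  "(\<And>f. f \<in> set fs \<Longrightarrow> degrees_le \<delta> f) \<Longrightarrow>
    degrees_le (sum_list \<alpha> * \<delta>) (polys.power_product fs \<alpha> :: 'k::field mpoly)"
proof (induction fs \<alpha> rule: polys.power_product.induct)
  case (1 f fs i \<alpha>)
  then show ?case
    using degrees_le_mult[OF degrees_le_power[of \<delta> f i]] by (simp add: add_mult_distrib)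
qed (auto simp: degrees_le_def)

lemma ex_degrees_le:
  fixes fs :: "'k::field mpoly list"
  obtains \<delta> where "\<And>f. f \<in> set fs \<Longrightarrow> degrees_le \<delta> f"
proof -
  let ?R = "\<Union>f\<in>set fs. \<Union>e\<in>Poly_Mapping.keys f. Poly_Mapping.range e"
  define \<delta> where "\<delta> = Max (insert 0 ?R)"
  have "Poly_Mapping.lookup e i \<le> \<delta>" if "f \<in> set fs" "e \<in> Poly_Mapping.keys f" for f e i
  proof (cases "i \<in> vars e")
    case True
    then have "Poly_Mapping.lookup e i \<in> Poly_Mapping.range e" by (rule in_keys_lookup_in_range)
    then have "Poly_Mapping.lookup e i \<in> insert 0 ?R" using that by blast
    then show ?thesis unfolding \<delta>_def by (intro Max_ge) auto
  qed (auto simp: in_keys_iff)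
  then show ?thesis using that unfolding degrees_le_def by blast
qed

lemma card_bounded_exponents:
  assumes "finite F"
  shows "finite {e. vars e \<subseteq> F \<and> (\<forall>i. Poly_Mapping.lookup e i \<le> B)}" (is "finite ?E")
    and "card {e. vars e \<subseteq> F \<and> (\<forall>i. Poly_Mapping.lookup e i \<le> B)} \<le> Suc B ^ card F"
proof -
  let ?r = "\<lambda>e. restrict (Poly_Mapping.lookup e) F"
  have inj: "inj_on ?r ?E"
  proof (rule inj_onI, rule poly_mapping_eqI)
    fix e e' i assume e: "e \<in> ?E" "e' \<in> ?E" "?r e = ?r e'"
    show "Poly_Mapping.lookup e i = Poly_Mapping.lookup e' i"
    proof (cases "i \<in> F")
      case True
      then show ?thesis using fun_cong[OF e(3), of i] by simp
    next
      case False
      then have "i \<notin> vars e" "i \<notin> vars e'" using e by auto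
      then show ?thesis by (simp add: in_keys_iff)
    qed
  qed
  have sub: "?r ` ?E \<subseteq> PiE F (\<lambda>_. {..B})" by auto
  have fin: "finite (PiE F (\<lambda>_. {..B}))" using assms by (intro finite_PiE) auto
  show "finite ?E" by (rule finite_imageD[OF finite_subset[OF sub fin] inj])
  have "card ?E = card (?r ` ?E)" using inj by (simp add: card_image)
  also have "\<dots> \<le> card (PiE F (\<lambda>_. {..B}))" using sub fin by (intro card_mono)
  also have "\<dots> = Suc B ^ card F" using assms by (simp add: card_PiE)
  finally show "card ?E \<le> Suc B ^ card F" .
qed

lemma constant_unit: "c \<noteq> 0 \<Longrightarrow> polys.unit_in V (Poly_Mapping.single 0 c :: 'k::field mpoly)"
  unfolding polys.unit_in_def
  by (auto intro!: single_in_polys bexI[of _ "Poly_Mapping.single 0 (inverse c)"] simp: mult_single)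

text \<open>Each factor \<open>f \<in> A\<close> raises the degree of every monomial by at least one. A monomial outside the
  face ideal therefore has finite order.\<close>

lemma adic_face_ideal_weight:
  fixes x :: "'k::field mpoly"
  assumes V: "finite V" and "down_closed \<Delta>" and A: "A \<subseteq> polys V"
    and A0: "\<And>f. f \<in> A \<Longrightarrow> Poly_Mapping.lookup f 0 = 0"
    and "polys.adic V (face_ideal V \<Delta>) A j x" and "e \<in> Poly_Mapping.keys x" "vars e \<in> \<Delta>"
  shows "j \<le> weight V e"
  using assms(5,6,7)
proof (induction arbitrary: e)
  case (adic_base x k)
  then show ?case by (auto simp: face_ideal_def)
next
  case (adic_step f k x)
  from adic_step.prems(1) obtain a b where ab: "e = a + b" "a \<in> Poly_Mapping.keys f"
    "b \<in> Poly_Mapping.keys x" by (rule keys_multE)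
  have "vars b \<in> \<Delta>"
    using adic_step.prems(2) assms(2) unfolding ab(1) vars_add down_closed_def by blast
  then have "k \<le> weight V b" using adic_step.IH ab by blast
  moreover have "order_ge V 1 f" using V A A0 adic_step.hyps by (intro order_ge_1) auto
  then have "1 \<le> weight V a" using ab(2) by (auto simp: order_ge_def)
  ultimately show ?case by (simp add: ab weight_add)
next
  case (adic_add k x y)
  then show ?case by (auto elim!: keys_addE)
qed auto

text \<open>The monomial \<open>x\<^sup>F\<close> of a facet is annihilated by every variable outside \<open>F\<close>, so the multiples of
  \<open>x\<^sup>F\<close> form a copy of \<open>K[F]\<close>. A sequence longer than \<open>card F\<close> is algebraically dependent in \<open>K[F]\<close>:
  among its power products with exponents at most \<open>D\<close> there are more than monomials available
  for them. A polynomial relation annihilates \<open>x\<^sup>F\<close>, which by independence of a regular sequence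
  would have infinite order.\<close>

lemma regular_length_le_facet:
  fixes fs :: "'k::field mpoly list"
  assumes V: "finite V" and \<Delta>: "down_closed \<Delta>" and F: "F \<in> \<Delta>" "F \<subseteq> V"
    and facet: "\<And>v. v \<in> V - F \<Longrightarrow> insert v F \<notin> \<Delta>"
    and fs: "set fs \<subseteq> polys V" "\<And>f. f \<in> set fs \<Longrightarrow> Poly_Mapping.lookup f 0 = 0"
    and reg: "polys.regular V (face_ideal V \<Delta>) fs"
  shows "length fs \<le> card F"
proof (rule ccontr)
  assume "\<not> length fs \<le> card F"
  then have r: "Suc (card F) \<le> length fs" by simp
  have finF: "finite F" using F V finite_subset by blast
  let ?r = "length fs"
  obtain \<delta> where \<delta>: "\<And>f. f \<in> set fs \<Longrightarrow> degrees_le \<delta> f" using ex_degrees_le by blast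
  \<comment> \<open>\<open>D\<close> is chosen so that \<open>(r D \<delta> + 1)\<^sup>d < (D + 1)\<^sup>r\<close> whenever \<open>d < r\<close>\<close>
  define D where "D = (?r * \<delta> + 1) ^ card F"
  define A where "A = {\<alpha> :: nat list. set \<alpha> \<subseteq> {..D} \<and> length \<alpha> = ?r}"
  define E where "E = {e. vars e \<subseteq> F \<and> (\<forall>i. Poly_Mapping.lookup e i \<le> ?r * D * \<delta>)}"
  have finE: "finite E" and cardE: "card E \<le> Suc (?r * D * \<delta>) ^ card F"
    unfolding E_def using card_bounded_exponents[OF finF] by blast+
  have finA: "finite A" unfolding A_def by (rule finite_lists_length_eq) simp
  have "Suc (?r * D * \<delta>) \<le> (?r * \<delta> + 1) * Suc D" by (simp add: algebra_simps)
  then have "Suc (?r * D * \<delta>) ^ card F \<le> ((?r * \<delta> + 1) * Suc D) ^ card F" by (rule power_mono) simp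
  also have "\<dots> = D * Suc D ^ card F" by (simp only: power_mult_distrib D_def)
  also have "\<dots> < Suc D ^ Suc (card F)" by simp
  also have "\<dots> \<le> Suc D ^ ?r" using r by (intro power_increasing) auto
  also have "\<dots> = card A" unfolding A_def by (subst card_lists_length_eq) auto
  finally have "card E < card A" using cardE by linarith
  from linear_relation[OF finE finA this,
      where M = "\<lambda>\<alpha> e. Poly_Mapping.lookup (polys.power_product fs \<alpha>) e"]
  obtain c where c: "\<exists>\<alpha>\<in>A. c \<alpha> \<noteq> 0"
    and rel: "\<And>e. e \<in> E \<Longrightarrow> (\<Sum>\<alpha>\<in>A. c \<alpha> * Poly_Mapping.lookup (polys.power_product fs \<alpha>) e) = 0"
    by blast
  let ?c = "\<lambda>\<alpha>. Poly_Mapping.single 0 (c \<alpha>) :: 'k mpoly"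
  define p where "p = (\<Sum>\<alpha>\<in>A. ?c \<alpha> * polys.power_product fs \<alpha>)"
  have lookup_p: "Poly_Mapping.lookup p e
      = (\<Sum>\<alpha>\<in>A. c \<alpha> * Poly_Mapping.lookup (polys.power_product fs \<alpha>) e)" for e
  proof -
    have "Poly_Mapping.lookup (Poly_Mapping.single 0 x * q) e = x * Poly_Mapping.lookup q e"
      for x :: 'k and q using lookup_single_mult[of 0 x q e] by simp
    then show ?thesis by (simp add: p_def lookup_sum)
  qed
  have pV: "p \<in> polys V"
    unfolding p_def using fs
    by (intro polys.sum_in polys.mult_in polys.power_product_in single_in_polys) auto
  have outside: "\<not> vars e \<subseteq> F" if e: "e \<in> Poly_Mapping.keys p" for e
  proof
    assume "vars e \<subseteq> F"
    have "(\<Sum>\<alpha>\<in>A. c \<alpha> * Poly_Mapping.lookup (polys.power_product fs \<alpha>) e) \<noteq> 0"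
      using e by (simp add: in_keys_iff lookup_p)
    then obtain \<alpha> where \<alpha>: "\<alpha> \<in> A" "Poly_Mapping.lookup (polys.power_product fs \<alpha>) e \<noteq> 0"
      by (rule sum.not_neutral_contains_not_neutral) auto
    have "sum_list \<alpha> \<le> ?r * D"
      using \<alpha>(1) sum_list_mono[of \<alpha> "\<lambda>x. x" "\<lambda>_. D"]
      by (auto simp: A_def sum_list_triv subset_iff)
    then have "sum_list \<alpha> * \<delta> \<le> ?r * D * \<delta>" by simp
    moreover have "Poly_Mapping.lookup e i \<le> sum_list \<alpha> * \<delta>" for i
      using degrees_le_power_product[of fs \<delta> \<alpha>] \<delta> \<alpha>(2) by (auto simp: degrees_le_def in_keys_iff)
    ultimately have "e \<in> E" using \<open>vars e \<subseteq> F\<close> le_trans unfolding E_def by blast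
    then show False using rel e by (simp add: in_keys_iff lookup_p)
  qed
  let ?x = "monomial (indicator_exp F) :: 'k mpoly"
  have x: "?x \<in> polys V" using F finF by (intro single_in_polys) (simp add: vars_indicator_exp)
  have "p * ?x \<in> face_ideal V \<Delta>"
  proof -
    have "vars e \<notin> \<Delta>" if e: "e \<in> Poly_Mapping.keys (?x * p)" for e
    proof
      assume "vars e \<in> \<Delta>"
      obtain b where b: "b \<in> Poly_Mapping.keys p" "e = indicator_exp F + b"
        using e unfolding keys_monomial_mult by blast
      obtain v where v: "v \<in> vars b" "v \<notin> F" using outside[OF b(1)] by blast
      then have "v \<in> V" using b pV by (auto simp: in_polys_iff)
      moreover have "insert v F \<subseteq> vars e" using v finF by (auto simp: b vars_add vars_indicator_exp)
      ultimately show False using facet v \<Delta> \<open>vars e \<in> \<Delta>\<close> unfolding down_closed_def by blast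
    qed
    moreover have "?x * p \<in> polys V" by (rule polys.mult_in[OF x pV])
    ultimately show ?thesis unfolding face_ideal_def by (simp add: mult.commute)
  qed
  moreover obtain \<alpha>0 where "\<alpha>0 \<in> A" "?c \<alpha>0 \<noteq> 0" using c by (metis lookup_single_eq lookup_zero)
  moreover have "?c \<alpha> = 0 \<or> polys.unit_in V (?c \<alpha>)" for \<alpha>
    by (cases "c \<alpha> = 0") (auto intro: constant_unit)
  ultimately have "polys.adic V (face_ideal V \<Delta>) (set fs) j ?x" for j
    using fs(1) reg finA x face_ideal_ideal[OF \<Delta>]
    by (intro polys.regular_sequence_independent[where A = A and c = ?c and \<beta> = \<alpha>0])
      (auto simp: p_def A_def)
  then have "j \<le> weight V (indicator_exp F)" for j
    using adic_face_ideal_weight[OF V \<Delta> fs(1), of j ?x "indicator_exp F"] fs(2) F finF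
    by (auto simp: vars_indicator_exp)
  then show False using not_less_eq_eq by blast
qed

section \<open>Partitions into cones\<close>

definition in_cone :: "(nat \<Rightarrow>\<^sub>0 nat) \<times> nat set \<Rightarrow> (nat \<Rightarrow>\<^sub>0 nat) \<Rightarrow> bool" where
  "in_cone x e \<longleftrightarrow> (\<exists>h. e = fst x + h \<and> vars h \<subseteq> snd x)"

text \<open>Counting the cones that contain a monomial by the length of a filtered list expresses in one
  equation that the cones are disjoint and cover the monomials outside the face ideal, and it is
  compatible with appending and shifting lists of cones.\<close>

definition cone_partition :: "nat set \<Rightarrow> nat set set \<Rightarrow> ((nat \<Rightarrow>\<^sub>0 nat) \<times> nat set) list \<Rightarrow> bool" where
  "cone_partition V \<Delta> L \<longleftrightarrow> (\<forall>(e, Z)\<in>set L. vars e \<subseteq> V \<and> Z \<subseteq> V) \<and>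
    (\<forall>e. length (filter (\<lambda>x. in_cone x e) L) = (if vars e \<in> \<Delta> then 1 else 0))"

lemma in_cone_shift:
  "in_cone (Poly_Mapping.single v 1 + e', Z) e \<longleftrightarrow>
    v \<in> vars e \<and> in_cone (e', Z) (e - Poly_Mapping.single v 1)"
proof
  assume "in_cone (Poly_Mapping.single v 1 + e', Z) e"
  then obtain h where h: "e = Poly_Mapping.single v 1 + (e' + h)" "vars h \<subseteq> Z"
    by (auto simp: in_cone_def add.assoc)
  then have "v \<in> vars e" unfolding h(1) vars_add by simp
  moreover have "e - Poly_Mapping.single v 1 = e' + h" unfolding h(1) by simp
  ultimately show "v \<in> vars e \<and> in_cone (e', Z) (e - Poly_Mapping.single v 1)"
    using h(2) by (auto simp: in_cone_def)
next
  assume *: "v \<in> vars e \<and> in_cone (e', Z) (e - Poly_Mapping.single v 1)"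
  then obtain h where "e - Poly_Mapping.single v 1 = e' + h" "vars h \<subseteq> Z"
    by (auto simp: in_cone_def)
  then show "in_cone (Poly_Mapping.single v 1 + e', Z) e"
    using exponent_split[of v e] * by (auto simp: in_cone_def add.assoc)
qed

text \<open>The monomials not involving \<open>x\<^sub>v\<close> correspond to the deletion of \<open>v\<close>, the multiples of \<open>x\<^sub>v\<close> to its
  link.\<close>

lemma decomposable_cone_partition:
  assumes "decomposable V d \<Delta>"
  shows "\<exists>L. cone_partition V \<Delta> L \<and> (\<forall>(e, Z)\<in>set L. d \<le> card Z)"
  using assms
proof induction
  case decomposable_void
  show ?case by (intro exI[of _ "[]"]) (simp add: cone_partition_def)
next
  case (decomposable_simplex F)
  then show ?case
    by (intro exI[of _ "[(0, F)]"]) (auto simp: cone_partition_def in_cone_def)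
next
  case (decomposable_split v \<Delta>)
  obtain L1 where L1: "cone_partition V (link v \<Delta>) L1" "\<forall>(e, Z)\<in>set L1. d \<le> card Z"
    using decomposable_split by blast
  obtain L0 where L0: "cone_partition V (deletion v \<Delta>) L0" "\<forall>(e, Z)\<in>set L0. d \<le> card Z"
    using decomposable_split by blast
  define shift where "shift = (\<lambda>(e, Z :: nat set). (Poly_Mapping.single v 1 + e :: nat \<Rightarrow>\<^sub>0 nat, Z))"
  have "cone_partition V \<Delta> (L0 @ map shift L1)"
    unfolding cone_partition_def
  proof (intro conjI allI)
    show "\<forall>(e, Z)\<in>set (L0 @ map shift L1). vars e \<subseteq> V \<and> Z \<subseteq> V"
    proof -
      have "x \<in> V" if "(e, Z) \<in> set L0 \<union> set L1" "x \<in> vars e \<union> Z" for x e Z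
        using that L0(1) L1(1) unfolding cone_partition_def by blast
      then show ?thesis using decomposable_split.hyps(1) by (auto simp: shift_def vars_add; blast)
    qed
    fix e :: "nat \<Rightarrow>\<^sub>0 nat"
    let ?e = "e - Poly_Mapping.single v 1"
    have shift: "in_cone (shift x) e \<longleftrightarrow> v \<in> vars e \<and> in_cone x ?e" for x
      using in_cone_shift[of v "fst x" "snd x" e] by (simp add: shift_def split_beta)
    have len1: "length (filter (\<lambda>x. in_cone x ?e) L1) = (if vars ?e \<in> link v \<Delta> then 1 else 0)"
      and len0: "length (filter (\<lambda>x. in_cone x e) L0) = (if vars e \<in> deletion v \<Delta> then 1 else 0)"
      using L0(1) L1(1) unfolding cone_partition_def by blast+
    have split: "length (filter (\<lambda>x. in_cone x e) (L0 @ map shift L1))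
        = length (filter (\<lambda>x. in_cone x e) L0)
          + length (filter (\<lambda>x. v \<in> vars e \<and> in_cone x ?e) L1)"
      by (simp add: filter_map o_def shift)
    show "length (filter (\<lambda>x. in_cone x e) (L0 @ map shift L1)) = (if vars e \<in> \<Delta> then 1 else 0)"
    proof (cases "v \<in> vars e")
      case True
      have "insert v (vars ?e) = vars e"
        using arg_cong[OF exponent_split[OF True], of "vars"] vars_add[of "Poly_Mapping.single v 1" ?e]
        by simp
      then show ?thesis
        unfolding split len0 using True len1 by (simp add: link_def deletion_def)
    next
      case False
      then show ?thesis unfolding split len0 by (simp add: deletion_def)
    qed
  qed
  moreover have "\<forall>(e, Z)\<in>set (L0 @ map shift L1). d \<le> card Z"
    using L0(2) L1(2) by (auto simp: shift_def)
  ultimately show ?case by blast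
qed

section \<open>Path complexes\<close>

text \<open>A list of pairwise disjoint blocks generalizes a path graph, whose vertices correspond to the
  blocks: an edge consists of two consecutive blocks.\<close>

fun has_edge :: "'a set list \<Rightarrow> 'a set \<Rightarrow> bool" where
  "has_edge (B # C # Bs) G \<longleftrightarrow> B \<union> C \<subseteq> G \<or> has_edge (C # Bs) G"
| "has_edge _ G \<longleftrightarrow> False"

fun disjoint_blocks :: "'a set list \<Rightarrow> bool" where
  "disjoint_blocks (B # Bs) \<longleftrightarrow> B \<inter> \<Union>(set Bs) = {} \<and> disjoint_blocks Bs"
| "disjoint_blocks [] \<longleftrightarrow> True"

definition path_complex :: "'a set \<Rightarrow> 'a set list \<Rightarrow> 'a set set" where
  "path_complex K Bs = {G. G \<subseteq> K \<union> \<Union>(set Bs) \<and> \<not> has_edge Bs G}"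

text \<open>The number of vertices of a path on \<open>q\<close> vertices outside a smallest maximal independent set.\<close>

definition path_defect :: "nat \<Rightarrow> nat" where
  "path_defect q = q - (q + 2) div 3"

lemma path_defect_simps [simp]:
  "path_defect 0 = 0" "path_defect (Suc 0) = 0" "path_defect (Suc (Suc 0)) = 1"
  "path_defect (Suc (Suc (Suc q))) = path_defect q + 2"
  by (simp_all add: path_defect_def)

lemma path_defect_Suc_Suc: "path_defect (Suc (Suc q)) \<ge> path_defect q + 1"
proof -
  let ?x = "(q + 2) div 3" and ?y = "(q + 4) div 3"
  have "3 * ?x \<le> q + 2" "q + 2 < 3 * ?x + 3" "3 * ?y \<le> q + 4"
    using dividend_less_times_div[of 3 "q + 2"] by (simp_all add: times_div_less_eq_dividend)
  then show ?thesis unfolding path_defect_def by simp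
qed

lemma has_edge_mono: "has_edge Bs G \<Longrightarrow> G \<subseteq> H \<Longrightarrow> has_edge Bs H"
  by (induction Bs G rule: has_edge.induct) auto

lemma has_edge_cong: "G \<inter> \<Union>(set Bs) = H \<inter> \<Union>(set Bs) \<Longrightarrow> has_edge Bs G \<longleftrightarrow> has_edge Bs H"
proof (induction Bs G rule: has_edge.induct)
  case (1 B C Bs G)
  have "B \<union> C \<subseteq> G \<longleftrightarrow> B \<union> C \<subseteq> H" using 1(2) by auto
  moreover have "has_edge (C # Bs) G \<longleftrightarrow> has_edge (C # Bs) H"
    using 1(2) by (intro 1(1)) auto
  ultimately show ?case by simp
qed auto

lemma has_edge_Cons_missing:
  assumes "\<not> B \<subseteq> G"
  shows "has_edge (B # Bs) G \<longleftrightarrow> has_edge Bs G"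
  using assms by (cases Bs) auto

text \<open>The complex is split at the vertices of \<open>B\<close> one after another. Either all of \<open>B\<close> is put into the
  face, or some \<open>x\<close> is the first vertex to be deleted, and then \<open>Y\<close> consists of the vertices before it.\<close>

lemma decomposable_block:
  assumes "finite B" "B \<subseteq> V"
    and "decomposable V d {G. G \<union> B \<in> \<Delta>}"
    and "\<And>x Y. x \<in> B \<Longrightarrow> Y \<subseteq> B - {x} \<Longrightarrow> decomposable V d {G. x \<notin> G \<and> G \<union> Y \<in> \<Delta>}"
  shows "decomposable V d \<Delta>"
  using assms
proof (induction B arbitrary: \<Delta> rule: finite_induct)
  case (insert b B)
  have "decomposable V d (deletion b \<Delta>)"
    using insert.prems(3)[of b "{}"] by (simp add: deletion_def conj_commute)
  moreover have "decomposable V d (link b \<Delta>)"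
  proof (rule insert.IH)
    show "decomposable V d {G. G \<union> B \<in> link b \<Delta>}"
      using insert.prems(2) by (simp add: link_def)
    fix x Y assume "x \<in> B" "Y \<subseteq> B - {x}"
    then have "decomposable V d {G. x \<notin> G \<and> G \<union> insert b Y \<in> \<Delta>}"
      using insert.hyps by (intro insert.prems(3)) auto
    then show "decomposable V d {G. x \<notin> G \<and> G \<union> Y \<in> link b \<Delta>}"
      by (simp add: link_def)
  qed (use insert.prems in auto)
  ultimately show ?case using insert.prems(1) by (auto intro: decomposable_split)
qed simp

text \<open>The path is decomposed at its second block \<open>C\<close>. If \<open>C\<close> is kept entirely, one vertex of each
  neighbouring block has to go and the path loses three blocks at the expense of two vertices.
  If a vertex of \<open>C\<close> is deleted, the path loses two blocks at the expense of one vertex.\<close>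

lemma decomposable_path:
  fixes Bs :: "nat set list"
  assumes "finite V" "K \<union> \<Union>(set Bs) \<subseteq> V" "K \<inter> \<Union>(set Bs) = {}" "disjoint_blocks Bs"
    and "d + path_defect (length Bs) \<le> card (K \<union> \<Union>(set Bs))"
  shows "decomposable V d (path_complex K Bs)"
  using assms(2-5)
proof (induction "length Bs" arbitrary: K Bs rule: less_induct)
  case less
  have card_remove: "card (X - {x}) = card X - 1" "card X \<ge> 1" if "x \<in> X" "X \<subseteq> V" for x X
    using that assms(1) by (auto simp: finite_subset Suc_le_eq card_gt_0_iff)
  have simplex: "decomposable V d (path_complex K Bs)" if "\<And>G. \<not> has_edge Bs G"
  proof -
    have "path_complex K Bs = Pow (K \<union> \<Union>(set Bs))" using that by (auto simp: path_complex_def)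
    then show ?thesis using less.prems by (auto intro!: decomposable_simplex)
  qed
  consider B C Bs' where "Bs = B # C # Bs'" | "Bs = []" | B where "Bs = [B]"
    by (metis list.exhaust)
  then show ?case
  proof cases
    case (1 B C Bs')
    have Bs: "Bs = B # C # Bs'" using 1 by simp
    have sets: "B \<subseteq> V" "C \<subseteq> V" "K \<subseteq> V" "\<Union>(set Bs') \<subseteq> V" using less.prems Bs by auto
    have fin: "finite B" "finite C" by (simp_all add: finite_subset[OF _ assms(1)] sets)
    have disj: "B \<inter> C = {}" "B \<inter> \<Union>(set Bs') = {}" "C \<inter> \<Union>(set Bs') = {}" "K \<inter> B = {}"
      "K \<inter> C = {}" "K \<inter> \<Union>(set Bs') = {}" "disjoint_blocks Bs'"
      using less.prems Bs by auto
    show ?thesis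
    proof (rule decomposable_block[OF fin(2) sets(2)])
      fix x Y assume x: "x \<in> C" "Y \<subseteq> C - {x}"
      let ?K = "K \<union> B \<union> (C - {x})"
      have edge: "has_edge Bs (G \<union> Y) \<longleftrightarrow> has_edge Bs' G" if "x \<notin> G" for G
      proof -
        have "\<not> C \<subseteq> G \<union> Y" using x that by auto
        then have "has_edge Bs (G \<union> Y) \<longleftrightarrow> has_edge Bs' (G \<union> Y)"
          using has_edge_Cons_missing[of C "G \<union> Y" Bs'] by (auto simp: Bs)
        also have "\<dots> \<longleftrightarrow> has_edge Bs' G" using x disj by (intro has_edge_cong) auto
        finally show ?thesis .
      qed
      have "x \<notin> G \<and> G \<union> Y \<subseteq> K \<union> \<Union>(set Bs) \<longleftrightarrow> G \<subseteq> ?K \<union> \<Union>(set Bs')" for G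
      proof -
        have "\<Union>(set Bs) = B \<union> C \<union> \<Union>(set Bs')" using Bs by auto
        moreover have "x \<notin> K" "x \<notin> B" "x \<notin> \<Union>(set Bs')" using x disj by blast+
        ultimately show ?thesis using x by blast
      qed
      then have "{G. x \<notin> G \<and> G \<union> Y \<in> path_complex K Bs} = path_complex ?K Bs'"
        using edge unfolding path_complex_def by blast
      moreover have "decomposable V d (path_complex ?K Bs')"
      proof (rule less.hyps)
        have "?K \<union> \<Union>(set Bs') = (K \<union> \<Union>(set Bs)) - {x}" using x disj Bs by auto
        then show "d + path_defect (length Bs') \<le> card (?K \<union> \<Union>(set Bs'))"
          using less.prems(1,4) card_remove[of x "K \<union> \<Union>(set Bs)"] x
            path_defect_Suc_Suc[of "length Bs'"] by (auto simp: Bs)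
      qed (use disj sets Bs x in auto)
      ultimately show "decomposable V d {G. x \<notin> G \<and> G \<union> Y \<in> path_complex K Bs}" by simp
    next
      let ?\<Delta> = "{G. G \<union> C \<in> path_complex K Bs}"
      show "decomposable V d ?\<Delta>"
      proof (rule decomposable_block[OF fin(1) sets(1)])
        have "{G. G \<union> B \<in> ?\<Delta>} = {}" by (auto simp: path_complex_def Bs)
        then show "decomposable V d {G. G \<union> B \<in> ?\<Delta>}" by (simp only: decomposable_void)
      next
        fix x Y assume x: "x \<in> B" "Y \<subseteq> B - {x}"
        let ?\<Delta>' = "{G. x \<notin> G \<and> G \<union> Y \<in> ?\<Delta>}"
        show "decomposable V d ?\<Delta>'"
        proof (cases Bs')
          case Nil
          let ?F = "K \<union> (B - {x}) \<union> C"
          have "x \<notin> K" "x \<notin> C" using x disj by blast+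
          then have "?\<Delta>' = Pow ?F" using x by (auto simp: path_complex_def Bs Nil)
          moreover have "?F = (K \<union> \<Union>(set Bs)) - {x}" using x disj Bs Nil by auto
          then have "d \<le> card ?F"
            using less.prems(1,4) card_remove[of x "K \<union> \<Union>(set Bs)"] x by (auto simp: Bs Nil)
          ultimately show ?thesis using sets by (auto intro!: decomposable_simplex)
        next
          case (Cons D Bs'')
          have "D \<subseteq> V" using sets Cons by auto
          then have D: "D \<subseteq> V" "finite D" by (simp_all add: finite_subset[OF _ assms(1)])
          have disj': "D \<inter> B = {}" "D \<inter> C = {}" "D \<inter> K = {}" "D \<inter> \<Union>(set Bs'') = {}"
            "disjoint_blocks Bs''" using disj Cons by auto
          show ?thesis
          proof (rule decomposable_block[OF D(2,1)])
            have "{G. G \<union> D \<in> ?\<Delta>'} = {}" by (auto simp: path_complex_def Bs Cons)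
            then show "decomposable V d {G. G \<union> D \<in> ?\<Delta>'}" by (simp only: decomposable_void)
          next
            fix z Z assume z: "z \<in> D" "Z \<subseteq> D - {z}"
            let ?K = "K \<union> (B - {x}) \<union> C \<union> (D - {z})"
            have edge: "has_edge Bs (G \<union> Z \<union> Y \<union> C) \<longleftrightarrow> has_edge Bs'' G" if "z \<notin> G" "x \<notin> G" for G
            proof -
              let ?G = "G \<union> Z \<union> Y \<union> C"
              have "x \<notin> ?G" "z \<notin> ?G" using x z that disj(1) disj'(1,2) by blast+
              then have "\<not> B \<subseteq> ?G" "\<not> D \<subseteq> ?G" using x z by blast+
              then have "has_edge Bs ?G \<longleftrightarrow> has_edge Bs'' ?G"
                using has_edge_Cons_missing[of D ?G Bs''] by (auto simp: Bs Cons)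
              also have "\<dots> \<longleftrightarrow> has_edge Bs'' G"
                using x z disj disj' Cons by (intro has_edge_cong) auto
              finally show ?thesis .
            qed
            have un: "\<Union>(set Bs) = B \<union> C \<union> D \<union> \<Union>(set Bs'')" using Bs Cons by auto
            have nx: "x \<notin> K" "x \<notin> C" "x \<notin> D" "x \<notin> \<Union>(set Bs'')" "z \<notin> Y"
              "z \<notin> K" "z \<notin> C" "z \<notin> B" "z \<notin> \<Union>(set Bs'')"
              using x z disj disj' Cons by auto
            have verts: "z \<notin> G \<and> x \<notin> G \<union> Z \<and> G \<union> Z \<union> Y \<union> C \<subseteq> K \<union> \<Union>(set Bs)
                \<longleftrightarrow> G \<subseteq> ?K \<union> \<Union>(set Bs'')" for G
              unfolding un using x z nx by blast
            have "z \<notin> G \<and> G \<union> Z \<in> ?\<Delta>' \<longleftrightarrow> G \<in> path_complex ?K Bs''" for G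
              using verts[of G] edge[of G] Un_iff[of x G Z]
              unfolding path_complex_def mem_Collect_eq by argo
            then have "{G. z \<notin> G \<and> G \<union> Z \<in> ?\<Delta>'} = path_complex ?K Bs''" by blast
            moreover have "decomposable V d (path_complex ?K Bs'')"
            proof (rule less.hyps)
              have "?K \<union> \<Union>(set Bs'') = (K \<union> \<Union>(set Bs)) - {x} - {z}"
                unfolding un using x z nx by blast
              moreover have "z \<in> K \<union> \<Union>(set Bs) - {x}" "x \<in> K \<union> \<Union>(set Bs)"
                unfolding un using x z nx by blast+
              ultimately show "d + path_defect (length Bs'') \<le> card (?K \<union> \<Union>(set Bs''))"
                using less.prems(1,4) card_remove[of x "K \<union> \<Union>(set Bs)"]
                  card_remove[of z "K \<union> \<Union>(set Bs) - {x}"] by (auto simp: Bs Cons)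
              have "\<Union>(set Bs'') \<subseteq> \<Union>(set Bs')" using Cons by auto
              then show "?K \<inter> \<Union>(set Bs'') = {}" "?K \<union> \<Union>(set Bs'') \<subseteq> V"
                using disj(2,3,6) disj'(4) sets D(1) by blast+
            qed (simp_all add: Bs Cons disj'(5))
            ultimately show "decomposable V d {G. z \<notin> G \<and> G \<union> Z \<in> ?\<Delta>'}" by simp
          qed
        qed
      qed
    qed
  qed (rule simplex; simp)+
qed

text \<open>The blocks \<open>2, 5, 8, \<dots>\<close> are kept entirely and one vertex is dropped from every other block, except
  that a single block left over at the end is kept as well. Each dropped vertex is the only one
  missing from an edge with a kept block, so the resulting face is a facet. Kept blocks may be empty,
  but the others must contain a vertex to drop.\<close>

lemma path_facet:
  assumes "disjoint_blocks Bs" "finite (\<Union>(set Bs))"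
    and "length Bs \<noteq> 1 \<Longrightarrow> \<forall>i<length Bs. i mod 3 \<noteq> 1 \<longrightarrow> Bs ! i \<noteq> {}"
  obtains F where "F \<subseteq> \<Union>(set Bs)" "\<not> has_edge Bs F"
    "\<And>v. v \<in> \<Union>(set Bs) - F \<Longrightarrow> has_edge Bs (insert v F)"
    "card F + path_defect (length Bs) = card (\<Union>(set Bs))"
proof -
  have "\<exists>F. F \<subseteq> \<Union>(set Bs) \<and> \<not> has_edge Bs F \<and>
      (\<forall>v. v \<in> \<Union>(set Bs) - F \<longrightarrow> has_edge Bs (insert v F)) \<and>
      card F + path_defect (length Bs) = card (\<Union>(set Bs))"
    using assms
  proof (induction "length Bs" arbitrary: Bs rule: less_induct)
    case less
    consider "Bs = []" | B where "Bs = [B]" | B C where "Bs = [B, C]"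
      | B C D Bs' where "Bs = B # C # D # Bs'" by (metis list.exhaust)
    then show ?case
    proof cases
      case (3 B C)
      then obtain x where x: "x \<in> B" using less.prems(3) by fastforce
      have disj: "B \<inter> C = {}" "finite B" "finite C" using 3 less.prems(1,2) by auto
      then have "card (B - {x} \<union> C) + 1 = card (B \<union> C)"
        using x card.remove[of B x] by (subst (1 2) card_Un_disjoint) auto
      then show ?thesis using 3 x disj(1) by (intro exI[of _ "B - {x} \<union> C"]) auto
    next
      case (4 B C D Bs')
      obtain x where x: "x \<in> B" using less.prems(3) 4 by fastforce
      have "\<forall>i<length Bs. i mod 3 \<noteq> 1 \<longrightarrow> Bs ! i \<noteq> {}" using less.prems(3) 4 by simp
      then have ne: "Bs ! i \<noteq> {}" if "i < length Bs" "i mod 3 \<noteq> 1" for i using that by blast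
      obtain z where z: "z \<in> D" using ne[of 2] 4 by (auto simp: numeral_2_eq_2)
      have "Bs' ! i \<noteq> {}" if "i < length Bs'" "i mod 3 \<noteq> 1" for i
      proof -
        have "Bs ! (i + 3) = Bs' ! i" unfolding 4 by (simp add: nth_Cons')
        moreover have "i + 3 < length Bs" using that(1) unfolding 4 by simp
        moreover have "(i + 3) mod 3 \<noteq> 1" using that(2) by simp
        ultimately show ?thesis using ne by metis
      qed
      then obtain F where F: "F \<subseteq> \<Union>(set Bs')" "\<not> has_edge Bs' F"
        "\<And>v. v \<in> \<Union>(set Bs') - F \<Longrightarrow> has_edge Bs' (insert v F)"
        "card F + path_defect (length Bs') = card (\<Union>(set Bs'))"
        using less.hyps[of Bs'] less.prems(1,2) 4 by auto
      have disj: "B \<inter> C = {}" "B \<inter> D = {}" "C \<inter> D = {}" "B \<inter> \<Union>(set Bs') = {}"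
        "C \<inter> \<Union>(set Bs') = {}" "D \<inter> \<Union>(set Bs') = {}"
        using less.prems(1) 4 by auto
      let ?H = "(B - {x}) \<union> C \<union> (D - {z})"
      have edge: "has_edge Bs G \<longleftrightarrow> has_edge Bs' G" if "x \<notin> G" "z \<notin> G" for G
        using that x z has_edge_Cons_missing[of D G Bs'] by (auto simp: 4)
      have "has_edge Bs' (?H \<union> G) \<longleftrightarrow> has_edge Bs' G" for G
        using disj by (intro has_edge_cong) auto
      note cong = this
      have x_z: "x \<notin> ?H \<union> F" "z \<notin> ?H \<union> F" using x z F(1) disj by auto
      have "\<not> has_edge Bs (?H \<union> F)" using edge[OF x_z] cong F(2) by simp
      moreover have "has_edge Bs (insert v (?H \<union> F))" if v: "v \<in> \<Union>(set Bs) - (?H \<union> F)" for v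
      proof -
        consider "v = x" | "v = z" | "v \<in> \<Union>(set Bs') - F" using v 4 by auto
        then show ?thesis
        proof cases
          case 3
          then have "has_edge Bs' (insert v F)" by (rule F(3))
          then have "has_edge Bs' (insert v (?H \<union> F))" by (rule has_edge_mono) auto
          then show ?thesis using has_edge_Cons_missing by (metis 4 has_edge.simps(1) has_edge.elims(2) has_edge.elims(3))
        qed (auto simp: 4)
      qed
      moreover have "card (?H \<union> F) + path_defect (length Bs) = card (\<Union>(set Bs))"
      proof -
        have "\<Union>(set Bs) = insert x (insert z (?H \<union> \<Union>(set Bs')))" using 4 x z by auto
        moreover have "x \<notin> insert z (?H \<union> \<Union>(set Bs'))" "z \<notin> ?H \<union> \<Union>(set Bs')"
          using x z disj by auto
        moreover have fin: "finite ?H" "finite (\<Union>(set Bs'))" using less.prems(2) 4 by auto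
        moreover have "card (insert x (insert z U)) = card U + 2"
          if "x \<notin> insert z U" "z \<notin> U" "finite U" for U using that by simp
        ultimately have "card (\<Union>(set Bs)) = card (?H \<union> \<Union>(set Bs')) + 2"
          by (metis finite_UnI)
        moreover have "card (?H \<union> \<Union>(set Bs')) = card ?H + card (\<Union>(set Bs'))"
          using disj fin by (intro card_Un_disjoint) auto
        moreover have "card (?H \<union> F) = card ?H + card F"
          using disj fin F(1) by (intro card_Un_disjoint) (auto intro: finite_subset)
        ultimately show ?thesis using F(4) 4 by simp
      qed
      moreover have "?H \<union> F \<subseteq> \<Union>(set Bs)" using F(1) 4 by auto
      ultimately show ?thesis by blast
    qed (auto intro: exI[of _ "\<Union>(set Bs)"])
  qed
  then show ?thesis using that by blast
qed

lemma has_edge_nth: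
  "has_edge Bs G \<longleftrightarrow> (\<exists>i. Suc i < length Bs \<and> Bs ! i \<union> Bs ! Suc i \<subseteq> G)"
proof (induction Bs G rule: has_edge.induct)
  case (1 B C Bs G)
  have zero_Suc: "(\<exists>i. P i) \<longleftrightarrow> P 0 \<or> (\<exists>i. P (Suc i))" for P by (metis not0_implies_Suc)
  have "(\<exists>i. Suc i < length (B # C # Bs) \<and> (B # C # Bs) ! i \<union> (B # C # Bs) ! Suc i \<subseteq> G)
      \<longleftrightarrow> B \<union> C \<subseteq> G \<or> (\<exists>i. Suc i < length (C # Bs) \<and> (C # Bs) ! i \<union> (C # Bs) ! Suc i \<subseteq> G)"
    by (subst zero_Suc) simp
  then show ?case using 1 by simp
qed auto

lemma disjoint_blocks_nth:
  "(\<And>i j. i < j \<Longrightarrow> j < length Bs \<Longrightarrow> Bs ! i \<inter> Bs ! j = {}) \<Longrightarrow> disjoint_blocks Bs"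
proof (induction Bs)
  case (Cons B Bs)
  have "B \<inter> Bs ! j = {}" if "j < length Bs" for j using Cons.prems[of 0 "Suc j"] that by simp
  then have "B \<inter> X = {}" if "X \<in> set Bs" for X using that by (metis in_set_conv_nth)
  then have "B \<inter> \<Union>(set Bs) = {}" by blast
  moreover have "disjoint_blocks Bs"
    using Cons.prems[of "Suc i" "Suc j" for i j] by (intro Cons.IH) auto
  ultimately show ?case by simp
qed simp

text \<open>With \<open>U\<^sub>k\<close> the \<open>k\<close>-th interval, the blocks are \<open>U\<^sub>1 - U\<^sub>2\<close>, \<open>U\<^sub>1 \<inter> U\<^sub>2\<close>, \<open>U\<^sub>2 - U\<^sub>1\<close>, \<open>U\<^sub>3 - U\<^sub>2\<close>, and so
  on. Since \<open>U\<^sub>k\<^sub>+\<^sub>2\<close> starts immediately after \<open>U\<^sub>k\<close> ends, the block \<open>U\<^sub>k\<^sub>+\<^sub>1 - U\<^sub>k\<close> is also the part of \<open>U\<^sub>k\<^sub>+\<^sub>1\<close>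
  contained in \<open>U\<^sub>k\<^sub>+\<^sub>2\<close>. The second block is empty if \<open>s = 2\<close> and the two intervals are disjoint, or
  if \<open>s = 1\<close>.\<close>

lemma interval_blocks:
  fixes a b :: "nat \<Rightarrow> nat"
  assumes "strict_mono_on {1..s} a" "strict_mono_on {1..s} b"
    and "1 \<le> s \<Longrightarrow> 1 \<le> a 1" "1 \<le> s \<Longrightarrow> b s \<le> n"
    and ab: "\<And>i. i \<in> {1..s} \<Longrightarrow> a i \<le> b i"
    and step: "\<And>k. 1 \<le> k \<Longrightarrow> k + 2 \<le> s \<Longrightarrow> a (k + 2) = b k + 1"
  obtains Bs where "disjoint_blocks Bs" "\<Union>(set Bs) \<subseteq> {1..n}"
    "\<And>G. has_edge Bs G \<longleftrightarrow> (\<exists>k\<in>{1..s}. {a k..b k} \<subseteq> G)"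
    "path_defect (length Bs) = s - s div 3"
    "length Bs \<noteq> 1 \<Longrightarrow> \<forall>i<length Bs. i mod 3 \<noteq> 1 \<longrightarrow> Bs ! i \<noteq> {}"
proof (cases "s = 0")
  case True
  then show ?thesis by (intro that[of "[]"]) auto
next
  case False
  have a: "a i < a j" and b: "b i < b j" if "1 \<le> i" "i < j" "j \<le> s" for i j
    using assms(1,2) that by (auto simp: strict_mono_on_def)
  have b_le: "b i \<le> b j" if "1 \<le> i" "i \<le> j" "j \<le> s" for i j
    using b[of i j] that by (cases "i = j") auto
  define U where "U k = {a k..b k}" for k
  define Blk where "Blk i = (if i = 0 then (if s = 1 then U 1 else U 1 - U 2)
    else if i = 1 then (if s = 1 then {} else U 1 \<inter> U 2) else U i - U (i - 1))" for i
  define Bs where "Bs = map Blk [0..<Suc s]"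
  have len: "length Bs = Suc s" by (simp add: Bs_def)
  have nth: "Bs ! i = Blk i" if "i \<le> s" for i
    using that by (auto simp: Bs_def simp del: upt_Suc)
  have above: "b (j - 1) < x" if "x \<in> Blk j" "2 \<le> j" "j \<le> s" for x j
  proof -
    have "a (j - 1) < a j" using a[of "j - 1" j] that by linarith
    then show ?thesis using that by (auto simp: Blk_def U_def)
  qed
  have below: "x \<le> b (max 1 i)" "x \<in> U (max 1 i)" if "x \<in> Blk i" for x i
    using that by (auto simp: Blk_def U_def split: if_splits)
  have disj: "Blk i \<inter> Blk j = {}" if "i < j" "j \<le> s" for i j
  proof (cases "j = 1")
    case True
    then show ?thesis using that by (auto simp: Blk_def)
  next
    case False
    then have "max 1 i \<le> j - 1" using that by auto
    then have "b (max 1 i) \<le> b (j - 1)" using that b_le[of "max 1 i" "j - 1"] by simp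
    then show ?thesis using above[of _ j] below(1)[of _ i] that False by fastforce
  qed
  have union: "Blk i \<union> Blk (Suc i) = U (Suc i)" if "i < s" for i
  proof -
    consider "i = 0" | "i = 1" | "2 \<le> i" by linarith
    then show ?thesis
    proof cases
      case 3
      then have "a (Suc i) = b (i - 1) + 1" using step[of "i - 1"] that by (simp add: numeral_2_eq_2)
      moreover have "a (i - 1) < a i" "b i < b (Suc i)" using 3 that a[of "i - 1" i] b[of i "Suc i"] by auto
      moreover have "a i < a (Suc i)" using 3 that a[of i "Suc i"] by auto
      ultimately show ?thesis using 3 by (auto simp: Blk_def U_def)
    qed (use that in \<open>auto simp: Blk_def numeral_2_eq_2\<close>)
  qed
  show ?thesis
  proof (rule that)
    show "disjoint_blocks Bs"
      using disj nth len by (intro disjoint_blocks_nth) auto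
    have "U k \<subseteq> {1..n}" if "k \<in> {1..s}" for k
    proof -
      have "1 \<le> a k" using assms(3) that a[of 1 k] by (cases "k = 1") auto
      moreover have "b k \<le> n" using assms(4) that b[of k s] by (cases "k = s") auto
      ultimately show ?thesis by (auto simp: U_def)
    qed
    then have "Blk i \<subseteq> {1..n}" if "i \<le> s" for i
      using below(2)[of _ i] that False by (metis atLeastAtMost_iff le_eq_less_or_eq less_one max.bounded_iff max_def not_less subsetD subsetI)
    then show "\<Union>(set Bs) \<subseteq> {1..n}"
      unfolding Bs_def set_map set_upt by (intro UN_least) simp
    show "path_defect (length Bs) = s - s div 3" by (simp add: len path_defect_def)
    have "Blk i \<noteq> {}" if "i \<le> s" "i mod 3 \<noteq> 1" for i
    proof (cases "i = 0")
      case True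
      have "a 1 \<in> U 1" using ab[of 1] False by (simp add: U_def)
      moreover have "a 1 \<notin> U 2" if "s \<noteq> 1" using a[of 1 2] that False by (simp add: U_def)
      ultimately show ?thesis using True by (auto simp: Blk_def)
    next
      case False
      then have "2 \<le> i" using that by (cases "i = 1") auto
      then have "b (i - 1) < b i" using that b[of "i - 1" i] by linarith
      then have "b i \<in> U i - U (i - 1)" using that ab[of i] \<open>2 \<le> i\<close> by (auto simp: U_def)
      then show ?thesis using \<open>2 \<le> i\<close> by (auto simp: Blk_def)
    qed
    then show "\<forall>i<length Bs. i mod 3 \<noteq> 1 \<longrightarrow> Bs ! i \<noteq> {}" by (simp add: len nth)
    show "has_edge Bs G \<longleftrightarrow> (\<exists>k\<in>{1..s}. {a k..b k} \<subseteq> G)" for G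
    proof -
      have "Bs ! i \<union> Bs ! Suc i = U (Suc i)" if "i < s" for i using union nth that by simp
      then have "has_edge Bs G \<longleftrightarrow> (\<exists>i<s. U (Suc i) \<subseteq> G)"
        unfolding has_edge_nth by (simp only: len Suc_less_eq cong: conj_cong)
      also have "\<dots> \<longleftrightarrow> (\<exists>k\<in>{1..s}. U k \<subseteq> G)"
        by (metis Suc_le_eq Suc_pred atLeastAtMost_iff le_add1 less_eq_Suc_le less_le_trans plus_1_eq_Suc zero_less_one)
      finally show ?thesis by (simp add: U_def)
    qed
  qed
qed

section \<open>Quotient modules of the polynomial ring\<close>

lemma carrier_poly_ring: "carrier (poly_ring V) = polys V"
  by (simp add: polys_def)

lemma poly_ring_simps:
  "mult (poly_ring V) = (*)" "one (poly_ring V) = 1"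
  "zero (poly_ring V) = 0" "add (poly_ring V) = (+)"
  by (simp_all add: poly_ring_def)

lemma cring_poly_ring: "cring (poly_ring V :: 'k::field mpoly ring)"
proof (rule cringI)
  show "abelian_group (poly_ring V :: 'k mpoly ring)"
  proof (rule abelian_groupI)
    fix x :: "'k mpoly" assume "x \<in> carrier (poly_ring V)"
    then show "\<exists>y\<in>carrier (poly_ring V). y \<oplus>\<^bsub>poly_ring V\<^esub> x = \<zero>\<^bsub>poly_ring V\<^esub>"
      by (intro bexI[of _ "- x"]) (auto simp: carrier_poly_ring poly_ring_simps)
  qed (auto simp: carrier_poly_ring poly_ring_simps ac_simps)
  show "comm_monoid (poly_ring V :: 'k mpoly ring)"
    by (rule comm_monoidI) (auto simp: carrier_poly_ring poly_ring_simps ac_simps)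
qed (auto simp: poly_ring_simps distrib_right)

lemma ideal_poly_ring:
  fixes N :: "'k::field mpoly set"
  assumes "polys.is_ideal V N"
  shows "ideal N (poly_ring V)"
proof -
  interpret R: cring "poly_ring V :: 'k mpoly ring" by (rule cring_poly_ring)
  note N = polys.is_idealD[OF assms]
  show ?thesis
  proof (rule idealI)
    show "ring (poly_ring V :: 'k mpoly ring)" by (rule R.ring_axioms)
    show "subgroup N (add_monoid (poly_ring V))"
    proof (rule R.add.subgroupI)
      fix a assume a: "a \<in> N"
      then have "\<ominus>\<^bsub>poly_ring V\<^esub> a = - a"
        using N(1) by (intro R.minus_equality[symmetric, THEN sym])
          (auto simp: carrier_poly_ring poly_ring_simps)
      then show "\<ominus>\<^bsub>poly_ring V\<^esub> a \<in> N" using N(5)[OF N(2) a] by simp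
    qed (use N in \<open>auto simp: carrier_poly_ring poly_ring_simps\<close>)
    fix a x :: "'k mpoly" assume "a \<in> N" "x \<in> carrier (poly_ring V)"
    then have "x * a \<in> N" using N(4) by (simp add: carrier_poly_ring)
    then show "x \<otimes>\<^bsub>poly_ring V\<^esub> a \<in> N" "a \<otimes>\<^bsub>poly_ring V\<^esub> x \<in> N"
      by (simp_all add: poly_ring_simps mult.commute)
  qed
qed

lemma is_ideal_poly_ring:
  fixes N :: "'k::field mpoly set"
  assumes "ideal N (poly_ring V)"
  shows "polys.is_ideal V N"
proof -
  interpret ideal N "poly_ring V" by (rule assms)
  show ?thesis
    unfolding polys.is_ideal_def
  proof (intro conjI ballI)
    show "N \<subseteq> polys V" using a_subset by (simp only: carrier_poly_ring)
    show "0 \<in> N"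
      using additive_subgroup.zero_closed[OF additive_subgroup_axioms] by (simp only: poly_ring_simps)
    show "x + y \<in> N" if "x \<in> N" "y \<in> N" for x y
      using additive_subgroup.a_closed[OF additive_subgroup_axioms that] by (simp only: poly_ring_simps)
    show "s * x \<in> N" if "s \<in> polys V" "x \<in> N" for s x
      using I_l_closed[of x s] that by (simp only: poly_ring_simps carrier_poly_ring)
  qed
qed

lemma in_ideal_if_monomials:
  fixes p :: "'k::field mpoly"
  assumes N: "polys.is_ideal V N" and p: "p \<in> polys V"
    and mult: "\<And>e. e \<in> Poly_Mapping.keys p \<Longrightarrow> \<exists>m h. monomial m \<in> N \<and> e = h + m"
  shows "p \<in> N"
proof -
  have "Poly_Mapping.single e c \<in> N" if e: "e \<in> Poly_Mapping.keys p" for e and c :: 'k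
  proof -
    obtain m h where mh: "monomial m \<in> N" "e = h + m" using mult[OF e] by blast
    have "vars h \<subseteq> V" using p e vars_add[of h m] unfolding mh(2) in_polys_iff by blast
    then have "Poly_Mapping.single h c * monomial m \<in> N"
      by (intro polys.is_idealD(4)[OF N _ mh(1)] single_in_polys)
    then show ?thesis by (simp add: mult_single mh(2))
  qed
  then have "(\<Sum>e\<in>Poly_Mapping.keys p. Poly_Mapping.single e (Poly_Mapping.lookup p e)) \<in> N"
    by (rule polys.ideal_sum[OF N])
  then show ?thesis by (simp only: poly_mapping_expansion[symmetric])
qed

lemma generated_ideal:
  fixes A :: "'k::field mpoly set"
  assumes "A \<subseteq> polys V"
  shows "polys.is_ideal V (Idl\<^bsub>poly_ring V\<^esub> A)" "A \<subseteq> Idl\<^bsub>poly_ring V\<^esub> A"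
    "\<And>N. polys.is_ideal V N \<Longrightarrow> A \<subseteq> N \<Longrightarrow> Idl\<^bsub>poly_ring V\<^esub> A \<subseteq> N"
proof -
  interpret R: cring "poly_ring V :: 'k mpoly ring" by (rule cring_poly_ring)
  have A: "A \<subseteq> carrier (poly_ring V)" using assms by (simp add: carrier_poly_ring)
  show "polys.is_ideal V (Idl\<^bsub>poly_ring V\<^esub> A)" using is_ideal_poly_ring R.genideal_ideal[OF A] .
  show "A \<subseteq> Idl\<^bsub>poly_ring V\<^esub> A" by (rule R.genideal_self[OF A])
  show "Idl\<^bsub>poly_ring V\<^esub> A \<subseteq> N" if "polys.is_ideal V N" "A \<subseteq> N" for N
    using R.genideal_minimal[OF ideal_poly_ring[OF that(1)] that(2)] .
qed

lemma zero_constant_term_ideal: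
  "polys.is_ideal V {p \<in> polys V. Poly_Mapping.lookup p 0 = (0 :: 'k::field)}"
proof -
  have "face_ideal V {{}} = {p \<in> polys V. Poly_Mapping.lookup p 0 = (0 :: 'k)}"
    by (auto simp: face_ideal_def in_keys_iff)
  moreover have "polys.is_ideal V (face_ideal V {{}} :: 'k mpoly set)"
    by (rule face_ideal_ideal) (auto simp: down_closed_def)
  ultimately show ?thesis by simp
qed

lemma graded_maximal_ideal_eq:
  "graded_maximal_ideal n = {p \<in> polys {1..n}. Poly_Mapping.lookup p 0 = (0 :: 'k::field)}"
proof -
  let ?A = "var ` {1..n} :: 'k mpoly set"
  have A: "?A \<subseteq> polys {1..n}" using var_in_polys by blast
  note gen = generated_ideal[OF A]
  have "?A \<subseteq> {p \<in> polys {1..n}. Poly_Mapping.lookup p 0 = 0}"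
    using A by (auto simp: lookup_var_0)
  moreover have "p \<in> Idl\<^bsub>poly_ring {1..n}\<^esub> ?A"
    if p: "p \<in> polys {1..n}" "Poly_Mapping.lookup p 0 = 0" for p :: "'k mpoly"
  proof (rule in_ideal_if_monomials[OF gen(1) p(1)])
    fix e assume e: "e \<in> Poly_Mapping.keys p"
    then have "e \<noteq> 0" using p(2) by (auto simp: in_keys_iff)
    then obtain v where v: "v \<in> vars e" by (metis keys_eq_empty ex_in_conv)
    then have "var v \<in> ?A" using p(1) e by (auto simp: in_polys_iff)
    then have "(var v :: 'k mpoly) \<in> Idl\<^bsub>poly_ring {1..n}\<^esub> ?A" using gen(2) by blast
    then show "\<exists>m h. monomial m \<in> Idl\<^bsub>poly_ring {1..n}\<^esub> ?A \<and> e = h + m"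
      using exponent_split[OF v] unfolding var_def by (metis add.commute)
  qed
  ultimately show ?thesis
    unfolding graded_maximal_ideal_def using gen(3)[OF zero_constant_term_ideal] by blast
qed

lemma prod_var: "finite G \<Longrightarrow> (\<Prod>i\<in>G. var i) = (monomial (indicator_exp G) :: 'k::field mpoly)"
  by (induction rule: finite_induct) (simp_all add: monomial_indicator_insert, simp add: indicator_exp_def)

lemma indicator_exp_dvd:
  assumes "finite G" "G \<subseteq> vars e"
  shows "e = (e - indicator_exp G) + indicator_exp G"
proof (rule poly_mapping_eqI)
  fix i
  have "1 \<le> Poly_Mapping.lookup e i" if "i \<in> G" using that assms(2) by (auto simp: in_keys_iff Suc_le_eq)
  then show "Poly_Mapping.lookup e i = Poly_Mapping.lookup (e - indicator_exp G + indicator_exp G) i"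
    by (simp add: lookup_add lookup_minus lookup_indicator_exp[OF assms(1)])
qed

lemma interval_ideal_eq_face_ideal:
  assumes "\<And>k. k \<in> {1..s} \<Longrightarrow> {a k..b k} \<subseteq> {1..n}"
  shows "interval_ideal n s a b
    = (face_ideal {1..n} {G. \<not> (\<exists>k\<in>{1..s}. {a k..b k} \<subseteq> G)} :: 'k::field mpoly set)"
    (is "_ = face_ideal _ ?\<Delta>")
proof -
  let ?m = "\<lambda>k. monomial (indicator_exp {a k..b k}) :: 'k mpoly"
  have I: "interval_ideal n s a b = Idl\<^bsub>poly_ring {1..n}\<^esub> (?m ` {1..s})"
    by (simp add: interval_ideal_def prod_var)
  have A: "?m ` {1..s} \<subseteq> polys {1..n}"
    using assms by (auto intro!: single_in_polys simp: vars_indicator_exp subset_iff)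
  note gen = generated_ideal[OF A]
  have "polys.is_ideal {1..n} (face_ideal {1..n} ?\<Delta> :: 'k mpoly set)"
    by (rule face_ideal_ideal) (auto simp: down_closed_def)
  moreover have "?m ` {1..s} \<subseteq> face_ideal {1..n} ?\<Delta>"
    using A by (auto simp: face_ideal_def vars_indicator_exp)
  moreover have "p \<in> Idl\<^bsub>poly_ring {1..n}\<^esub> (?m ` {1..s})" if p: "p \<in> face_ideal {1..n} ?\<Delta>" for p
  proof (rule in_ideal_if_monomials[OF gen(1)])
    show "p \<in> polys {1..n}" using p by (simp add: face_ideal_def)
    fix e assume "e \<in> Poly_Mapping.keys p"
    then obtain k where k: "k \<in> {1..s}" "{a k..b k} \<subseteq> vars e" using p by (auto simp: face_ideal_def)
    then have "?m k \<in> Idl\<^bsub>poly_ring {1..n}\<^esub> (?m ` {1..s})" using gen(2) by blast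
    then show "\<exists>m h. monomial m \<in> Idl\<^bsub>poly_ring {1..n}\<^esub> (?m ` {1..s}) \<and> e = h + m"
      using indicator_exp_dvd[OF _ k(2)] by blast
  qed
  ultimately show ?thesis unfolding I using gen(3) by blast
qed

locale quotient_by_ideal =
  fixes V :: "nat set" and I :: "'k::field mpoly set"
  assumes ideal: "polys.is_ideal V I"
begin

abbreviation R :: "'k mpoly ring" where "R \<equiv> poly_ring V"
abbreviation M :: "('k mpoly, 'k mpoly set) module" where "M \<equiv> quotient_module R I"
abbreviation coset :: "'k mpoly \<Rightarrow> 'k mpoly set" where "coset p \<equiv> I +>\<^bsub>R\<^esub> p"

sublocale I: ideal I R
  by (rule ideal_poly_ring[OF ideal])

lemma coset_eq_iff:
  assumes "p \<in> polys V" "q \<in> polys V"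
  shows "coset p = coset q \<longleftrightarrow> p - q \<in> I"
proof -
  have mem: "x \<in> coset p \<longleftrightarrow> x - p \<in> I" for x p
    unfolding a_r_coset_def r_coset_def by (auto simp: poly_ring_simps intro: bexI[of _ "x - p"])
  note N = polys.is_idealD[OF ideal]
  show ?thesis
  proof
    assume "coset p = coset q"
    then have "p \<in> coset q" using N(2) mem[of p p] by simp
    then show "p - q \<in> I" by (simp add: mem)
  next
    assume pq: "p - q \<in> I"
    have "x - p \<in> I \<longleftrightarrow> x - q \<in> I" for x
      using N(3)[OF _ pq, of "x - p"] N(5)[OF _ pq, of "x - q"] by auto
    then show "coset p = coset q" using mem by blast
  qed
qed

lemma coset_eq_zero_iff: "p \<in> polys V \<Longrightarrow> coset p = \<zero>\<^bsub>M\<^esub> \<longleftrightarrow> p \<in> I"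
proof -
  have "coset 0 = I" unfolding a_r_coset_def r_coset_def by (auto simp: poly_ring_simps)
  then show "p \<in> polys V \<Longrightarrow> coset p = \<zero>\<^bsub>M\<^esub> \<longleftrightarrow> p \<in> I"
    using coset_eq_iff[of p 0] by (auto simp: quotient_module_def FactRing_def)
qed

lemma carrier_M: "carrier M = coset ` polys V"
  by (auto simp: quotient_module_def FactRing_def A_RCOSETS_defs a_r_coset_def[symmetric]
      carrier_poly_ring a_r_coset_def r_coset_def)

lemma smult_coset: "f \<in> polys V \<Longrightarrow> p \<in> polys V \<Longrightarrow> f \<odot>\<^bsub>M\<^esub> coset p = coset (f * p)"
  using I.rcoset_mult_add[of f p]
  by (simp add: quotient_module_def FactRing_def carrier_poly_ring poly_ring_simps)

lemma finsum_coset: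
  assumes "finite A" "\<And>i. i \<in> A \<Longrightarrow> g i \<in> polys V" "\<And>i. i \<in> A \<Longrightarrow> y i = coset (g i)"
  shows "(\<Oplus>\<^bsub>M\<^esub>i\<in>A. y i) = coset (\<Sum>i\<in>A. g i)"
proof -
  interpret Q: ring "R Quot I" by (rule I.quotient_is_ring)
  have "(\<Oplus>\<^bsub>M\<^esub>i\<in>A. y i) = (\<Oplus>\<^bsub>R Quot I\<^esub>i\<in>A. y i)"
    by (simp add: finsum_def finprod_def quotient_module_def)
  also have "\<dots> = coset (\<Sum>i\<in>A. g i)"
    using assms
  proof (induction A rule: finite_induct)
    case empty
    have "coset 0 = I" unfolding a_r_coset_def r_coset_def by (auto simp: poly_ring_simps)
    then show ?case unfolding Q.finsum_empty by (simp add: FactRing_def)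
  next
    case (insert i A)
    have carr: "coset p \<in> carrier (R Quot I)" if "p \<in> polys V" for p
      using that carrier_M by (auto simp: quotient_module_def)
    have "y i \<oplus>\<^bsub>R Quot I\<^esub> coset (\<Sum>i\<in>A. g i) = coset (g i + (\<Sum>i\<in>A. g i))"
      using I.a_rcos_sum[of "g i" "\<Sum>i\<in>A. g i"] insert.prems
      by (simp add: FactRing_def carrier_poly_ring poly_ring_simps polys.sum_in)
    then show ?case using insert carr by (simp add: Pi_iff)
  qed
  finally show ?thesis .
qed

lemma list_submodule_eq:
  assumes "set fs \<subseteq> polys V"
  shows "list_submodule M fs = coset ` fold (\<lambda>f N. polys.adjoin V N f) fs I"
proof (intro equalityI subsetI)
  have fs: "fs ! j \<in> polys V" if "j < length fs" for j using assms that nth_mem by blast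
  have 0: "0 \<in> I" using polys.is_idealD(2)[OF ideal] .
  {
    fix x assume "x \<in> list_submodule M fs"
    then obtain y where y: "y \<in> {..<length fs} \<rightarrow> carrier M"
      "x = (\<Oplus>\<^bsub>M\<^esub>j\<in>{..<length fs}. (fs ! j) \<odot>\<^bsub>M\<^esub> y j)" by (auto simp: list_submodule_def)
    have "y j \<in> coset ` polys V" if "j \<in> {..<length fs}" for j
      using funcset_mem[OF y(1) that] unfolding carrier_M .
    then have "\<forall>j\<in>{..<length fs}. \<exists>p. p \<in> polys V \<and> y j = coset p" by blast
    then obtain g where g: "\<And>j. j < length fs \<Longrightarrow> g j \<in> polys V \<and> y j = coset (g j)"
      by (metis lessThan_iff)
    have "x = coset (\<Sum>j<length fs. fs ! j * g j)"
      unfolding y(2) using g fs by (intro finsum_coset) (auto simp: smult_coset)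
    then show "x \<in> coset ` fold (\<lambda>f N. polys.adjoin V N f) fs I"
    proof (rule image_eqI)
      show "(\<Sum>j<length fs. fs ! j * g j) \<in> fold (\<lambda>f N. polys.adjoin V N f) fs I"
        unfolding polys.fold_adjoin_iff using g 0 by (intro bexI[of _ 0] exI[of _ g]) auto
    qed
  next
    fix x assume "x \<in> coset ` fold (\<lambda>f N. polys.adjoin V N f) fs I"
    then obtain q where q: "q \<in> fold (\<lambda>f N. polys.adjoin V N f) fs I" "x = coset q" by (rule imageE)
    obtain a g where ag: "a \<in> I" "\<forall>j<length fs. g j \<in> polys V"
      "q = a + (\<Sum>j<length fs. fs ! j * g j)"
      using q(1) unfolding polys.fold_adjoin_iff by (elim bexE exE conjE)
    have sum: "(\<Sum>j<length fs. fs ! j * g j) \<in> polys V"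
      using ag(2) fs by (intro polys.sum_in) auto
    have "x = coset (\<Sum>j<length fs. fs ! j * g j)"
      unfolding q(2) ag(3) using sum ag(1) polys.is_idealD(1)[OF ideal] by (subst coset_eq_iff) auto
    also have "\<dots> = (\<Oplus>\<^bsub>M\<^esub>j\<in>{..<length fs}. (fs ! j) \<odot>\<^bsub>M\<^esub> coset (g j))"
      using ag(2) fs by (intro finsum_coset[symmetric]) (auto simp: smult_coset)
    finally show "x \<in> list_submodule M fs"
      unfolding list_submodule_def using ag(2) carrier_M by (intro CollectI exI[of _ "\<lambda>j. coset (g j)"]) auto
  }
qed

lemma regular_sequence_iff:
  assumes "set fs \<subseteq> polys V"
  shows "regular_sequence R M fs \<longleftrightarrow>
    polys.regular V I fs \<and> fold (\<lambda>f N. polys.adjoin V N f) fs I \<noteq> polys V"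
proof -
  let ?J = "\<lambda>fs. fold (\<lambda>f N. polys.adjoin V N f) fs I"
  have J: "polys.is_ideal V (?J gs)" "I \<subseteq> ?J gs" if "set gs \<subseteq> polys V" for gs
    by (rule polys.fold_adjoin_ideal[OF ideal that]) (rule polys.subset_fold_adjoin)
  have mem: "coset p \<in> coset ` ?J gs \<longleftrightarrow> p \<in> ?J gs" if p: "p \<in> polys V" and gs: "set gs \<subseteq> polys V" for p gs
  proof
    assume "coset p \<in> coset ` ?J gs"
    then obtain q where q: "q \<in> ?J gs" "coset p = coset q" by auto
    then have "p - q \<in> I" using coset_eq_iff[OF p polys.is_idealD(1)[OF J(1)[OF gs] q(1)]] by simp
    then have "p - q + q \<in> ?J gs" using polys.is_idealD(3)[OF J(1)[OF gs] _ q(1)] J(2)[OF gs] by blast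
    then show "p \<in> ?J gs" by simp
  qed auto
  have take: "set (take i fs) \<subseteq> polys V" for i
    by (rule subset_trans[OF set_take_subset assms])
  have nth: "fs ! i \<in> polys V" if "i < length fs" for i using assms that nth_mem by blast
  have "(\<forall>i<length fs. \<forall>x\<in>carrier M. fs ! i \<odot>\<^bsub>M\<^esub> x \<in> list_submodule M (take i fs) \<longrightarrow>
      x \<in> list_submodule M (take i fs)) \<longleftrightarrow> polys.regular V I fs"
    unfolding polys.regular_iff_nth polys.nonzerodivisor_def carrier_M ball_simps(9)
    using nth take by (simp add: smult_coset list_submodule_eq mem polys.mult_in cong: conj_cong)
  moreover have "list_submodule M fs = carrier M \<longleftrightarrow> ?J fs = polys V"
  proof
    assume "list_submodule M fs = carrier M"
    then have "p \<in> ?J fs" if "p \<in> polys V" for p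
      using mem[OF that assms] that list_submodule_eq[OF assms] carrier_M by blast
    then show "?J fs = polys V" using polys.is_idealD(1)[OF J(1)[OF assms]] by blast
  qed (simp add: list_submodule_eq[OF assms] carrier_M)
  ultimately show ?thesis
    unfolding regular_sequence_def using assms by (auto simp: carrier_poly_ring)
qed

end

section \<open>Depth and Stanley depth of decomposable complexes\<close>

locale face_quotient =
  fixes n :: nat and \<Delta> :: "nat set set" and coefficients :: "'k::field itself"
  assumes down: "down_closed \<Delta>"
begin

abbreviation I :: "'k mpoly set" where "I \<equiv> face_ideal {1..n} \<Delta>"

sublocale quotient_by_ideal "{1..n}" I
  by unfold_locales (rule face_ideal_ideal[OF down])

lemma in_I_iff: "p \<in> polys {1..n} \<Longrightarrow>
    p \<in> I \<longleftrightarrow> (\<forall>e. vars e \<in> \<Delta> \<longrightarrow> Poly_Mapping.lookup p e = 0)"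
  by (auto simp: face_ideal_def in_keys_iff)

text \<open>The upper bound by a facet meets the lower bound by a decomposition whose simplices are all at
  least as large.\<close>

lemma depth_eq_card_facet:
  assumes F: "F \<in> \<Delta>" "F \<subseteq> {1..n}" and facet: "\<And>v. v \<in> {1..n} - F \<Longrightarrow> insert v F \<notin> \<Delta>"
    and dec: "decomposable {1..n} (card F) \<Delta>"
  shows "depth R (graded_maximal_ideal n) M = card F"
proof -
  let ?L = "{length fs | fs. regular_sequence R M fs \<and> set fs \<subseteq> graded_maximal_ideal n}"
  have upper: "l \<le> card F" if "l \<in> ?L" for l
  proof -
    from that obtain fs where fs: "l = length fs" "regular_sequence R M fs"
      "set fs \<subseteq> graded_maximal_ideal n" by blast
    then have "set fs \<subseteq> polys {1..n}" "\<And>f. f \<in> set fs \<Longrightarrow> Poly_Mapping.lookup f 0 = 0"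
      by (auto simp: graded_maximal_ideal_eq)
    then show ?thesis
      using regular_length_le_facet[OF _ down F facet, of fs] fs(1,2) regular_sequence_iff[of fs] by simp
  qed
  let ?es = "map (elementary_symmetric {1..n}) [1..<Suc (card F)] :: 'k mpoly list"
  let ?Z = "{p \<in> polys {1..n}. Poly_Mapping.lookup p 0 = (0 :: 'k)}"
  note Z = polys.is_idealD[OF zero_constant_term_ideal[of "{1..n}", where 'k = 'k]]
  have "Poly_Mapping.lookup (elementary_symmetric {1..n} k :: 'k mpoly) 0 = 0" if "1 \<le> k" for k
  proof (rule ccontr)
    assume "\<not> ?thesis"
    then have "0 \<in> Poly_Mapping.keys (elementary_symmetric {1..n} k :: 'k mpoly)"
      by (simp add: in_keys_iff)
    then obtain G where G: "G \<subseteq> {1..n}" "card G = k" "0 = indicator_exp G"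
      using keys_elementary_symmetric[of "{1..n}"] by blast
    have "G = {}" using vars_indicator_exp[of G] finite_subset[OF G(1)] G(3)[symmetric] by simp
    then show False using G(2) that by simp
  qed
  then have es: "set ?es \<subseteq> ?Z"
    using elementary_symmetric_in[of "{1..n}"] by (auto simp del: upt_Suc)
  have "{} \<in> \<Delta>" using F(1) down unfolding down_closed_def by blast
  then have "Poly_Mapping.lookup x 0 = 0" if "x \<in> I" for x
    using that in_I_iff[of x] by (auto simp: face_ideal_def)
  then have "I \<subseteq> ?Z" by (auto simp: face_ideal_def)
  then have "fold (\<lambda>f N. polys.adjoin {1..n} N f) ?es I \<subseteq> ?Z"
  proof (intro subsetI)
    fix x assume "x \<in> fold (\<lambda>f N. polys.adjoin {1..n} N f) ?es I"
    then obtain a g where ag: "a \<in> I" "\<forall>j<length ?es. g j \<in> polys {1..n}"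
      "x = a + (\<Sum>j<length ?es. ?es ! j * g j)"
      unfolding polys.fold_adjoin_iff by blast
    have "?es ! j \<in> ?Z" if "j < length ?es" for j using es nth_mem[OF that] by blast
    then have "(\<Sum>j<length ?es. g j * ?es ! j) \<in> ?Z"
      using ag(2) by (intro polys.ideal_sum[OF zero_constant_term_ideal] Z(4)) auto
    moreover have "a \<in> ?Z" using ag(1) \<open>I \<subseteq> ?Z\<close> by blast
    ultimately show "x \<in> ?Z" unfolding ag(3) using Z(3) by (simp only: mult.commute)
  qed
  moreover have "1 \<notin> ?Z" by simp
  ultimately have "fold (\<lambda>f N. polys.adjoin {1..n} N f) ?es I \<noteq> polys {1..n}"
    using polys.one_in by blast
  moreover have "polys.regular {1..n} I ?es" by (rule decomposable_regular[OF _ dec down]) simp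
  moreover have "set ?es \<subseteq> polys {1..n}" using es by blast
  ultimately have "regular_sequence R M ?es" using regular_sequence_iff by blast
  then have "card F \<in> ?L" using es by (intro CollectI exI[of _ ?es]) (simp add: graded_maximal_ideal_eq)
  moreover have "finite ?L" using upper by (meson finite_atMost finite_subset subsetI atMost_iff)
  ultimately show ?thesis unfolding depth_def using upper by (intro Max_eqI)
qed

lemma quotient_grading_iff:
  "x \<in> quotient_grading n I g \<longleftrightarrow> (\<exists>p\<in>polys {1..n}. x = coset p \<and>
    (\<forall>e\<in>Poly_Mapping.keys p. \<forall>i. int (Poly_Mapping.lookup e i) = g i))"
  by (auto simp: quotient_grading_def carrier_poly_ring)

text \<open>Some Stanley space contains a multiple \<open>x\<^sup>h m\<close> of its generator with the same degree as the
  monomial \<open>x\<^sup>F\<close> of a facet. Variables outside \<open>F\<close> annihilate \<open>x\<^sup>F\<close>, hence do not occur in its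
  index set.\<close>

lemma stanley_space_in_facet:
  assumes F: "F \<in> \<Delta>" "F \<subseteq> {1..n}" and facet: "\<And>v. v \<in> {1..n} - F \<Longrightarrow> insert v F \<notin> \<Delta>"
    and D: "stanley_decomposition n M (quotient_grading n I) D"
  obtains m Z where "(m, Z) \<in> set D" "Z \<subseteq> F"
proof -
  have finF: "finite F" using F(2) finite_subset by blast
  let ?xF = "monomial (indicator_exp F) :: 'k mpoly"
  let ?N = "map (\<lambda>(m, Z). stanley_space M m Z) D"
  have xF: "?xF \<in> polys {1..n}" using F finF by (intro single_in_polys) (simp add: vars_indicator_exp)
  have "coset ?xF \<in> carrier M" using xF carrier_M by blast
  moreover have "internal_direct_sum M ?N" using D unfolding stanley_decomposition_def by (rule conjunct2)
  ultimately obtain y where y: "y \<in> (\<Pi>\<^sub>E i\<in>{..<length ?N}. ?N ! i)"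
    "coset ?xF = (\<Oplus>\<^bsub>M\<^esub>i\<in>{..<length ?N}. y i)"
    unfolding internal_direct_sum_def by (elim conjE) (drule (1) bspec, elim ex1E conjE)
  define component where "component i u p \<longleftrightarrow>
      u \<in> polys (snd (D ! i)) \<and> p \<in> polys {1..n} \<and> fst (D ! i) = coset p \<and>
      (\<exists>g. \<forall>e\<in>Poly_Mapping.keys p. \<forall>j. int (Poly_Mapping.lookup e j) = g j) \<and>
      y i = coset (u * p) \<and> snd (D ! i) \<subseteq> {1..n} \<and> free_stanley_space M (fst (D ! i)) (snd (D ! i))"
    for i u p
  have "\<exists>u p. component i u p" if i: "i < length D" for i
  proof -
    obtain m Z where mZ: "D ! i = (m, Z)" by (cases "D ! i")
    have "(m, Z) \<in> set D" using i mZ nth_mem by metis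
    then have hom: "homogeneous n (quotient_grading n I) m" and Z: "Z \<subseteq> {1..n}"
      and free: "free_stanley_space M m Z"
      using D unfolding stanley_decomposition_def by blast+
    obtain g p where p: "p \<in> polys {1..n}" "m = coset p"
      "\<forall>e\<in>Poly_Mapping.keys p. \<forall>i. int (Poly_Mapping.lookup e i) = g i"
      using hom unfolding homogeneous_def quotient_grading_iff by blast
    have "y i \<in> ?N ! i" using y(1) i by (auto dest: PiE_mem)
    then obtain u where u: "u \<in> polys Z" "y i = u \<odot>\<^bsub>M\<^esub> m"
      using i mZ by (auto simp: stanley_space_def carrier_poly_ring)
    have "u \<in> polys {1..n}" using u(1) Z unfolding in_polys_iff by blast
    then have "y i = coset (u * p)" using u(2) p smult_coset by simp
    then have "component i u p" using u(1) p Z free mZ unfolding component_def by auto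
    then show ?thesis by blast
  qed
  then obtain u p where "\<And>i. i < length D \<Longrightarrow> component i (u i) (p i)" by metis
  note up = this[unfolded component_def]
  have uV: "u i \<in> polys {1..n}" if "i < length D" for i
    using up[OF that] unfolding in_polys_iff by blast
  have upV: "u i * p i \<in> polys {1..n}" if "i < length D" for i
    using uV up that by (intro polys.mult_in) auto
  have sumV: "(\<Sum>i<length D. u i * p i) \<in> polys {1..n}" using upV by (intro polys.sum_in) auto
  have "coset ?xF = coset (\<Sum>i<length D. u i * p i)"
    unfolding y(2) length_map using up upV by (intro finsum_coset) auto
  then have "?xF - (\<Sum>i<length D. u i * p i) \<in> I" using coset_eq_iff xF sumV by blast
  moreover have "vars (indicator_exp F) \<in> \<Delta>" using F finF by (simp add: vars_indicator_exp)
  ultimately have "Poly_Mapping.lookup (?xF - (\<Sum>i<length D. u i * p i)) (indicator_exp F) = 0"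
    by (auto simp: face_ideal_def in_keys_iff)
  then have "(\<Sum>i<length D. Poly_Mapping.lookup (u i * p i) (indicator_exp F)) \<noteq> 0"
    by (simp add: lookup_minus lookup_sum)
  then obtain i where i: "i < length D" "Poly_Mapping.lookup (u i * p i) (indicator_exp F) \<noteq> 0"
    by (metis (no_types, lifting) lessThan_iff sum.not_neutral_contains_not_neutral)
  then obtain h e where he: "indicator_exp F = h + e" "h \<in> Poly_Mapping.keys (u i)"
    "e \<in> Poly_Mapping.keys (p i)" by (metis in_keys_iff keys_multE)
  let ?Z = "snd (D ! i)"
  have "e' = e" if "e' \<in> Poly_Mapping.keys (p i)" for e'
    using up[OF i(1)] that he(3) by (intro poly_mapping_eqI) (metis of_nat_eq_iff)
  then have keys: "Poly_Mapping.keys (p i) = {e}" using he(3) by blast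
  have "?Z \<subseteq> F"
  proof
    fix v assume v: "v \<in> ?Z"
    show "v \<in> F"
    proof (rule ccontr)
      assume "v \<notin> F"
      then have notin: "insert v F \<notin> \<Delta>" using facet v up[OF i(1)] by blast
      let ?h = "Poly_Mapping.single v 1 + h"
      have hZ: "vars ?h \<subseteq> ?Z" using v he(2) up[OF i(1)] by (auto simp: vars_add in_polys_iff)
      then have w: "monomial ?h \<in> polys ?Z" "monomial ?h \<in> polys {1..n}"
        using up[OF i(1)] by (auto intro!: single_in_polys)
      have "vars (?h + e) = insert v F"
        using vars_indicator_exp[OF finF] unfolding he(1) by (simp add: vars_add)
      then have "Poly_Mapping.keys (monomial ?h * p i) = {?h + e}" "vars (?h + e) \<notin> \<Delta>"
        using keys notin by (simp_all add: keys_monomial_mult)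
      moreover have whp: "monomial ?h * p i \<in> polys {1..n}" using w up[OF i(1)] by blast
      ultimately have "monomial ?h * p i \<in> I" unfolding face_ideal_def by simp
      moreover have gen: "p i \<in> polys {1..n}" "fst (D ! i) = coset (p i)" using up[OF i(1)] by blast+
      ultimately have "monomial ?h \<odot>\<^bsub>M\<^esub> fst (D ! i) = \<zero>\<^bsub>M\<^esub>"
        unfolding gen(2) smult_coset[OF w(2) gen(1)] coset_eq_zero_iff[OF whp] by blast
      then have "monomial ?h = (0 :: 'k mpoly)"
        using up[OF i(1)] w(1) unfolding free_stanley_space_def carrier_poly_ring by blast
      then show False by (metis keys_single keys_zero insert_not_empty one_neq_zero)
    qed
  qed
  moreover have "(fst (D ! i), ?Z) \<in> set D" using i(1) by simp
  ultimately show ?thesis using that by blast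
qed

text \<open>The part of \<open>p\<close> supported on a cone is its component in the corresponding Stanley space. The
  components are unique because the cones are disjoint and contain no monomial of \<open>I\<close>.\<close>

lemma stanley_decomposition_of_cones:
  assumes L: "cone_partition {1..n} \<Delta> L"
  shows "stanley_decomposition n M (quotient_grading n I) (map (\<lambda>(e, Z). (coset (monomial e), Z)) L)"
proof -
  have count: "card {i. i < length L \<and> in_cone (L ! i) e} = (if vars e \<in> \<Delta> then 1 else 0)" for e
    using L unfolding cone_partition_def length_filter_conv_card by blast
  have LV: "vars (fst (L ! i)) \<subseteq> {1..n}" "snd (L ! i) \<subseteq> {1..n}" if "i < length L" for i
    using L nth_mem[OF that] unfolding cone_partition_def by (auto simp: split_beta)
  have face: "vars e \<in> \<Delta>" if "i < length L" "in_cone (L ! i) e" for i e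
  proof -
    have "finite {i. i < length L \<and> in_cone (L ! i) e}" by simp
    then have "card {i. i < length L \<and> in_cone (L ! i) e} \<noteq> 0" using that by auto
    then show ?thesis using count[of e] by presburger
  qed
  have unique: "i = j" if "i < length L" "j < length L" "in_cone (L ! i) e" "in_cone (L ! j) e" for i j e
  proof -
    have "card {i. i < length L \<and> in_cone (L ! i) e} \<le> 1" using count[of e] by simp
    then show ?thesis using that by (simp add: card_le_Suc0_iff_eq)
  qed
  have xV: "monomial (fst (L ! i)) \<in> polys {1..n}" if "i < length L" for i
    using LV[OF that] by (intro single_in_polys)
  have polysZ: "u \<in> polys {1..n}" if "i < length L" "u \<in> polys (snd (L ! i))" for i u
    using that LV[of i] unfolding in_polys_iff by blast
  have cone_keys: "in_cone (L ! i) e"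
    if "u \<in> polys (snd (L ! i))" "e \<in> Poly_Mapping.keys (monomial (fst (L ! i)) * u :: 'k mpoly)" for i e u
    using that by (auto simp: keys_monomial_mult in_cone_def in_polys_iff)
  let ?D = "map (\<lambda>(e, Z). (coset (monomial e), Z)) L"
  let ?N = "map (\<lambda>(m, Z). stanley_space M m Z) ?D"
  have N_nth: "?N ! i = {coset (monomial (fst (L ! i)) * u) | u. u \<in> polys (snd (L ! i))}"
    if "i < length L" for i
  proof -
    have "?N ! i = stanley_space M (coset (monomial (fst (L ! i)))) (snd (L ! i))"
      using that by (simp add: split_beta)
    also have "\<dots> = {coset (monomial (fst (L ! i)) * u) | u. u \<in> polys (snd (L ! i))}"
      unfolding stanley_space_def carrier_poly_ring
      using smult_coset xV[OF that] polysZ[OF that] by (metis (no_types, opaque_lifting) mult.commute)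
    finally show ?thesis .
  qed
  have "\<forall>(m, Z)\<in>set ?D. m \<in> carrier M \<and> homogeneous n (quotient_grading n I) m \<and> Z \<subseteq> {1..n} \<and>
      free_stanley_space M m Z"
  proof clarify
    fix m Z assume "(m, Z) \<in> set ?D"
    then obtain i where i: "i < length L" "m = coset (monomial (fst (L ! i)))" "Z = snd (L ! i)"
      by (auto simp: in_set_conv_nth split_beta)
    let ?e = "fst (L ! i)"
    have "m \<in> quotient_grading n I (\<lambda>j. int (Poly_Mapping.lookup ?e j))"
      unfolding quotient_grading_iff using xV[OF i(1)] i(2) by (intro bexI[of _ "monomial ?e"]) auto
    moreover have "(\<lambda>j. int (Poly_Mapping.lookup ?e j)) \<in> degrees n"
      using LV(1)[OF i(1)] by (auto simp: degrees_def in_keys_iff subset_iff)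
    ultimately have "homogeneous n (quotient_grading n I) m" unfolding homogeneous_def by blast
    moreover have "u = 0" if u: "u \<in> polys Z" "u \<odot>\<^bsub>M\<^esub> m = \<zero>\<^bsub>M\<^esub>" for u
    proof -
      have uV: "u \<in> polys {1..n}" using polysZ[OF i(1)] u(1) i(3) by blast
      have xu: "monomial ?e * u \<in> polys {1..n}" by (rule polys.mult_in[OF xV[OF i(1)] uV])
      have "coset (monomial ?e * u) = \<zero>\<^bsub>M\<^esub>"
        using u(2) unfolding i(2) smult_coset[OF uV xV[OF i(1)]] by (simp add: mult.commute)
      then have "monomial ?e * u \<in> I" using coset_eq_zero_iff[OF xu] by blast
      then have "Poly_Mapping.keys (monomial ?e * u) = {}"
        using cone_keys[of u i] face[OF i(1)] u(1) i(3) unfolding face_ideal_def by blast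
      then show "u = 0" by (simp only: keys_monomial_mult image_is_empty keys_eq_empty)
    qed
    ultimately show "m \<in> carrier M \<and> homogeneous n (quotient_grading n I) m \<and> Z \<subseteq> {1..n} \<and>
        free_stanley_space M m Z"
      using i LV(2) xV carrier_M unfolding free_stanley_space_def carrier_poly_ring by blast
  qed
  moreover have "internal_direct_sum M ?N"
    unfolding internal_direct_sum_def
  proof (intro conjI ballI)
    fix N assume "N \<in> set ?N"
    then have "\<exists>i<length ?N. ?N ! i = N" by (simp only: in_set_conv_nth)
    then obtain i where "i < length L" "N = ?N ! i" unfolding length_map by blast
    then show "N \<subseteq> carrier M"
      using N_nth carrier_M polysZ xV polys.mult_in by fastforce
  next
    fix x assume "x \<in> carrier M"
    then obtain p where p: "p \<in> polys {1..n}" "x = coset p" using carrier_M by blast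
    define part where "part i = restrict_poly (in_cone (L ! i)) p" for i
    have partV: "part i \<in> polys {1..n}" for i unfolding part_def by (rule restrict_poly_in[OF p(1)])
    define y where "y = restrict (\<lambda>i. coset (part i)) {..<length L}"
    have "coset (part i) \<in> ?N ! i" if "i < length L" for i
    proof -
      obtain u where "u \<in> polys (snd (L ! i))" "part i = monomial (fst (L ! i)) * u"
        by (rule monomial_dvd[of "part i" "fst (L ! i)" "snd (L ! i)"])
          (auto simp: part_def keys_restrict_poly in_cone_def)
      then show ?thesis unfolding N_nth[OF that] by (intro CollectI exI[of _ u]) simp
    qed
    then have y: "y \<in> (\<Pi>\<^sub>E i\<in>{..<length ?N}. ?N ! i)" by (auto simp: y_def)
    have sumV: "(\<Sum>i<length L. part i) \<in> polys {1..n}" using partV by (intro polys.sum_in)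
    have "Poly_Mapping.lookup (p - (\<Sum>i<length L. part i)) e = 0" if "vars e \<in> \<Delta>" for e
    proof -
      have "(\<Sum>i<length L. Poly_Mapping.lookup (part i) e)
          = (\<Sum>i\<in>{i. i < length L \<and> in_cone (L ! i) e}. Poly_Mapping.lookup p e)"
        unfolding part_def lookup_restrict_poly by (intro sum.mono_neutral_cong_right) auto
      also have "\<dots> = Poly_Mapping.lookup p e" using count[of e] that by simp
      finally show ?thesis by (simp add: lookup_minus lookup_sum)
    qed
    then have "p - (\<Sum>i<length L. part i) \<in> I"
      using p(1) sumV by (subst in_I_iff) (auto intro: polys.diff_in)
    then have "x = coset (\<Sum>i<length L. part i)" unfolding p(2) using coset_eq_iff p(1) sumV by blast
    also have "\<dots> = (\<Oplus>\<^bsub>M\<^esub>i\<in>{..<length ?N}. y i)"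
      unfolding length_map using partV by (intro finsum_coset[symmetric]) (auto simp: y_def)
    finally have sum: "x = (\<Oplus>\<^bsub>M\<^esub>i\<in>{..<length ?N}. y i)" .
    have "y' = y" if y': "y' \<in> (\<Pi>\<^sub>E i\<in>{..<length ?N}. ?N ! i)"
      "x = (\<Oplus>\<^bsub>M\<^esub>i\<in>{..<length ?N}. y' i)" for y'
    proof -
      have "\<exists>u. u \<in> polys (snd (L ! i)) \<and> y' i = coset (monomial (fst (L ! i)) * u)"
        if "i < length L" for i
        using PiE_mem[OF y'(1), of i] that N_nth[OF that] by auto
      then obtain u where u: "\<And>i. i < length L \<Longrightarrow>
          u i \<in> polys (snd (L ! i)) \<and> y' i = coset (monomial (fst (L ! i)) * u i)" by metis
      define q where "q i = monomial (fst (L ! i)) * u i" for i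
      have qV: "q i \<in> polys {1..n}" if "i < length L" for i
        unfolding q_def using u xV polysZ that by (intro polys.mult_in) blast+
      have qsumV: "(\<Sum>i<length L. q i) \<in> polys {1..n}" using qV by (intro polys.sum_in) auto
      have "x = coset (\<Sum>i<length L. q i)"
        unfolding y'(2) length_map using qV u by (intro finsum_coset) (auto simp: q_def)
      then have "(\<Sum>i<length L. q i) - p \<in> I" using p qsumV coset_eq_iff by metis
      then have diff: "Poly_Mapping.lookup (\<Sum>i<length L. q i) e = Poly_Mapping.lookup p e"
        if "vars e \<in> \<Delta>" for e
        using that in_I_iff[OF polys.diff_in[OF qsumV p(1)]] by (simp add: lookup_minus)
      have q_cone: "in_cone (L ! i) e" if "i < length L" "Poly_Mapping.lookup (q i) e \<noteq> 0" for i e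
        using cone_keys[of "u i" i e] u[OF that(1)] that(2) by (simp add: q_def in_keys_iff)
      have "q i = part i" if i: "i < length L" for i
      proof (rule poly_mapping_eqI)
        fix e
        show "Poly_Mapping.lookup (q i) e = Poly_Mapping.lookup (part i) e"
        proof (cases "in_cone (L ! i) e")
          case True
          have "Poly_Mapping.lookup (q j) e = 0" if "j < length L" "j \<noteq> i" for j
            using q_cone[OF that(1)] unique[OF that(1) i _ True] that(2) by blast
          then have "(\<Sum>j<length L. Poly_Mapping.lookup (q j) e) = Poly_Mapping.lookup (q i) e"
            using i by (subst sum.remove[of _ i]) auto
          then show ?thesis
            using diff[OF face[OF i True]] True by (simp add: lookup_sum part_def lookup_restrict_poly)
        next
          case False
          then show ?thesis using q_cone[OF i] by (auto simp: part_def lookup_restrict_poly)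
        qed
      qed
      then have "y' i = y i" if "i < length L" for i using u[OF that] that by (simp add: q_def y_def)
      then show ?thesis using y y'(1) by (intro PiE_ext) auto
    qed
    then show "\<exists>!y. y \<in> (\<Pi>\<^sub>E i\<in>{..<length ?N}. ?N ! i) \<and> x = (\<Oplus>\<^bsub>M\<^esub>i\<in>{..<length ?N}. y i)"
      using y sum by blast
  qed
  ultimately show ?thesis unfolding stanley_decomposition_def by blast
qed

lemma sdepth_eq_card_facet:
  assumes F: "F \<in> \<Delta>" "F \<subseteq> {1..n}" and facet: "\<And>v. v \<in> {1..n} - F \<Longrightarrow> insert v F \<notin> \<Delta>"
    and dec: "decomposable {1..n} (card F) \<Delta>"
  shows "sdepth n M (quotient_grading n I) = card F"
proof -
  let ?G = "quotient_grading n I"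
  have finF: "finite F" using F(2) finite_subset by blast
  have fin: "finite {card Z | m Z. (m, Z) \<in> set D}" for D :: "('k mpoly set \<times> nat set) list"
  proof -
    have "{card Z | m Z. (m, Z) \<in> set D} = (\<lambda>(m, Z). card Z) ` set D" by force
    then show ?thesis by simp
  qed
  have upper: "\<exists>Z. (\<exists>m. (m, Z) \<in> set D) \<and> sdepth_decomposition D \<le> card Z \<and> card Z \<le> card F"
    if D: "stanley_decomposition n M ?G D" for D
  proof -
    obtain m Z where mZ: "(m, Z) \<in> set D" "Z \<subseteq> F"
      using stanley_space_in_facet[OF F facet D] by blast
    have "sdepth_decomposition D \<le> card Z"
      unfolding sdepth_decomposition_def using fin mZ(1) by (intro Min_le) auto
    then show ?thesis using mZ card_mono[OF finF mZ(2)] by blast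
  qed
  obtain L where L: "cone_partition {1..n} \<Delta> L" "\<forall>(e, Z)\<in>set L. card F \<le> card Z"
    using decomposable_cone_partition[OF dec] by blast
  let ?D = "map (\<lambda>(e, Z). (coset (monomial e), Z)) L"
  have D: "stanley_decomposition n M ?G ?D" by (rule stanley_decomposition_of_cones[OF L(1)])
  let ?C = "{card Z | m Z. (m, Z) \<in> set ?D}"
  have "?C \<noteq> {}" using upper[OF D] by blast
  then have "card F \<le> sdepth_decomposition ?D"
    unfolding sdepth_decomposition_def using L(2) fin[of ?D] by (subst Min_ge_iff) auto
  moreover have "sdepth_decomposition ?D \<le> card F" using upper[OF D] by (meson le_trans)
  ultimately have "card F \<in> {sdepth_decomposition D | D. stanley_decomposition n M ?G D}"
    using D by (intro CollectI exI[of _ ?D]) auto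
  moreover have le: "l \<le> card F" if "l \<in> {sdepth_decomposition D | D. stanley_decomposition n M ?G D}" for l
    using that upper by (auto intro: le_trans)
  moreover have "finite {sdepth_decomposition D | D. stanley_decomposition n M ?G D}"
    using le by (meson finite_atMost finite_subset subsetI atMost_iff)
  ultimately show ?thesis unfolding sdepth_def by (intro Max_eqI)
qed

end

theorem proposition1p11:
  fixes n s :: nat
    and a b :: "nat \<Rightarrow> nat"
    and I :: "'k::field mpoly set"
  defines "I \<equiv> interval_ideal n s a b"
  assumes "1 \<le> n" and "s \<le> n"
    and "strict_mono_on {1..s} a" and "strict_mono_on {1..s} b"
    and "1 \<le> s \<Longrightarrow> 1 \<le> a 1" and "1 \<le> s \<Longrightarrow> b s \<le> n"
    and "\<And>i. i \<in> {1..s} \<Longrightarrow> a i \<le> b i"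
    and "\<And>k. 1 \<le> k \<Longrightarrow> k + 2 \<le> s \<Longrightarrow> a (k + 2) = b k + 1"
  shows "sdepth n (quotient_module (poly_ring {1..n}) I) (quotient_grading n I)
           = depth (poly_ring {1..n}) (graded_maximal_ideal n)
               (quotient_module (poly_ring {1..n}) I)
    \<and> depth (poly_ring {1..n}) (graded_maximal_ideal n) (quotient_module (poly_ring {1..n}) I)
           = n - s + s div 3"
proof -
  obtain Bs where Bs: "disjoint_blocks Bs" "\<Union>(set Bs) \<subseteq> {1..n}"
    and edges: "\<And>G. has_edge Bs G \<longleftrightarrow> (\<exists>k\<in>{1..s}. {a k..b k} \<subseteq> G)"
    and defect: "path_defect (length Bs) = s - s div 3"
    and nonempty: "length Bs \<noteq> 1 \<Longrightarrow> \<forall>i<length Bs. i mod 3 \<noteq> 1 \<longrightarrow> Bs ! i \<noteq> {}"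
    using interval_blocks[OF assms(4-9)] by blast
  let ?W = "\<Union>(set Bs)"
  obtain F where F: "F \<subseteq> ?W" "\<not> has_edge Bs F"
    "\<And>v. v \<in> ?W - F \<Longrightarrow> has_edge Bs (insert v F)"
    "card F + path_defect (length Bs) = card ?W"
    using path_facet[OF Bs(1) finite_subset[OF Bs(2)] nonempty] by blast
  define \<Delta> where "\<Delta> = path_complex ({1..n} - ?W) Bs"
  have \<Delta>: "G \<in> \<Delta> \<longleftrightarrow> G \<subseteq> {1..n} \<and> \<not> has_edge Bs G" for G
  proof -
    have "{1..n} - ?W \<union> ?W = {1..n}" using Bs(2) by blast
    then show ?thesis unfolding \<Delta>_def path_complex_def by simp
  qed
  have down: "down_closed \<Delta>"
    unfolding down_closed_def using \<Delta> has_edge_mono by (metis subset_trans)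
  have "{a k..b k} \<subseteq> {1..n}" if "k \<in> {1..s}" for k
  proof -
    have "1 \<le> a k" using assms(6) that strict_mono_onD[OF assms(4), of 1 k] by (cases "k = 1") auto
    moreover have "b k \<le> n"
      using assms(7) that strict_mono_onD[OF assms(5), of k s] by (cases "k = s") auto
    ultimately show ?thesis by auto
  qed
  then have "I = face_ideal {1..n} {G. \<not> (\<exists>k\<in>{1..s}. {a k..b k} \<subseteq> G)}"
    unfolding I_def by (rule interval_ideal_eq_face_ideal)
  also have "\<dots> = face_ideal {1..n} \<Delta>"
    unfolding face_ideal_def \<Delta> edges[symmetric] by (auto simp: in_polys_iff)
  finally have I: "I = face_ideal {1..n} \<Delta>" .
  \<comment> \<open>variables outside all intervals belong to every facet\<close>
  define F' where "F' = F \<union> ({1..n} - ?W)"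
  have "finite ?W" using Bs(2) finite_subset by blast
  have "card F' = card F + card ({1..n} - ?W)"
    unfolding F'_def using F(1) \<open>finite ?W\<close> by (intro card_Un_disjoint) (auto intro: finite_subset)
  moreover have "card ({1..n} - ?W) = n - card ?W" using card_Diff_subset[OF \<open>finite ?W\<close> Bs(2)] by simp
  moreover have "card ?W \<le> n" using card_mono[OF _ Bs(2)] by simp
  ultimately have card: "card F' + (s - s div 3) = n" using F(4) unfolding defect by linarith
  interpret face_quotient n \<Delta> "TYPE('k)" by unfold_locales (rule down)
  have "has_edge Bs F' \<longleftrightarrow> has_edge Bs F"
    using F(1) by (intro has_edge_cong) (auto simp: F'_def)
  then have "F' \<in> \<Delta>" "F' \<subseteq> {1..n}" using F Bs(2) by (auto simp: \<Delta> F'_def)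
  moreover have "insert v F' \<notin> \<Delta>" if "v \<in> {1..n} - F'" for v
  proof -
    have "has_edge Bs (insert v F)" using that by (intro F(3)) (auto simp: F'_def)
    then show ?thesis using has_edge_mono[of Bs "insert v F" "insert v F'"] by (auto simp: \<Delta> F'_def)
  qed
  moreover have "decomposable {1..n} (card F') \<Delta>"
    unfolding \<Delta>_def
  proof (rule decomposable_path)
    have "{1..n} - ?W \<union> ?W = {1..n}" using Bs(2) by blast
    then show "card F' + path_defect (length Bs) \<le> card ({1..n} - ?W \<union> ?W)"
      and "{1..n} - ?W \<union> ?W \<subseteq> {1..n}" using card defect by simp_all
  qed (use Bs(1) in auto)
  ultimately have "sdepth n M (quotient_grading n I) = card F'"
    "depth R (graded_maximal_ideal n) M = card F'"
    unfolding I using sdepth_eq_card_facet depth_eq_card_facet by blast+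
  moreover have "card F' = n - s + s div 3" using card assms(3) by linarith
  ultimately show ?thesis unfolding I by simp
qed

end
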